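(* Let $(X^{*},\mathcal{A}^{*},\mu^{*},T_{*})$ and $(Y^{*},\mathcal{B}^{*},\nu^{*},S_{*})$ be the Poisson suspensions over $(X,\mathcal{A},\mu,T)$ and $(Y,\mathcal{B},\nu,S)$, and let $(X^{*}\times Y^{*},\mathcal{A}^{*}\otimes\mathcal{B}^{*},\mathfrak{P},T_{*}\times S_{*})$ be a Poissonian joining between them (i.e. a joining such that $\mathfrak{P}$ is infinitely divisible). Then there exist $T$-invariant measures $\mu'$ and $\tilde\mu$ on $(X,\mathcal{A})$, $S$-invariant measures $\nu'$ and $\tilde\nu$ on $(Y,\mathcal{B})$, with $\mu=\mu'+\tilde\mu$ and $\nu=\nu'+\tilde\nu$, and a $T\times S$-invariant joining $\gamma$ of $\tilde\mu$ and $\tilde\nu$ (a measure on $X\times Y$ with marginals $\tilde\mu$ and $\tilde\nu$) such that, denoting by $\widetilde{\gamma^{*}}$ the image of the Poisson measure $\gamma^{*}$ under the mapping $\pi_X^{*}\times\pi_Y^{*}:(X\times Y)^{*}\to X^{*}\times Y^{*}$, $$\mathfrak{P}=\left(\mu'^{*}\otimes\delta_{\mu_{0}}\right)*\widetilde{\gamma^{*}}*\left(\delta_{\mu_{0}}\otimes\nu'^{*}\right),$$ where $\mu_0$ denotes the null measure.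
   Context: The bases $(X,\mathcal{A},\mu)$ and $(Y,\mathcal{B},\nu)$ are $\sigma$-finite Lebesgue spaces with continuous infinite measures, and $T$, $S$ are automorphisms (invertible measure preserving transformations). Poisson suspension: $X^{*}$ is the space of measures on $(X,\mathcal{A})$; $\mathcal{A}^{*}$ is generated by the maps $N(A):\xi\mapsto\xi(A)$, $A\in\mathcal{A}$; for a $\sigma$-finite measure $m$ on $X$, the Poisson measure $m^{*}$ is the probability measure on $X^*$ under which, for disjoint $A_1,\dots,A_k$ of finite $m$-measure, the $N(A_i)$ are independent Poisson variables of parameter $m(A_i)$ ($m^*=\delta_{\mu_0}$ if $m=0$); $T_{*}(\xi)=\xi\circ T^{-1}$. The mapping $\pi_X^{*}\times\pi_Y^{*}$ sends a measure $\xi$ on $X\times Y$ to $(\xi\circ\pi_X^{-1},\xi\circ\pi_Y^{-1})$, where $\pi_X,\pi_Y$ are the coordinate projections. The sum of two elements of $X^*$ is the sum of measures, and sums on $X^*\times Y^*$ are coordinatewise; $*$ between distributions on $X^{*}\times Y^{*}$ denotes the corresponding convolution. A probability measure is infinitely divisible if for every integer $n\ge1$ it is the $n$-th convolution power of some probability measure. A joining of the two suspensions is a $T_*\times S_*$-invariant probability measure on $X^*\times Y^*$ with marginals $\mu^*$ and $\nu^*$. *)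

theory Defs
  imports "HOL-Probability.Probability"
begin

section \<open>Lebesgue spaces and automorphisms\<close>

definition iso_mod_null :: "'a measure \<Rightarrow> 'b measure \<Rightarrow> bool" where
  "iso_mod_null M N \<longleftrightarrow>
    (\<exists>A\<in>null_sets M. \<exists>B\<in>null_sets N. \<exists>f g.
      (let M' = restrict_space M (space M - A); N' = restrict_space N (space N - B)
       in f \<in> M' \<rightarrow>\<^sub>M N' \<and> g \<in> N' \<rightarrow>\<^sub>M M' \<and>
          (\<forall>x\<in>space M'. g (f x) = x) \<and> (\<forall>y\<in>space N'. f (g y) = y) \<and>
          distr M' N' f = N'))"

text \<open>
  A \<open>\<sigma>\<close>-finite Lebesgue space is isomorphic modulo null sets to the real line with a
  \<open>\<sigma>\<close>-finite Borel measure, up to completion. Passing to completions on both sides covers the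
  convention in which Lebesgue spaces are complete as well as the one in which they are standard
  Borel spaces.
\<close>

definition sigma_finite_lebesgue_space :: "'a measure \<Rightarrow> bool" where
  "sigma_finite_lebesgue_space M \<longleftrightarrow> sigma_finite_measure M \<and>
    (\<exists>\<rho> :: real measure. sets \<rho> = sets borel \<and> sigma_finite_measure \<rho> \<and>
       iso_mod_null (completion M) (completion \<rho>))"

text \<open>
  In a Lebesgue space an atom is, up to a null set, a measurable singleton, and a non-measurable
  singleton has \<open>emeasure\<close> 0 by convention; so the following says that there are no atoms.
\<close>

definition continuous_measure :: "'a measure \<Rightarrow> bool" where
  "continuous_measure M \<longleftrightarrow> (\<forall>x\<in>space M. emeasure M {x} = 0)"

definition invariant_measure :: "'a measure \<Rightarrow> ('a \<Rightarrow> 'a) \<Rightarrow> 'a measure \<Rightarrow> bool" where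
  "invariant_measure M T m \<longleftrightarrow> sets m = sets M \<and> distr m M T = m"

definition automorphism :: "'a measure \<Rightarrow> ('a \<Rightarrow> 'a) \<Rightarrow> bool" where
  "automorphism M T \<longleftrightarrow>
    T \<in> M \<rightarrow>\<^sub>M M \<and> bij_betw T (space M) (space M) \<and>
    the_inv_into (space M) T \<in> M \<rightarrow>\<^sub>M M \<and> invariant_measure M T M"

definition joining ::
  "'a measure \<Rightarrow> ('a \<Rightarrow> 'a) \<Rightarrow> 'b measure \<Rightarrow> ('b \<Rightarrow> 'b) \<Rightarrow> ('a \<times> 'b) measure \<Rightarrow> bool" where
  "joining M T N S J \<longleftrightarrow>
    invariant_measure (M \<Otimes>\<^sub>M N) (map_prod T S) J \<and> distr J M fst = M \<and> distr J N snd = N"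

section \<open>Spaces of measures and Poisson measures\<close>

text \<open>
  All measures on the measurable space underlying \<open>M\<close>, with the \<open>\<sigma>\<close>-algebra generated by the
  evaluations; only \<open>sets M\<close> matters, not the measure \<open>M\<close> itself.
\<close>

definition measures_on :: "'a measure \<Rightarrow> 'a measure set" where
  "measures_on M = {\<xi>. sets \<xi> = sets M}"

definition measures_space :: "'a measure \<Rightarrow> 'a measure measure" where
  "measures_space M = sigma (measures_on M)
     {(\<lambda>\<xi>. emeasure \<xi> A) -` B \<inter> measures_on M | A B. A \<in> sets M \<and> B \<in> sets borel}"

text \<open>\<^const>\<open>poisson_pmf\<close> is only specified for positive parameters.\<close>

definition poisson_dist :: "real \<Rightarrow> nat pmf" where
  "poisson_dist r = (if r = 0 then return_pmf 0 else poisson_pmf r)"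

definition is_poisson_measure :: "'a measure \<Rightarrow> 'a measure measure \<Rightarrow> bool" where
  "is_poisson_measure m P \<longleftrightarrow>
    prob_space P \<and> sets P = sets (measures_space m) \<and>
    (\<forall>(k::nat) A. disjoint_family_on A {..<k} \<and>
        (\<forall>i<k. A i \<in> sets m \<and> emeasure m (A i) < \<infinity>) \<longrightarrow>
      prob_space.indep_vars P (\<lambda>_. borel) (\<lambda>i \<xi>. emeasure \<xi> (A i)) {..<k} \<and>
      (\<forall>i<k. distr P borel (\<lambda>\<xi>. emeasure \<xi> (A i)) =
             distr (measure_pmf (poisson_dist (measure m (A i)))) borel (of_nat :: nat \<Rightarrow> ennreal)))"

text \<open>
  For \<open>\<sigma>\<close>-finite \<open>m\<close> there is exactly one such probability measure. For \<open>m = 0\<close> it is the point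
  mass at the null measure.
\<close>

definition poisson_measure :: "'a measure \<Rightarrow> 'a measure measure" where
  "poisson_measure m = (THE P. is_poisson_measure m P)"

definition suspension_map :: "'a measure \<Rightarrow> ('a \<Rightarrow> 'a) \<Rightarrow> 'a measure \<Rightarrow> 'a measure" where
  "suspension_map M T \<xi> = distr \<xi> M T"

definition marginals_map ::
  "'a measure \<Rightarrow> 'b measure \<Rightarrow> ('a \<times> 'b) measure \<Rightarrow> 'a measure \<times> 'b measure" where
  "marginals_map M N \<xi> = (distr \<xi> M fst, distr \<xi> N snd)"

section \<open>Convolution and infinite divisibility\<close>

definition add_measure :: "'a measure \<Rightarrow> 'a measure \<Rightarrow> 'a measure" where
  "add_measure \<xi> \<eta> = measure_of (space \<xi>) (sets \<xi>) (\<lambda>A. emeasure \<xi> A + emeasure \<eta> A)"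

abbreviation pair_measures_space ::
  "'a measure \<Rightarrow> 'b measure \<Rightarrow> ('a measure \<times> 'b measure) measure" where
  "pair_measures_space M N \<equiv> measures_space M \<Otimes>\<^sub>M measures_space N"

definition convolution_pair ::
  "'a measure \<Rightarrow> 'b measure \<Rightarrow> ('a measure \<times> 'b measure) measure \<Rightarrow>
   ('a measure \<times> 'b measure) measure \<Rightarrow> ('a measure \<times> 'b measure) measure" where
  "convolution_pair M N P Q =
     distr (P \<Otimes>\<^sub>M Q) (pair_measures_space M N)
       (\<lambda>((\<xi>, \<eta>), (\<xi>', \<eta>')). (add_measure \<xi> \<xi>', add_measure \<eta> \<eta>'))"

primrec convolution_power ::
  "'a measure \<Rightarrow> 'b measure \<Rightarrow> ('a measure \<times> 'b measure) measure \<Rightarrow> nat \<Rightarrow>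
   ('a measure \<times> 'b measure) measure" where
  "convolution_power M N Q 0 =
     return (pair_measures_space M N) (null_measure M, null_measure N)"
| "convolution_power M N Q (Suc n) = convolution_pair M N Q (convolution_power M N Q n)"

definition infinitely_divisible ::
  "'a measure \<Rightarrow> 'b measure \<Rightarrow> ('a measure \<times> 'b measure) measure \<Rightarrow> bool" where
  "infinitely_divisible M N P \<longleftrightarrow>
    (\<forall>n\<ge>1. \<exists>Q. prob_space Q \<and> sets Q = sets (pair_measures_space M N) \<and>
       P = convolution_power M N Q n)"

definition poissonian_joining ::
  "'a measure \<Rightarrow> ('a \<Rightarrow> 'a) \<Rightarrow> 'b measure \<Rightarrow> ('b \<Rightarrow> 'b) \<Rightarrow>
   ('a measure \<times> 'b measure) measure \<Rightarrow> bool" where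
  "poissonian_joining M T N S P \<longleftrightarrow>
    prob_space P \<and>
    joining (poisson_measure M) (suspension_map M T) (poisson_measure N) (suspension_map N S) P \<and>
    infinitely_divisible M N P"

end

theory Submission
  imports Defs "HOL-Combinatorics.Multiset_Permutations" "HOL-Real_Asymp.Real_Asymp"
begin

text \<open>
  The only thing that has to be computed about a law on pairs of random measures \<open>(\<xi>, \<eta>)\<close> is its
  avoidance function \<open>v(A, B) = Prob(\<xi> A = 0, \<eta> B = 0)\<close>. The events \<open>{\<xi> A = 0, \<eta> B = 0}\<close> are closed
  under intersection, so \<open>v\<close> determines the law on the \<open>\<sigma>\<close>-algebra they generate. If a set can be
  cut so finely that, with probability close to one, all pieces have mass 0 or 1, then its mass is a
  limit of numbers of occupied pieces; so this \<open>\<sigma>\<close>-algebra is everything up to null sets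
  (\<open>prob_eq_if_avoidance_eq\<close>). A continuous Lebesgue space allows such fine partitions
  (\<open>diffuse_lebesgue_space\<close>, \<open>diffuse_dissection\<close>), and for a Poisson law the chance that a piece
  of mass \<open>r\<close> carries neither 0 nor 1 is at most \<open>r\<^sup>2\<close>. Convolution multiplies avoidance functions.

  Let now \<open>P\<close> be infinitely divisible with Poisson marginals, and let \<open>Q\<^sub>n\<close> be an \<open>n\<close>-th convolution
  root. Then \<open>v\<^sub>P\<close> is the \<open>n\<close>-th power of the avoidance function of \<open>Q\<^sub>n\<close>, and therefore
  \<open>n Q\<^sub>n(\<xi> A > 0, \<eta> B > 0)\<close> converges to \<open>g(A, B) = \<mu> A + \<nu> B + ln v\<^sub>P(A, B)\<close>. In terms of Levy measures:
  since the marginals are Poisson, the Levy measure of \<open>P\<close> is carried by the pairs \<open>(\<delta>\<^sub>x, 0)\<close>,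
  \<open>(\<delta>\<^sub>x, \<delta>\<^sub>y)\<close> and \<open>(0, \<delta>\<^sub>y)\<close>, and \<open>g(A, B)\<close> is the mass of the pairs \<open>(\<delta>\<^sub>x, \<delta>\<^sub>y)\<close> with \<open>x\<close> in \<open>A\<close>
  and \<open>y\<close> in \<open>B\<close>. The joining \<open>\<gamma>\<close> must give this mass to \<open>A \<times> B\<close>.

  That \<open>g\<close> extends to a measure on the product (\<open>bimeasure_extends\<close>) is proved by Caratheodory's
  theorem on rectangles. If countably many rectangles cover \<open>E \<times> F\<close>, then every pair of measures that
  charges \<open>E\<close> and \<open>F\<close> charges both sides of one of the covering rectangles (\<open>rectangle_null_cover\<close>), so
  the hitting probabilities under \<open>Q\<^sub>n\<close> are countably subadditive. This survives the limit because
  \<open>n Q\<^sub>n(\<xi> A > 0, \<eta> B > 0) \<le> \<mu> A \<nu> B / n + g(A, B)\<close> (\<open>hit_bound\<close>) and the error terms of disjoint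
  rectangles add up to the area of \<open>E \<times> F\<close> divided by \<open>n\<close>. Superadditivity holds because two disjoint
  rectangles are both hit with probability of order \<open>1 / n\<^sup>2\<close> only.

  The marginals of \<open>\<gamma>\<close> are dominated by \<open>\<mu>\<close> and \<open>\<nu>\<close>; the remainders are \<open>\<mu>'\<close> and \<open>\<nu>'\<close>. Invariance of
  \<open>P\<close> makes \<open>g\<close>, hence \<open>\<gamma>\<close>, its marginals and the remainders invariant. Finally, both sides of the
  claimed identity have the avoidance function
  \<open>exp (- \<mu>' A) \<cdot> exp (- \<gamma> (A \<times> Y \<union> X \<times> B)) \<cdot> exp (- \<nu>' B) = exp (- (\<mu> A + \<nu> B - \<gamma> (A \<times> B)))\<close>,
  so they are equal (\<open>law_decomposition\<close>). The existence and uniqueness of Poisson measures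
  (\<open>is_poisson_measure_poisson_measure\<close>) gives meaning to the factors on the right-hand side.
\<close>

section \<open>Spaces of measures\<close>

lemma space_measures_space [simp]: "space (measures_space M) = measures_on M"
  by (auto simp: measures_space_def space_measure_of_conv)

lemma sets_measures_space:
  "sets (measures_space M) = sigma_sets (measures_on M)
     {(\<lambda>\<xi>. emeasure \<xi> A) -` B \<inter> measures_on M | A B. A \<in> sets M \<and> B \<in> sets borel}"
  unfolding measures_space_def by (rule sets_measure_of) auto

lemma measures_space_cong:
  "sets M = sets M' \<Longrightarrow> measures_space M = measures_space M'"
  by (auto simp: measures_space_def measures_on_def)

lemma null_measure_in_measures_on [simp]: "null_measure M \<in> measures_on M"
  by (simp add: measures_on_def)

lemma measurable_emeasure_measures_space [measurable]:
  assumes "A \<in> sets M"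
  shows "(\<lambda>\<xi>. emeasure \<xi> A) \<in> borel_measurable (measures_space M)"
proof (rule measurableI)
  fix B :: "ennreal set" assume "B \<in> sets borel"
  then show "(\<lambda>\<xi>. emeasure \<xi> A) -` B \<inter> space (measures_space M) \<in> sets (measures_space M)"
    using assms by (auto simp: sets_measures_space intro!: sigma_sets.Basic)
qed auto

lemma measurable_measures_spaceI:
  assumes "\<And>\<omega>. \<omega> \<in> space K \<Longrightarrow> sets (f \<omega>) = sets M"
    and "\<And>A. A \<in> sets M \<Longrightarrow> (\<lambda>\<omega>. emeasure (f \<omega>) A) \<in> borel_measurable K"
  shows "f \<in> K \<rightarrow>\<^sub>M measures_space M"
  unfolding measures_space_def
proof (rule measurable_measure_of)
  fix y assume "y \<in> {(\<lambda>\<xi>. emeasure \<xi> A) -` B \<inter> measures_on M |A B. A \<in> sets M \<and> B \<in> sets borel}"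
  then obtain A B where y: "y = (\<lambda>\<xi>. emeasure \<xi> A) -` B \<inter> measures_on M" "A \<in> sets M" "B \<in> sets borel"
    by auto
  have "f -` y \<inter> space K = (\<lambda>\<omega>. emeasure (f \<omega>) A) -` B \<inter> space K"
    using assms(1) by (auto simp: y measures_on_def)
  also have "\<dots> \<in> sets K"
    using assms(2)[OF y(2)] y(3) by (rule measurable_sets)
  finally show "f -` y \<inter> space K \<in> sets K" .
qed (use assms(1) in \<open>auto simp: measures_on_def\<close>)

lemma sets_add_measure [simp]: "sets (add_measure \<xi> \<eta>) = sets \<xi>"
  by (simp add: add_measure_def)

lemma emeasure_add_measure:
  assumes "sets \<eta> = sets \<xi>"
  shows "emeasure (add_measure \<xi> \<eta>) A = emeasure \<xi> A + emeasure \<eta> A"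
proof (cases "A \<in> sets \<xi>")
  case True
  show ?thesis
  proof (rule emeasure_measure_of[OF add_measure_def])
    show "countably_additive (sets (add_measure \<xi> \<eta>)) (\<lambda>A. emeasure \<xi> A + emeasure \<eta> A)"
    proof (rule countably_additiveI)
      fix F :: "nat \<Rightarrow> 'a set"
      assume "range F \<subseteq> sets (add_measure \<xi> \<eta>)" "disjoint_family F"
      then show "(\<Sum>i. emeasure \<xi> (F i) + emeasure \<eta> (F i)) =
          emeasure \<xi> (\<Union> (range F)) + emeasure \<eta> (\<Union> (range F))"
        using assms by (simp add: suminf_add[symmetric] suminf_emeasure)
    qed
  qed (use True in \<open>auto simp: positive_def sets.space_closed dest: sets.sets_into_space\<close>)
next
  case False
  then show ?thesis using assms
    by (simp add: emeasure_notin_sets)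
qed

section \<open>Laws determined by avoidance probabilities\<close>

text \<open>
  The avoidance events \<open>{N c = 0}\<close> form a \<open>\<pi>\<close>-system, so both laws agree on the \<open>\<sigma>\<close>-algebra they
  generate. By \<open>dissect\<close> and the Borel-Cantelli lemma, \<open>N c\<close> is almost surely, for both laws, the
  limit of the numbers of occupied pieces of ever finer dissections of \<open>c\<close>, which are measurable for
  that \<open>\<sigma>\<close>-algebra. Hence every event equals one of its members up to a set that is null for both laws.
\<close>

theorem prob_eq_if_avoidance_eq:
  fixes P1 P2 :: "'w measure" and N :: "'c \<Rightarrow> 'w \<Rightarrow> ennreal" and I :: "'c set"
  assumes P1: "prob_space P1" and P2: "prob_space P2" and sets_eq: "sets P2 = sets P1"
    and meas: "\<And>c. c \<in> I \<Longrightarrow> N c \<in> borel_measurable P1"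
    and gen: "\<And>K. space K = space P1 \<Longrightarrow> (\<And>c. c \<in> I \<Longrightarrow> N c \<in> borel_measurable K) \<Longrightarrow>
      sets P1 \<subseteq> sets K"
    and join: "\<And>c c'. c \<in> I \<Longrightarrow> c' \<in> I \<Longrightarrow>
      \<exists>d\<in>I. \<forall>\<omega>\<in>space P1. N d \<omega> = 0 \<longleftrightarrow> N c \<omega> = 0 \<and> N c' \<omega> = 0"
    and avoid: "\<And>c. c \<in> I \<Longrightarrow>
      measure P1 {\<omega> \<in> space P1. N c \<omega> = 0} = measure P2 {\<omega> \<in> space P1. N c \<omega> = 0}"
    and dissect: "\<And>c \<epsilon>. c \<in> I \<Longrightarrow> 0 < \<epsilon> \<Longrightarrow>
      \<exists>(k::nat) d. (\<forall>j<k. d j \<in> I) \<and> (\<forall>\<omega>\<in>space P1. N c \<omega> = (\<Sum>j<k. N (d j) \<omega>)) \<and>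
        (\<Sum>j<k. measure P1 {\<omega> \<in> space P1. N (d j) \<omega> \<notin> {0, 1}}) \<le> \<epsilon> \<and>
        (\<Sum>j<k. measure P2 {\<omega> \<in> space P1. N (d j) \<omega> \<notin> {0, 1}}) \<le> \<epsilon>"
  shows "P1 = P2"
proof -
  interpret P1: prob_space P1 by fact
  interpret P2: prob_space P2 by fact
  have space_eq: "space P2 = space P1" using sets_eq by (rule sets_eq_imp_space_eq)
  define \<Omega> where "\<Omega> = space P1"
  define G where "G = (\<lambda>c. {\<omega> \<in> \<Omega>. N c \<omega> = 0}) ` I"
  have G_sets: "G \<subseteq> sets P1"
    using meas by (auto simp: G_def \<Omega>_def)
  have G_Pow: "G \<subseteq> Pow \<Omega>" by (auto simp: G_def)
  define K where "K = sigma \<Omega> G"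
  have sets_K: "sets K = sigma_sets \<Omega> G" and space_K: "space K = \<Omega>"
    using G_Pow by (auto simp: K_def)
  have K_sub: "sets K \<subseteq> sets P1"
    unfolding sets_K \<Omega>_def by (rule sets.sigma_sets_subset[OF G_sets])
  have Int_G: "Int_stable G"
  proof (rule Int_stableI)
    fix a b assume "a \<in> G" "b \<in> G"
    then obtain c c' where c: "c \<in> I" "c' \<in> I" "a = {\<omega> \<in> \<Omega>. N c \<omega> = 0}" "b = {\<omega> \<in> \<Omega>. N c' \<omega> = 0}"
      by (auto simp: G_def)
    obtain d where d: "d \<in> I" "\<And>\<omega>. \<omega> \<in> \<Omega> \<Longrightarrow> N d \<omega> = 0 \<longleftrightarrow> N c \<omega> = 0 \<and> N c' \<omega> = 0"
      using join[OF c(1,2)] by (auto simp: \<Omega>_def)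
    have "a \<inter> b = {\<omega> \<in> \<Omega>. N d \<omega> = 0}" using d(2) by (auto simp: c)
    then show "a \<inter> b \<in> G" using d(1) by (auto simp: G_def)
  qed
  have eq_K: "measure P1 E = measure P2 E" if "E \<in> sets K" for E
  proof -
    from Int_G G_Pow that[unfolded sets_K] show ?thesis
    proof (induction rule: sigma_sets_induct_disjoint)
      case (basic A)
      then show ?case using avoid by (auto simp: G_def \<Omega>_def)
    next
      case empty
      show ?case by simp
    next
      case (compl A)
      then have "A \<in> sets P1" using K_sub sets_K by auto
      then show ?case
        using compl P1.prob_compl[of A] P2.prob_compl[of A]
        by (simp add: \<Omega>_def space_eq sets_eq)
    next
      case (union A)
      have "A i \<in> sets P1" for i using union K_sub sets_K by auto
      then have "(\<lambda>i. measure P1 (A i)) sums measure P1 (\<Union>(range A))"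
        "(\<lambda>i. measure P2 (A i)) sums measure P2 (\<Union>(range A))"
        using union(1) by (auto intro!: P1.finite_measure_UNION P2.finite_measure_UNION simp: sets_eq)
      then show ?case using union(3) by (simp add: sums_iff)
    qed
  qed
  \<comment> \<open>the events that agree almost surely, under both laws, with an event in \<open>K\<close>\<close>
  define \<E> where "\<E> = {E \<in> sets P1. \<exists>E'\<in>sets K. (AE \<omega> in P1. \<omega> \<in> E \<longleftrightarrow> \<omega> \<in> E') \<and>
      (AE \<omega> in P2. \<omega> \<in> E \<longleftrightarrow> \<omega> \<in> E')}"
  have sa: "sigma_algebra \<Omega> \<E>"
    unfolding sigma_algebra_iff2
  proof (intro conjI ballI allI impI)
    show "\<E> \<subseteq> Pow \<Omega>" by (auto simp: \<E>_def \<Omega>_def dest: sets.sets_into_space)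
    show "{} \<in> \<E>" by (auto simp: \<E>_def intro!: bexI[of _ "{}"])
  next
    fix E assume "E \<in> \<E>"
    then obtain E' where E': "E' \<in> sets K" "AE \<omega> in P1. \<omega> \<in> E \<longleftrightarrow> \<omega> \<in> E'"
      "AE \<omega> in P2. \<omega> \<in> E \<longleftrightarrow> \<omega> \<in> E'" and E: "E \<in> sets P1" by (auto simp: \<E>_def)
    have "\<Omega> - E' \<in> sets K" using E'(1) space_K sets.compl_sets by blast
    moreover have "\<Omega> - E \<in> sets P1" using E by (auto simp: \<Omega>_def)
    moreover have "AE \<omega> in P1. \<omega> \<in> \<Omega> - E \<longleftrightarrow> \<omega> \<in> \<Omega> - E'" using E'(2) by eventually_elim auto
    moreover have "AE \<omega> in P2. \<omega> \<in> \<Omega> - E \<longleftrightarrow> \<omega> \<in> \<Omega> - E'" using E'(3) by eventually_elim auto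
    ultimately show "\<Omega> - E \<in> \<E>" unfolding \<E>_def by blast
  next
    fix A :: "nat \<Rightarrow> 'w set" assume "range A \<subseteq> \<E>"
    then have "\<forall>i. \<exists>E'. A i \<in> sets P1 \<and> E' \<in> sets K \<and> (AE \<omega> in P1. \<omega> \<in> A i \<longleftrightarrow> \<omega> \<in> E') \<and>
      (AE \<omega> in P2. \<omega> \<in> A i \<longleftrightarrow> \<omega> \<in> E')" by (auto simp: \<E>_def)
    then obtain E' where E': "\<And>i. A i \<in> sets P1" "\<And>i. E' i \<in> sets K"
      "\<And>i. AE \<omega> in P1. \<omega> \<in> A i \<longleftrightarrow> \<omega> \<in> E' i" "\<And>i. AE \<omega> in P2. \<omega> \<in> A i \<longleftrightarrow> \<omega> \<in> E' i"
      by metis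
    have "AE \<omega> in P1. \<forall>i. \<omega> \<in> A i \<longleftrightarrow> \<omega> \<in> E' i" "AE \<omega> in P2. \<forall>i. \<omega> \<in> A i \<longleftrightarrow> \<omega> \<in> E' i"
      using E' by (simp_all add: AE_all_countable)
    then have "AE \<omega> in P1. \<omega> \<in> (\<Union>i. A i) \<longleftrightarrow> \<omega> \<in> (\<Union>i. E' i)"
      "AE \<omega> in P2. \<omega> \<in> (\<Union>i. A i) \<longleftrightarrow> \<omega> \<in> (\<Union>i. E' i)" by (auto elim: eventually_mono)
    moreover have "(\<Union>i. E' i) \<in> sets K" "(\<Union>i. A i) \<in> sets P1" using E' by auto
    ultimately show "(\<Union>i. A i) \<in> \<E>" unfolding \<E>_def by blast
  qed
  define K' where "K' = sigma \<Omega> \<E>"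
  have space_K': "space K' = \<Omega>" and sets_K': "sets K' = \<E>"
    using sa by (auto simp: K'_def sigma_algebra.sets_measure_of_eq space_measure_of_conv)
  have N_meas: "N c \<in> borel_measurable K'" if c: "c \<in> I" for c
  proof (rule measurableI)
    fix D :: "ennreal set" assume D: "D \<in> sets borel"
    have "\<forall>n. \<exists>(k::nat) d. (\<forall>j<k. d j \<in> I) \<and> (\<forall>\<omega>\<in>space P1. N c \<omega> = (\<Sum>j<k. N (d j) \<omega>)) \<and>
        (\<Sum>j<k. measure P1 {\<omega> \<in> space P1. N (d j) \<omega> \<notin> {0, 1}}) \<le> (1/2)^n \<and>
        (\<Sum>j<k. measure P2 {\<omega> \<in> space P1. N (d j) \<omega> \<notin> {0, 1}}) \<le> (1/2)^n"
      using dissect[OF c] by simp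
    then obtain k :: "nat \<Rightarrow> nat" and d where kd: "\<forall>n. (\<forall>j<k n. d n j \<in> I) \<and>
        (\<forall>\<omega>\<in>space P1. N c \<omega> = (\<Sum>j<k n. N (d n j) \<omega>)) \<and>
        (\<Sum>j<k n. measure P1 {\<omega> \<in> space P1. N (d n j) \<omega> \<notin> {0, 1}}) \<le> (1/2)^n \<and>
        (\<Sum>j<k n. measure P2 {\<omega> \<in> space P1. N (d n j) \<omega> \<notin> {0, 1}}) \<le> (1/2)^n"
      unfolding choice_iff by blast
    have d: "d n j \<in> I" if "j < k n" for n j using kd that by blast
    have sum: "N c \<omega> = (\<Sum>j<k n. N (d n j) \<omega>)" if "\<omega> \<in> space P1" for n \<omega>
      using kd that by blast
    have small1: "(\<Sum>j<k n. measure P1 {\<omega> \<in> space P1. N (d n j) \<omega> \<notin> {0, 1}}) \<le> (1/2)^n" for n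
      using kd by blast
    have small2: "(\<Sum>j<k n. measure P2 {\<omega> \<in> space P1. N (d n j) \<omega> \<notin> {0, 1}}) \<le> (1/2)^n" for n
      using kd by blast
    \<comment> \<open>the number of occupied pieces; it equals \<open>N c\<close> off the set \<open>B n\<close> of probability at most \<open>(1/2) ^ n\<close>\<close>
    define X where "X = (\<lambda>n \<omega>. \<Sum>j<k n. (if N (d n j) \<omega> = 0 then 0 else 1 :: ennreal))"
    define B where "B = (\<lambda>n. \<Union>j<k n. {\<omega> \<in> space P1. N (d n j) \<omega> \<notin> {0, 1}})"
    have X_meas: "X n \<in> borel_measurable K" for n
    proof -
      have "{\<omega> \<in> space K. N (d n j) \<omega> = 0} \<in> sets K" if "j < k n" for j
        unfolding sets_K space_K using d[OF that] by (auto simp: G_def intro!: sigma_sets.Basic)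
      then show ?thesis unfolding X_def
        by (intro borel_measurable_sum measurable_If) auto
    qed
    have limsup_meas: "(\<lambda>\<omega>. limsup (\<lambda>n. X n \<omega>)) \<in> borel_measurable K"
      using X_meas by measurable
    define E' where "E' = (\<lambda>\<omega>. limsup (\<lambda>n. X n \<omega>)) -` D \<inter> space K"
    have E': "E' \<in> sets K" unfolding E'_def using limsup_meas D by (rule measurable_sets)
    have bad: "{\<omega> \<in> space P1. N (d n j) \<omega> \<notin> {0, 1}} \<in> sets P1" if "j < k n" for n j
      using meas[OF d[OF that]] by measurable
    have B_sets: "B n \<in> sets P1" for n
      unfolding B_def using bad[of _ n] by (intro sets.finite_UN) blast+
    have pB1: "measure P1 (B n) \<le> (1/2)^n" for n
      unfolding B_def
      by (rule order_trans[OF P1.finite_measure_subadditive_finite small1])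
        (rule finite_lessThan | rule image_subsetI, rule bad, simp)+
    have pB2: "measure P2 (B n) \<le> (1/2)^n" for n
      unfolding B_def
      by (rule order_trans[OF P2.finite_measure_subadditive_finite small2])
        (rule finite_lessThan | rule image_subsetI, unfold sets_eq, rule bad, simp)+
    have sm: "summable (\<lambda>n. (1/2::real)^n)" by (rule summable_geometric) simp
    have sm1: "summable (\<lambda>n. measure P1 (B n))" "summable (\<lambda>n. measure P2 (B n))"
      by (rule summable_comparison_test'[OF sm, of 0]; simp add: pB1 pB2)+
    have ae1: "AE \<omega> in P1. eventually (\<lambda>n. \<omega> \<in> space P1 - B n) sequentially"
      by (rule borel_cantelli_AE1) (auto simp: P1.emeasure_eq_measure B_sets sm1)
    have ae2: "AE \<omega> in P2. eventually (\<lambda>n. \<omega> \<in> space P2 - B n) sequentially"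
      by (rule borel_cantelli_AE1) (auto simp: P2.emeasure_eq_measure B_sets sets_eq sm1)
    have key: "\<omega> \<in> N c -` D \<inter> \<Omega> \<longleftrightarrow> \<omega> \<in> E'"
      if "eventually (\<lambda>n. \<omega> \<in> space P1 - B n) sequentially" for \<omega>
    proof -
      have om: "\<omega> \<in> \<Omega>" using eventually_happens[OF that] by (auto simp: \<Omega>_def)
      have "eventually (\<lambda>n. X n \<omega> = N c \<omega>) sequentially"
        using that
      proof eventually_elim
        case (elim n)
        have "X n \<omega> = (\<Sum>j<k n. N (d n j) \<omega>)"
          unfolding X_def using elim by (intro sum.cong) (auto simp: B_def)
        then show ?case using sum elim by simp
      qed
      then have "(\<lambda>n. X n \<omega>) \<longlonglongrightarrow> N c \<omega>" by (rule tendsto_eventually)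
      then have "limsup (\<lambda>n. X n \<omega>) = N c \<omega>" by (intro lim_imp_Limsup) auto
      then show ?thesis using om by (auto simp: E'_def space_K)
    qed
    have "N c -` D \<inter> \<Omega> \<in> sets P1" using meas[OF c] D by (auto simp: \<Omega>_def intro: measurable_sets)
    moreover have "AE \<omega> in P1. \<omega> \<in> N c -` D \<inter> \<Omega> \<longleftrightarrow> \<omega> \<in> E'"
      using ae1 by eventually_elim (rule key)
    moreover have "AE \<omega> in P2. \<omega> \<in> N c -` D \<inter> \<Omega> \<longleftrightarrow> \<omega> \<in> E'"
      using ae2 by eventually_elim (rule key, simp add: space_eq)
    ultimately show "N c -` D \<inter> space K' \<in> sets K'"
      using E' unfolding space_K' sets_K' \<E>_def by blast
  qed auto
  have sub: "sets P1 \<subseteq> \<E>"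
    using gen[of K', OF _ N_meas] by (simp add: space_K' sets_K' \<Omega>_def)
  show ?thesis
  proof (rule measure_eqI)
    fix E assume E: "E \<in> sets P1"
    then obtain E' where E': "E' \<in> sets K" "AE \<omega> in P1. \<omega> \<in> E \<longleftrightarrow> \<omega> \<in> E'"
      "AE \<omega> in P2. \<omega> \<in> E \<longleftrightarrow> \<omega> \<in> E'" using sub by (auto simp: \<E>_def)
    have "measure P1 E = measure P1 E'"
      using E'(2) E E'(1) K_sub by (intro P1.finite_measure_eq_AE) auto
    also have "\<dots> = measure P2 E'" by (rule eq_K) fact
    also have "\<dots> = measure P2 E"
      using E'(3) E E'(1) K_sub by (intro P2.finite_measure_eq_AE) (auto simp: sets_eq)
    finally show "emeasure P1 E = emeasure P2 E"
      by (simp add: P1.emeasure_eq_measure P2.emeasure_eq_measure)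
  qed (simp add: sets_eq)
qed

section \<open>Diffuse measures\<close>

text \<open>
  Absence of atoms, witnessed by a real coordinate with null fibres. In this form it passes at once to
  smaller measures and to every measure on a product one of whose marginals has the property.
\<close>

definition diffuse :: "'a measure \<Rightarrow> bool" where
  "diffuse m \<longleftrightarrow> (\<exists>h\<in>borel_measurable m. \<forall>y::real. emeasure m (h -` {y} \<inter> space m) = 0)"

text \<open>
  The distribution function of the coordinate on \<open>C\<close> is continuous, hence uniformly continuous on a
  compact interval outside of which little mass lies; the pieces of \<open>C\<close> are cut out by a fine grid on
  this interval and the two tails.
\<close>

lemma diffuse_dissection:
  assumes "diffuse m" and C: "C \<in> sets m" "emeasure m C < \<infinity>" and "0 < \<epsilon>"
  obtains k :: nat and D where "disjoint_family_on D {..<k}"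
    "\<And>j. j < k \<Longrightarrow> D j \<in> sets m" "C = (\<Union>j<k. D j)"
    "\<And>j. j < k \<Longrightarrow> measure m (D j) \<le> \<epsilon>"
proof -
  obtain h :: "'a \<Rightarrow> real" where h[measurable]: "h \<in> borel_measurable m"
    and fibre: "\<And>y. emeasure m (h -` {y} \<inter> space m) = 0"
    using assms(1) by (auto simp: diffuse_def)
  have [measurable]: "C \<in> sets m" by fact
  have Csp: "C \<subseteq> space m" using C(1) by (rule sets.sets_into_space)
  define lw where "lw = distr (restrict_space m C) borel h"
  have em: "emeasure lw B = emeasure m {x\<in>C. h x \<in> B}" if [measurable]: "B \<in> sets borel" for B
  proof -
    have "emeasure lw B = emeasure (restrict_space m C) (h -` B \<inter> space (restrict_space m C))"
      unfolding lw_def by (rule emeasure_distr) (auto intro: measurable_restrict_space1)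
    also have "h -` B \<inter> space (restrict_space m C) = {x\<in>C. h x \<in> B}"
      using Csp by (auto simp: space_restrict_space)
    also have "emeasure (restrict_space m C) {x\<in>C. h x \<in> B} = emeasure m {x\<in>C. h x \<in> B}"
      using Csp C(1) by (intro emeasure_restrict_space) auto
    finally show ?thesis .
  qed
  interpret L: finite_borel_measure lw
  proof (intro finite_borel_measure.intro finite_measureI finite_borel_measure_axioms.intro)
    have "emeasure lw UNIV = emeasure m C" by (simp add: em)
    then show "emeasure lw (space lw) \<noteq> \<infinity>" using C(2) by (simp add: lw_def)
  qed (simp add: lw_def)
  have me: "measure lw B = measure m {x\<in>C. h x \<in> B}" if "B \<in> sets borel" for B
    using em[OF that] by (simp add: measure_def)
  have "measure lw {y} = 0" for y
  proof -
    have "emeasure m {x\<in>C. h x \<in> {y}} \<le> emeasure m (h -` {y} \<inter> space m)"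
      using Csp by (intro emeasure_mono) auto
    then show ?thesis using fibre[of y] by (simp add: em measure_def)
  qed
  then have cont: "isCont (cdf lw) y" for y by (simp add: L.isCont_cdf)
  have "eventually (\<lambda>y. cdf lw y < \<epsilon>) at_bot"
    using L.cdf_lim_at_bot \<open>0 < \<epsilon>\<close> by (rule order_tendstoD)
  then obtain R1 where R1: "\<And>y. y \<le> R1 \<Longrightarrow> cdf lw y < \<epsilon>" by (auto simp: eventually_at_bot_linorder)
  have "eventually (\<lambda>y. measure lw (space lw) - \<epsilon> < cdf lw y) at_top"
    using L.cdf_lim_at_top by (rule order_tendstoD) (use \<open>0 < \<epsilon>\<close> in simp)
  then obtain R2 where R2: "\<And>y. R2 \<le> y \<Longrightarrow> measure lw (space lw) - \<epsilon> < cdf lw y"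
    by (auto simp: eventually_at_top_linorder)
  define R where "R = max 1 (max (-R1) R2)"
  have R: "0 < R" "cdf lw (-R) < \<epsilon>" "measure lw (space lw) - \<epsilon> < cdf lw R"
    using R1[of "-R"] R2[of R] by (auto simp: R_def)
  have "uniformly_continuous_on {-R..R} (cdf lw)"
    using cont by (intro compact_uniformly_continuous continuous_at_imp_continuous_on) auto
  then obtain \<delta> where \<delta>: "0 < \<delta>"
    "\<And>x y. x \<in> {-R..R} \<Longrightarrow> y \<in> {-R..R} \<Longrightarrow> \<bar>y - x\<bar> < \<delta> \<Longrightarrow> \<bar>cdf lw y - cdf lw x\<bar> < \<epsilon>"
    unfolding uniformly_continuous_on_def dist_real_def using \<open>0 < \<epsilon>\<close> by metis
  obtain k :: nat where k0: "2 * R / \<delta> < real k" using reals_Archimedean2 by blast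
  have "0 < 2 * R / \<delta>" using R \<delta> by simp
  then have kpos: "0 < real k" using k0 by linarith
  define w where "w = 2 * R / real k"
  have w: "0 < w" "w < \<delta>" using R \<delta> kpos k0 by (auto simp: w_def field_simps)
  have kw: "real k * w = 2 * R" using kpos by (simp add: w_def)
  \<comment> \<open>the number of the grid cell of \<open>y\<close>: 0 and \<open>k + 1\<close> stand for the two tails\<close>
  define J where "J = (\<lambda>y::real. nat (min (int k + 1) \<lceil>(y + R) / w\<rceil>))"
  have [measurable]: "J \<in> borel \<rightarrow>\<^sub>M count_space UNIV"
    unfolding J_def by measurable
  define D where "D = (\<lambda>j. {x\<in>C. h x \<in> J -` {j}})"
  have J_sets: "J -` {j} \<in> sets borel" for j
    using measurable_sets[of J borel "count_space UNIV" "{j}"] by simp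
  have small: "measure lw (J -` {j}) \<le> \<epsilon>" if jk: "j < k + 2" for j
  proof -
    consider "j = 0" | "j = k + 1" | "0 < j" "j \<le> k" using jk by linarith
    then show ?thesis
    proof cases
      case 1
      have "y \<le> - R" if "J y = 0" for y
      proof -
        have "\<lceil>(y + R) / w\<rceil> \<le> 0" using that by (auto simp: J_def min_def split: if_splits)
        then have "(y + R) / w \<le> 0" by linarith
        then show ?thesis using w by (simp add: divide_le_0_iff)
      qed
      then have "measure lw (J -` {j}) \<le> measure lw {..-R}"
        using 1 by (intro L.finite_measure_mono) auto
      then show ?thesis using R(2) by (simp add: cdf_def)
    next
      case 2
      have "R < y" if "J y = k + 1" for y
      proof -
        have "int k + 1 \<le> \<lceil>(y + R) / w\<rceil>" using that by (auto simp: J_def min_def split: if_splits)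
        then have "real k < (y + R) / w" by linarith
        then have "real k * w < y + R" using w by (simp add: field_simps)
        then show ?thesis using kw by simp
      qed
      then have "measure lw (J -` {j}) \<le> measure lw (space lw - {..R})"
        using 2 by (intro L.finite_measure_mono) (auto simp: lw_def simp flip: not_less)
      also have "\<dots> = measure lw (space lw) - cdf lw R"
        unfolding cdf_def by (rule L.finite_measure_compl) (simp add: lw_def)
      finally show ?thesis using R(3) by simp
    next
      case 3
      define a b where "a = -R + (real j - 1) * w" and "b = -R + real j * w"
      have "a < y \<and> y \<le> b" if "J y = j" for y
      proof -
        have "\<lceil>(y + R) / w\<rceil> = int j" using that 3 by (auto simp: J_def min_def split: if_splits)
        then have "real j - 1 < (y + R) / w" "(y + R) / w \<le> real j" by linarith+
        then show ?thesis using w by (simp add: field_simps a_def b_def)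
      qed
      then have "measure lw (J -` {j}) \<le> measure lw {a<..b}"
        by (intro L.finite_measure_mono) auto
      also have "\<dots> = cdf lw b - cdf lw a"
        using w by (intro L.cdf_diff_eq[symmetric]) (auto simp: a_def b_def algebra_simps)
      also have "\<dots> \<le> \<epsilon>"
      proof -
        have "real j * w \<le> real k * w" "0 \<le> (real j - 1) * w"
          using 3 w by (auto intro!: mult_right_mono mult_nonneg_nonneg)
        then have "-R \<le> a" "b \<le> R" unfolding a_def b_def using kw by linarith+
        moreover have "b = a + w" by (simp add: a_def b_def algebra_simps)
        ultimately have "a \<in> {-R..R}" "b \<in> {-R..R}" "\<bar>b - a\<bar> < \<delta>" using w by auto
        then show ?thesis using \<delta>(2)[of a b] by linarith
      qed
      finally show ?thesis .
    qed
  qed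
  show ?thesis
  proof (rule that[of D "k + 2"])
    show "disjoint_family_on D {..<k + 2}" by (auto simp: disjoint_family_on_def D_def)
    show "D j \<in> sets m" for j unfolding D_def using J_sets[of j] by measurable
    have "J y < k + 2" for y by (auto simp: J_def min_def)
    then show "C = (\<Union>j<k + 2. D j)" by (auto simp: D_def)
    show "measure m (D j) \<le> \<epsilon>" if "j < k + 2" for j
      using small[OF that] J_sets[of j] by (simp add: me D_def)
  qed
qed

text \<open>
  If all pieces have mass at most \<open>\<delta>\<close>, then the squares of their masses add up to at most
  \<open>\<delta>\<close> times the mass of \<open>C\<close>. The squares bound the probabilities of multiple points.
\<close>

lemma diffuse_dissection_squares:
  assumes "diffuse m" and C: "C \<in> sets m" "emeasure m C < \<infinity>" and "0 < \<epsilon>"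
  obtains k :: nat and D where "disjoint_family_on D {..<k}"
    "\<And>j. j < k \<Longrightarrow> D j \<in> sets m" "\<And>j. j < k \<Longrightarrow> emeasure m (D j) < \<infinity>" "C = (\<Union>j<k. D j)"
    "(\<Sum>j<k. (measure m (D j))\<^sup>2) \<le> \<epsilon>"
proof -
  define \<delta> where "\<delta> = \<epsilon> / (measure m C + 1)"
  have pos: "0 < measure m C + 1" using measure_nonneg[of m C] by linarith
  have "0 < \<delta>" using \<open>0 < \<epsilon>\<close> pos by (simp add: \<delta>_def)
  obtain k :: nat and D where D: "disjoint_family_on D {..<k}"
    "\<And>j. j < k \<Longrightarrow> D j \<in> sets m" "C = (\<Union>j<k. D j)" "\<And>j. j < k \<Longrightarrow> measure m (D j) \<le> \<delta>"
    using diffuse_dissection[OF assms(1) C \<open>0 < \<delta>\<close>] by metis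
  have fin: "emeasure m (D j) < \<infinity>" if "j < k" for j
    using emeasure_mono[of "D j" C m] that D(3) C by (auto intro: le_less_trans)
  have "(\<Sum>j<k. (measure m (D j))\<^sup>2) \<le> (\<Sum>j<k. \<delta> * measure m (D j))"
    using D(4) by (intro sum_mono) (auto simp: power2_eq_square intro!: mult_right_mono)
  also have "\<dots> = \<delta> * measure m C"
    unfolding D(3) sum_distrib_left[symmetric] using fin D
    by (subst measure_finite_Union) (auto simp: less_top)
  also have "\<dots> \<le> \<delta> * (measure m C + 1)"
    using \<open>0 < \<delta>\<close> by simp
  also have "\<dots> = \<epsilon>" using pos by (simp add: \<delta>_def)
  finally show ?thesis using that[of D k] D fin by blast
qed

lemma diffuse_if_le:
  assumes "diffuse m" "sets m' = sets m" "\<And>A. A \<in> sets m \<Longrightarrow> emeasure m' A \<le> emeasure m A"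
  shows "diffuse m'"
proof -
  obtain h :: "'a \<Rightarrow> real" where h[measurable]: "h \<in> borel_measurable m"
    and fibre: "\<And>y. emeasure m (h -` {y} \<inter> space m) = 0"
    using assms(1) by (auto simp: diffuse_def)
  have sp: "space m' = space m" using assms(2) by (rule sets_eq_imp_space_eq)
  have "emeasure m' (h -` {y} \<inter> space m') = 0" for y
    using assms(3)[of "h -` {y} \<inter> space m"] fibre[of y] by (simp add: sp)
  moreover have "h \<in> borel_measurable m'" using h by (subst measurable_cong_sets[OF assms(2) refl])
  ultimately show ?thesis unfolding diffuse_def by (intro bexI[of _ h]) auto
qed

lemma diffuse_if_marginal:
  fixes m :: "'a measure" and M :: "'b measure"
  assumes "diffuse (distr m M f)" "f \<in> m \<rightarrow>\<^sub>M M"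
  shows "diffuse m"
proof -
  obtain h :: "'b \<Rightarrow> real" where h[measurable]: "h \<in> borel_measurable (distr m M f)"
    and fibre: "\<And>y. emeasure (distr m M f) (h -` {y} \<inter> space M) = 0"
    using assms(1) by (auto simp: diffuse_def)
  have [measurable]: "h \<in> borel_measurable M" "f \<in> m \<rightarrow>\<^sub>M M" using h assms(2) by simp_all
  have "emeasure m ((\<lambda>x. h (f x)) -` {y} \<inter> space m) = 0" for y
  proof -
    have "emeasure (distr m M f) (h -` {y} \<inter> space M) = emeasure m (f -` (h -` {y} \<inter> space M) \<inter> space m)"
      by (rule emeasure_distr) auto
    also have "f -` (h -` {y} \<inter> space M) \<inter> space m = (\<lambda>x. h (f x)) -` {y} \<inter> space m"
      using measurable_space[OF assms(2)] by auto
    finally show ?thesis using fibre by simp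
  qed
  then show ?thesis unfolding diffuse_def by (intro bexI[of _ "\<lambda>x. h (f x)"]) auto
qed

text \<open>
  The coordinate is a version, measurable for the \<open>\<sigma>\<close>-algebra of \<open>M\<close> itself, of the isomorphism with the
  real line, which is measurable for the completion only. A fibre of the isomorphism is a singleton;
  the singleton is null in the completion because its main part is empty or the singleton itself.
\<close>

lemma diffuse_lebesgue_space:
  assumes "sigma_finite_lebesgue_space M" "continuous_measure M"
  shows "diffuse M"
proof -
  obtain \<rho> :: "real measure" and A B f g where \<rho>: "sets \<rho> = sets borel"
    and A: "A \<in> null_sets (completion M)" and B: "B \<in> null_sets (completion \<rho>)"
    and f: "f \<in> restrict_space (completion M) (space (completion M) - A) \<rightarrow>\<^sub>M
      restrict_space (completion \<rho>) (space (completion \<rho>) - B)"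
    and gf: "\<And>x. x \<in> space (restrict_space (completion M) (space (completion M) - A)) \<Longrightarrow> g (f x) = x"
    using assms(1) unfolding sigma_finite_lebesgue_space_def iso_mod_null_def Let_def by blast
  define M' where "M' = restrict_space (completion M) (space (completion M) - A)"
  have gf': "g (f x) = x" if "x \<in> space M'" for x
    using gf that by (simp add: M'_def)
  have A_sets: "A \<in> sets (completion M)" using A by auto
  have space_M': "space M' = space M - A" by (auto simp: M'_def space_restrict_space)
  have f': "f \<in> borel_measurable M'"
  proof (rule measurableI)
    fix D :: "real set" assume "D \<in> sets borel"
    then have "D \<inter> (space (completion \<rho>) - B) \<in>
        sets (restrict_space (completion \<rho>) (space (completion \<rho>) - B))"
      using \<rho> by (auto simp: sets_restrict_space)
    from measurable_sets[OF f this]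
    have "f -` (D \<inter> (space (completion \<rho>) - B)) \<inter> space M' \<in> sets M'" by (simp add: M'_def)
    also have "f -` (D \<inter> (space (completion \<rho>) - B)) \<inter> space M' = f -` D \<inter> space M'"
      using measurable_space[OF f] by (auto simp: space_restrict_space M'_def)
    finally show "f -` D \<inter> space M' \<in> sets M'" .
  qed auto
  have sub: "S \<in> sets (completion M)" if "S \<in> sets M'" for S
    using that A_sets by (auto simp: M'_def sets_restrict_space)
  define h0 where "h0 = (\<lambda>x. if x \<in> space M - A then f x else 0)"
  have "h0 \<in> borel_measurable (completion M)"
  proof (rule measurableI)
    fix D :: "real set" assume D: "D \<in> sets borel"
    have "f -` D \<inter> space M' \<in> sets (completion M)" using f' D by (intro sub measurable_sets)
    moreover have "h0 -` D \<inter> space (completion M) =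
        (f -` D \<inter> space M') \<union> (if 0 \<in> D then A else {})"
      using sets.sets_into_space[OF A_sets] by (auto simp: h0_def space_M' split: if_splits)
    ultimately show "h0 -` D \<inter> space (completion M) \<in> sets (completion M)" using A_sets by simp
  qed auto
  then obtain h where h[measurable]: "h \<in> borel_measurable M" and hh0: "AE x in M. h0 x = h x"
    using completion_ex_borel_measurable_real by blast
  have "emeasure M (h -` {y} \<inter> space M) = 0" for y
  proof -
    have ae: "AE x in completion M. h0 x = h x" using hh0 by (rule AE_completion)
    have aeA: "AE x in completion M. x \<notin> A" using A by (rule AE_not_in)
    have "AE x in completion M. h x \<noteq> y"
    proof (cases "\<exists>x0\<in>space M'. f x0 = y")
      case False
      show ?thesis using ae aeA AE_space
        by eventually_elim (use False in \<open>auto simp: h0_def space_M'\<close>)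
    next
      case True
      then obtain x0 where x0: "x0 \<in> space M'" "f x0 = y" by blast
      have "f -` {y} \<inter> space M' = {x0}"
      proof -
        have "x = x0" if "x \<in> space M'" "f x = y" for x
          using gf'[of x] gf'[of x0] that x0 by metis
        then show ?thesis using x0 by blast
      qed
      then have "{x0} \<in> sets M'" using measurable_sets[OF f', of "{y}"] by simp
      then have x0c: "{x0} \<in> sets (completion M)" by (rule sub)
      have mp1: "main_part M {x0} \<subseteq> {x0}" using main_part_null_part_Un[OF x0c] by blast
      have mp2: "main_part M {x0} \<in> sets M" using x0c by (rule main_part_sets)
      consider "main_part M {x0} = {}" | "main_part M {x0} = {x0}" using mp1 by blast
      then have mp0: "emeasure M (main_part M {x0}) = 0"
      proof cases
        case 2
        then show ?thesis using assms(2) x0(1) by (simp add: continuous_measure_def space_M')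
      qed simp
      have "emeasure (completion M) {x0} = emeasure M (main_part M {x0})"
        using x0c by (rule emeasure_completion)
      also note mp0
      finally have "{x0} \<in> null_sets (completion M)" using x0c by auto
      then have "AE x in completion M. x \<notin> {x0}" by (rule AE_not_in)
      then show ?thesis using ae aeA AE_space
      proof eventually_elim
        case (elim x)
        then have "x \<in> space M'" by (auto simp: space_M')
        then have "f x = y \<Longrightarrow> x = x0" using gf'[of x] gf'[of x0] x0 by metis
        then show ?case using elim by (auto simp: h0_def)
      qed
    qed
    then have "AE x in M. h x \<noteq> y" by (simp add: AE_completion_iff)
    then have "emeasure M {x\<in>space M. \<not> h x \<noteq> y} = 0"
      by (subst (asm) AE_iff_measurable[OF _ refl]) auto
    moreover have "{x\<in>space M. \<not> h x \<noteq> y} = h -` {y} \<inter> space M" by auto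
    ultimately show ?thesis by simp
  qed
  then show ?thesis unfolding diffuse_def using h by blast
qed

section \<open>Poisson measures\<close>

lemma pmf_poisson_dist:
  assumes "0 \<le> r"
  shows "pmf (poisson_dist r) k = r ^ k / fact k * exp (- r)"
  using assms by (cases k) (auto simp: poisson_dist_def)

lemma poisson_dist_multiple:
  assumes "0 \<le> r"
  shows "measure (measure_pmf (poisson_dist r)) {n. n \<notin> {0, 1}} \<le> r\<^sup>2"
proof -
  have "measure (measure_pmf (poisson_dist r)) (UNIV - {0, 1}) =
      1 - measure (measure_pmf (poisson_dist r)) {0, 1}"
    using measure_pmf.prob_compl[of "{0,1}" "poisson_dist r"] by simp
  also have "measure (measure_pmf (poisson_dist r)) {0, 1} = exp (- r) * (1 + r)"
    using assms by (subst measure_measure_pmf_finite) (auto simp: pmf_poisson_dist algebra_simps)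
  also have "1 - \<dots> \<le> 1 - (1 - r) * (1 + r)"
    using exp_ge_add_one_self[of "-r"] assms by (intro diff_left_mono mult_right_mono) auto
  also have "\<dots> = r\<^sup>2" by (simp add: power2_eq_square algebra_simps)
  also have "UNIV - {0, 1} = {n::nat. n \<notin> {0, 1}}" by auto
  finally show ?thesis .
qed

text \<open>
  Two properties of a Poisson measure that are easy to transport and that characterise it when the
  intensity is diffuse and \<open>\<sigma>\<close>-finite: by \<open>poisson_like_unique\<close> they determine the law, and by
  \<open>poisson_like_imp_is_poisson_measure\<close> they imply independence and Poisson marginals.
\<close>

definition poisson_like :: "'a measure \<Rightarrow> 'a measure measure \<Rightarrow> bool" where
  "poisson_like m P \<longleftrightarrow> prob_space P \<and> sets P = sets (measures_space m) \<and>
    (\<forall>A\<in>sets m. emeasure m A < \<infinity> \<longrightarrow>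
      measure P {\<xi> \<in> space P. emeasure \<xi> A = 0} = exp (- measure m A) \<and>
      measure P {\<xi> \<in> space P. emeasure \<xi> A \<notin> {0, 1}} \<le> (measure m A)\<^sup>2)"

lemma poisson_likeD:
  assumes "poisson_like m P"
  shows "prob_space P" "sets P = sets (measures_space m)" "space P = measures_on m"
    "A \<in> sets m \<Longrightarrow> emeasure m A < \<infinity> \<Longrightarrow>
      measure P {\<xi> \<in> space P. emeasure \<xi> A = 0} = exp (- measure m A)"
    "A \<in> sets m \<Longrightarrow> emeasure m A < \<infinity> \<Longrightarrow>
      measure P {\<xi> \<in> space P. emeasure \<xi> A \<notin> {0, 1}} \<le> (measure m A)\<^sup>2"
proof -
  show *: "prob_space P" "sets P = sets (measures_space m)"
    using assms by (auto simp: poisson_like_def)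
  show "space P = measures_on m" using sets_eq_imp_space_eq[OF *(2)] by simp
qed (use assms in \<open>auto simp: poisson_like_def\<close>)

lemma emeasure_eq_suminf_pieces:
  assumes "disjoint_family D" "range D \<subseteq> sets \<xi>" "(\<Union>i. D i) = space \<xi>" "A \<in> sets \<xi>"
  shows "emeasure \<xi> A = (\<Sum>i::nat. emeasure \<xi> (A \<inter> D i))"
proof -
  have "(\<Sum>i. emeasure \<xi> (A \<inter> D i)) = emeasure \<xi> (\<Union>i. A \<inter> D i)"
    using assms by (intro suminf_emeasure) (auto simp: disjoint_family_on_def)
  also have "(\<Union>i. A \<inter> D i) = A"
    using assms sets.sets_into_space[OF assms(4)] by auto
  finally show ?thesis by simp
qed

lemma measurable_measures_space_sigma_finiteI:
  assumes "sigma_finite_measure m" and f: "\<And>\<omega>. \<omega> \<in> space K \<Longrightarrow> sets (f \<omega>) = sets m"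
    and N: "\<And>A. A \<in> sets m \<Longrightarrow> emeasure m A < \<infinity> \<Longrightarrow>
      (\<lambda>\<omega>. emeasure (f \<omega>) A) \<in> borel_measurable K"
  shows "f \<in> K \<rightarrow>\<^sub>M measures_space m"
proof (rule measurable_measures_spaceI)
  interpret sigma_finite_measure m by fact
  obtain D :: "nat \<Rightarrow> 'a set" where D: "range D \<subseteq> sets m" "(\<Union>i. D i) = space m"
    "\<And>i. emeasure m (D i) \<noteq> \<infinity>" "disjoint_family D"
    using sigma_finite_disjoint by metis
  fix A assume A: "A \<in> sets m"
  have "(\<lambda>\<omega>. emeasure (f \<omega>) (A \<inter> D i)) \<in> borel_measurable K" for i
  proof (rule N)
    show "A \<inter> D i \<in> sets m" using A D by auto
    have "emeasure m (A \<inter> D i) \<le> emeasure m (D i)" using D by (intro emeasure_mono) auto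
    then show "emeasure m (A \<inter> D i) < \<infinity>" using D(3)[of i] by (auto simp: less_top[symmetric] top_unique)
  qed
  then have "(\<lambda>\<omega>. \<Sum>i. emeasure (f \<omega>) (A \<inter> D i)) \<in> borel_measurable K" by measurable
  moreover have "emeasure (f \<omega>) A = (\<Sum>i. emeasure (f \<omega>) (A \<inter> D i))" if "\<omega> \<in> space K" for \<omega>
  proof (rule emeasure_eq_suminf_pieces)
    note s = f[OF that]
    show "range D \<subseteq> sets (f \<omega>)" "A \<in> sets (f \<omega>)" "(\<Union>i. D i) = space (f \<omega>)" "disjoint_family D"
      using s sets_eq_imp_space_eq[OF s] D A by auto
  qed
  ultimately show "(\<lambda>\<omega>. emeasure (f \<omega>) A) \<in> borel_measurable K"
    by (simp cong: measurable_cong)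
qed (use f in auto)

lemma emeasure_Un_eq_0_iff:
  assumes "A \<in> sets \<xi>" "B \<in> sets \<xi>"
  shows "emeasure \<xi> (A \<union> B) = 0 \<longleftrightarrow> emeasure \<xi> A = 0 \<and> emeasure \<xi> B = 0"
proof
  assume "emeasure \<xi> (A \<union> B) = 0"
  moreover have "emeasure \<xi> A \<le> emeasure \<xi> (A \<union> B)" "emeasure \<xi> B \<le> emeasure \<xi> (A \<union> B)"
    using assms by (auto intro!: emeasure_mono)
  ultimately show "emeasure \<xi> A = 0 \<and> emeasure \<xi> B = 0" by auto
next
  assume *: "emeasure \<xi> A = 0 \<and> emeasure \<xi> B = 0"
  have "emeasure \<xi> (A \<union> B) \<le> emeasure \<xi> A + emeasure \<xi> B"
    using assms by (rule emeasure_subadditive)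
  then show "emeasure \<xi> (A \<union> B) = 0" using * by simp
qed

lemma poisson_like_unique:
  assumes "sigma_finite_measure m" "diffuse m" and P: "poisson_like m P" and Q: "poisson_like m Q"
  shows "P = Q"
proof (rule prob_eq_if_avoidance_eq[where I = "{A\<in>sets m. emeasure m A < \<infinity>}"
      and N = "\<lambda>A \<xi>. emeasure \<xi> A"])
  note PD = poisson_likeD[OF P] and QD = poisson_likeD[OF Q]
  show "prob_space P" "prob_space Q" by fact+
  show "sets Q = sets P" using PD(2) QD(2) by simp
  show "(\<lambda>\<xi>. emeasure \<xi> A) \<in> borel_measurable P" if "A \<in> {A\<in>sets m. emeasure m A < \<infinity>}" for A
    using that by (subst measurable_cong_sets[OF PD(2) refl]) auto
  show "sets P \<subseteq> sets K" if K: "space K = space P"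
    and N: "\<And>A. A \<in> {A\<in>sets m. emeasure m A < \<infinity>} \<Longrightarrow> (\<lambda>\<xi>. emeasure \<xi> A) \<in> borel_measurable K" for K
  proof
    fix E assume E: "E \<in> sets P"
    have "(\<lambda>\<xi>. \<xi>) \<in> K \<rightarrow>\<^sub>M measures_space m"
      using assms(1) K N PD(3) by (intro measurable_measures_space_sigma_finiteI) (auto simp: measures_on_def)
    then have "(\<lambda>\<xi>. \<xi>) -` E \<inter> space K \<in> sets K" using E PD(2) by (intro measurable_sets) auto
    moreover have "(\<lambda>\<xi>. \<xi>) -` E \<inter> space K = E" using sets.sets_into_space[OF E] K by auto
    ultimately show "E \<in> sets K" by simp
  qed
next
  fix A B assume A: "A \<in> {A\<in>sets m. emeasure m A < \<infinity>}" and B: "B \<in> {A\<in>sets m. emeasure m A < \<infinity>}"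
  have "emeasure m (A \<union> B) \<le> emeasure m A + emeasure m B" using A B by (intro emeasure_subadditive) auto
  then have "emeasure m (A \<union> B) < \<infinity>" using A B by (auto intro: le_less_trans)
  then show "\<exists>d\<in>{A\<in>sets m. emeasure m A < \<infinity>}. \<forall>\<omega>\<in>space P.
      emeasure \<omega> d = 0 \<longleftrightarrow> emeasure \<omega> A = 0 \<and> emeasure \<omega> B = 0"
    using A B poisson_likeD(3)[OF P]
    by (intro bexI[of _ "A \<union> B"]) (auto simp: measures_on_def emeasure_Un_eq_0_iff)
next
  fix A assume "A \<in> {A\<in>sets m. emeasure m A < \<infinity>}"
  then show "measure P {\<omega> \<in> space P. emeasure \<omega> A = 0} = measure Q {\<omega> \<in> space P. emeasure \<omega> A = 0}"
    using poisson_likeD[OF P] poisson_likeD[OF Q] by simp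
next
  note PD = poisson_likeD[OF P] and QD = poisson_likeD[OF Q]
  fix A and \<epsilon> :: real assume A: "A \<in> {A\<in>sets m. emeasure m A < \<infinity>}" and \<epsilon>: "0 < \<epsilon>"
  then have A': "A \<in> sets m" "emeasure m A < \<infinity>" by auto
  obtain k :: nat and D where D: "disjoint_family_on D {..<k}"
    "\<And>j. j < k \<Longrightarrow> D j \<in> sets m" "\<And>j. j < k \<Longrightarrow> emeasure m (D j) < \<infinity>" "A = (\<Union>j<k. D j)"
    "(\<Sum>j<k. (measure m (D j))\<^sup>2) \<le> \<epsilon>"
    using diffuse_dissection_squares[OF assms(2) A' \<epsilon>] by metis
  have "(\<Sum>j<k. measure P {\<omega> \<in> space P. emeasure \<omega> (D j) \<notin> {0, 1}}) \<le> \<epsilon>"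
    using PD(5) D(2,3) by (intro order_trans[OF sum_mono D(5)]) auto
  moreover have "(\<Sum>j<k. measure Q {\<omega> \<in> space P. emeasure \<omega> (D j) \<notin> {0, 1}}) \<le> \<epsilon>"
    unfolding PD(3) QD(3)[symmetric]
    using QD(5) D(2,3) by (intro order_trans[OF sum_mono D(5)]) auto
  moreover have "emeasure \<omega> A = (\<Sum>j<k. emeasure \<omega> (D j))" if "\<omega> \<in> space P" for \<omega>
    unfolding D(4) using that D PD(3)
    by (intro sum_emeasure[symmetric]) (auto simp: measures_on_def)
  ultimately show "\<exists>(k::nat) d. (\<forall>j<k. d j \<in> {A\<in>sets m. emeasure m A < \<infinity>}) \<and>
      (\<forall>\<omega>\<in>space P. emeasure \<omega> A = (\<Sum>j<k. emeasure \<omega> (d j))) \<and>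
      (\<Sum>j<k. measure P {\<omega> \<in> space P. emeasure \<omega> (d j) \<notin> {0, 1}}) \<le> \<epsilon> \<and>
      (\<Sum>j<k. measure Q {\<omega> \<in> space P. emeasure \<omega> (d j) \<notin> {0, 1}}) \<le> \<epsilon>"
    using D(2,3) by (intro exI[of _ k] exI[of _ D]) blast
qed

lemma is_poisson_measure_law:
  assumes "is_poisson_measure m P" "A \<in> sets m" "emeasure m A < \<infinity>" "D \<in> sets borel"
  shows "measure P {\<xi> \<in> space P. emeasure \<xi> A \<in> D} =
    measure (measure_pmf (poisson_dist (measure m A))) {n. of_nat n \<in> D}"
proof -
  have P: "prob_space P" "sets P = sets (measures_space m)"
    using assms(1) by (auto simp: is_poisson_measure_def)
  have meas: "(\<lambda>\<xi>. emeasure \<xi> A) \<in> borel_measurable P"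
    using assms(2) by (subst measurable_cong_sets[OF P(2) refl]) auto
  have "distr P borel (\<lambda>\<xi>. emeasure \<xi> A) =
             distr (measure_pmf (poisson_dist (measure m A))) borel (of_nat :: nat \<Rightarrow> ennreal)"
    using assms(1)[unfolded is_poisson_measure_def, THEN conjunct2, THEN conjunct2, rule_format,
        of "\<lambda>_. A" 1] assms(2,3) by (auto simp: disjoint_family_on_def)
  then have "measure (distr P borel (\<lambda>\<xi>. emeasure \<xi> A)) D =
      measure (distr (measure_pmf (poisson_dist (measure m A))) borel (of_nat :: nat \<Rightarrow> ennreal)) D"
    by simp
  then show ?thesis
    using assms(4) meas by (simp add: measure_distr vimage_def Int_def conj_commute)
qed

lemma is_poisson_measure_imp_poisson_like:
  assumes "is_poisson_measure m P"
  shows "poisson_like m P"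
  unfolding poisson_like_def
proof (intro conjI ballI impI)
  show "prob_space P" "sets P = sets (measures_space m)"
    using assms by (auto simp: is_poisson_measure_def)
  fix A assume A: "A \<in> sets m" "emeasure m A < \<infinity>"
  show "measure P {\<xi> \<in> space P. emeasure \<xi> A = 0} = exp (- measure m A)"
    using is_poisson_measure_law[OF assms A, of "{0}"]
    by (simp add: measure_pmf_single pmf_poisson_dist)
  have "{n. of_nat n \<in> - {0, 1 :: ennreal}} = {n. n \<notin> {0, 1}}" by auto
  then show "measure P {\<xi> \<in> space P. emeasure \<xi> A \<notin> {0, 1}} \<le> (measure m A)\<^sup>2"
    using is_poisson_measure_law[OF assms A, of "- {0, 1}"] poisson_dist_multiple[of "measure m A"]
    by simp
qed

text \<open>
  The point probabilities of the product of the \<open>p l\<close> sum up to one. Hence they give lower bounds for the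
  probabilities of an event \<open>{X l \<in> D l for all l}\<close> and of its complement that leave no room for
  strict inequality; this determines the joint law although the values need not be integers everywhere.
\<close>

lemma indep_vars_if_joint_pmf:
  fixes X :: "nat \<Rightarrow> 'w \<Rightarrow> ennreal" and p :: "nat \<Rightarrow> nat pmf"
  assumes P: "prob_space P" and X: "\<And>l. l < k \<Longrightarrow> X l \<in> borel_measurable P"
    and joint: "\<And>v :: nat \<Rightarrow> nat. measure P {\<omega> \<in> space P. \<forall>l<k. X l \<omega> = of_nat (v l)} =
      (\<Prod>l<k. pmf (p l) (v l))"
  shows "prob_space.indep_vars P (\<lambda>_. borel) X {..<k}"
    and "l < k \<Longrightarrow> distr P borel (X l) = distr (measure_pmf (p l)) borel (of_nat :: nat \<Rightarrow> ennreal)"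
proof -
  interpret prob_space P by fact
  define q where "q = Pi_pmf {..<k} 0 p"
  define E where "E = (\<lambda>v :: nat \<Rightarrow> nat. {\<omega> \<in> space P. \<forall>l<k. X l \<omega> = of_nat (v l)})"
  have E_eq: "E v = space P - (\<Union>l\<in>{..<k}. space P - X l -` {of_nat (v l)} \<inter> space P)" for v
    by (auto simp: E_def)
  have E_sets: "E v \<in> events" for v
    unfolding E_eq using X by (intro sets.Diff sets.top sets.finite_UN measurable_sets) auto
  have outside: "v l = 0" if "v \<in> set_pmf q" "\<not> l < k" for v l
    using that set_Pi_pmf_subset[of "{..<k}" 0 p] by (auto simp: q_def)
  have lower: "measure_pmf.prob q W \<le> measure P F" if W: "W \<subseteq> set_pmf q" and F: "F \<in> events"
    and sub: "\<And>v. v \<in> W \<Longrightarrow> E v \<subseteq> F" for W F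
  proof -
    have cW: "countable W" using W countable_set_pmf by (rule countable_subset)
    have disj: "disjoint_family_on E W"
      unfolding disjoint_family_on_def
    proof (intro ballI impI)
      fix v v' assume "v \<in> W" "v' \<in> W" "v \<noteq> v'"
      then obtain l where "v l \<noteq> v' l" by auto
      then have "l < k" using outside W \<open>v \<in> W\<close> \<open>v' \<in> W\<close> by (metis subsetD)
      with \<open>v l \<noteq> v' l\<close> show "E v \<inter> E v' = {}" by (auto simp: E_def)
    qed
    have "emeasure (measure_pmf q) W = (\<integral>\<^sup>+v. ennreal (pmf q v) \<partial>count_space W)"
      by (simp add: nn_integral_pmf)
    also have "\<dots> = (\<integral>\<^sup>+v. emeasure P (E v) \<partial>count_space W)"
    proof (rule nn_integral_cong)
      fix v assume "v \<in> space (count_space W)"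
      then have "v \<in> set_pmf q" using W by auto
      then have "pmf q v = (\<Prod>l<k. pmf (p l) (v l))"
        unfolding q_def using outside by (subst pmf_Pi) (auto simp: q_def)
      then show "ennreal (pmf q v) = emeasure P (E v)"
        using joint[of v] by (simp add: emeasure_eq_measure E_def)
    qed
    also have "\<dots> = emeasure P (\<Union>v\<in>W. E v)"
      using cW disj E_sets by (intro emeasure_UN_countable[symmetric]) auto
    also have "\<dots> \<le> emeasure P F" using sub F by (intro emeasure_mono) auto
    finally show ?thesis by (simp add: emeasure_eq_measure measure_pmf.emeasure_eq_measure)
  qed
  have law: "measure P {\<omega> \<in> space P. \<forall>l<k. X l \<omega> \<in> D l} =
      (\<Prod>l<k. measure (measure_pmf (p l)) {n. of_nat n \<in> D l})"
    if D: "\<And>l. l < k \<Longrightarrow> D l \<in> sets borel" for D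
  proof -
    define F where "F = {\<omega> \<in> space P. \<forall>l<k. X l \<omega> \<in> D l}"
    have "F = space P - (\<Union>l\<in>{..<k}. space P - X l -` D l \<inter> space P)" by (auto simp: F_def)
    also have "\<dots> \<in> events" using X D by (intro sets.Diff sets.top sets.finite_UN measurable_sets) auto
    finally have F: "F \<in> events" .
    define W where "W = {v \<in> set_pmf q. \<forall>l<k. of_nat (v l) \<in> D l}"
    have 1: "measure_pmf.prob q W \<le> measure P F"
    proof (rule lower)
      show "E v \<subseteq> F" if "v \<in> W" for v
        using that unfolding W_def E_def F_def by force
    qed (use F in \<open>simp_all add: W_def\<close>)
    have 2: "measure_pmf.prob q (set_pmf q - W) \<le> measure P (space P - F)"
    proof (rule lower)
      show "E v \<subseteq> space P - F" if v: "v \<in> set_pmf q - W" for v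
      proof -
        obtain l where "l < k" "of_nat (v l) \<notin> D l" using v unfolding W_def by blast
        then show ?thesis unfolding E_def F_def by force
      qed
    qed (use F in auto)
    have "measure_pmf.prob q (set_pmf q - W) = measure_pmf.prob q (- W)"
      by (intro measure_pmf.finite_measure_eq_AE) (auto simp: AE_measure_pmf_iff)
    also have "\<dots> = 1 - measure_pmf.prob q W"
      using measure_pmf.prob_compl[of W q] by (simp add: Compl_eq_Diff_UNIV)
    finally have "measure P F = measure_pmf.prob q W"
      using 1 2 prob_compl[OF F] by linarith
    also have "\<dots> = measure_pmf.prob q (Pi {..<k} (\<lambda>l. {n. of_nat n \<in> D l}))"
      by (intro measure_pmf.finite_measure_eq_AE) (auto simp: AE_measure_pmf_iff W_def)
    also have "\<dots> = (\<Prod>l<k. measure (measure_pmf (p l)) {n. of_nat n \<in> D l})"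
      unfolding q_def by (subst measure_Pi_pmf_Pi) auto
    finally show ?thesis by (simp add: F_def)
  qed
  have law1: "measure P {\<omega> \<in> space P. X l \<omega> \<in> D} =
      measure (measure_pmf (p l)) {n. of_nat n \<in> D}" if "l < k" "D \<in> sets borel" for l D
  proof -
    have "measure P {\<omega> \<in> space P. \<forall>i<k. X i \<omega> \<in> (if i = l then D else UNIV)} =
        (\<Prod>i<k. measure (measure_pmf (p i)) {n. of_nat n \<in> (if i = l then D else UNIV)})"
      using that by (intro law) auto
    also have "\<dots> = (\<Prod>i<k. if i = l then measure (measure_pmf (p l)) {n. of_nat n \<in> D} else 1)"
      by (intro prod.cong) auto
    also have "\<dots> = measure (measure_pmf (p l)) {n. of_nat n \<in> D}"
      using that by (subst prod.delta) auto
    also have "{\<omega> \<in> space P. \<forall>i<k. X i \<omega> \<in> (if i = l then D else UNIV)} = {\<omega> \<in> space P. X l \<omega> \<in> D}"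
      using that by auto
    finally show ?thesis .
  qed
  show "distr P borel (X l) = distr (measure_pmf (p l)) borel (of_nat :: nat \<Rightarrow> ennreal)"
    if l: "l < k" for l
  proof (rule measure_eqI)
    fix D assume "D \<in> sets (distr P borel (X l))"
    then have D: "D \<in> sets borel" by simp
    have "emeasure (distr P borel (X l)) D = emeasure P {\<omega> \<in> space P. X l \<omega> \<in> D}"
      using X[OF l] D by (subst emeasure_distr) (auto intro!: arg_cong[where f = "emeasure P"])
    also have "\<dots> = emeasure (measure_pmf (p l)) {n. of_nat n \<in> D}"
      using law1[OF l D] by (simp add: emeasure_eq_measure measure_pmf.emeasure_eq_measure)
    also have "\<dots> = emeasure (distr (measure_pmf (p l)) borel of_nat) D"
      using D by (subst emeasure_distr) (auto intro!: arg_cong[where f = "emeasure (measure_pmf (p l))"])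
    finally show "emeasure (distr P borel (X l)) D = emeasure (distr (measure_pmf (p l)) borel of_nat) D" .
  qed simp
  show "indep_vars (\<lambda>_. borel) X {..<k}"
    unfolding indep_vars_def2
  proof (intro conjI ballI)
    show "indep_sets (\<lambda>i. {X i -` A \<inter> space P |A. A \<in> sets borel}) {..<k}"
    proof (cases "k = 0")
      case True
      then show ?thesis by (simp add: indep_sets_def)
    next
      case False
      show ?thesis
      proof (subst indep_sets_finite)
        show "space P \<in> {X i -` A \<inter> space P |A. A \<in> sets borel}" for i
          by (auto intro!: exI[of _ UNIV])
        show "\<forall>A\<in>Pi {..<k} (\<lambda>i. {X i -` A \<inter> space P |A. A \<in> sets borel}).
            prob (\<Inter>j\<in>{..<k}. A j) = (\<Prod>j\<in>{..<k}. prob (A j))"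
        proof
          fix A assume "A \<in> Pi {..<k} (\<lambda>i. {X i -` A \<inter> space P |A. A \<in> sets borel})"
          then have "\<forall>i\<in>{..<k}. \<exists>D. A i = X i -` D \<inter> space P \<and> D \<in> sets borel" by auto
          then obtain D where D: "\<And>i. i < k \<Longrightarrow> A i = X i -` D i \<inter> space P"
            "\<And>i. i < k \<Longrightarrow> D i \<in> sets borel" by (metis lessThan_iff)
          have "(\<Inter>j\<in>{..<k}. A j) = {\<omega> \<in> space P. \<forall>l<k. X l \<omega> \<in> D l}"
            using D(1) False by auto
          also have "prob \<dots> = (\<Prod>j<k. prob {\<omega> \<in> space P. X j \<omega> \<in> D j})"
            using law[of D] law1 D(2) by simp
          also have "\<dots> = (\<Prod>j\<in>{..<k}. prob (A j))"
            by (intro prod.cong arg_cong[where f = prob]) (auto simp: D(1))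
          finally show "prob (\<Inter>j\<in>{..<k}. A j) = (\<Prod>j\<in>{..<k}. prob (A j))" .
        qed
      qed (use X False in auto)
    qed
  qed (use X in auto)
qed

lemma is_poisson_measureI:
  assumes P: "prob_space P" "sets P = sets (measures_space m)"
    and joint: "\<And>(k::nat) A v. disjoint_family_on A {..<k} \<Longrightarrow> (\<And>i. i < k \<Longrightarrow> A i \<in> sets m) \<Longrightarrow>
      (\<And>i. i < k \<Longrightarrow> emeasure m (A i) < \<infinity>) \<Longrightarrow>
      measure P {\<xi> \<in> space P. \<forall>l<k. emeasure \<xi> (A l) = of_nat (v l)} =
      (\<Prod>l<k. pmf (poisson_dist (measure m (A l))) (v l))"
  shows "is_poisson_measure m P"
  unfolding is_poisson_measure_def
proof (intro conjI allI impI)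
  fix k :: nat and A :: "nat \<Rightarrow> 'a set"
  assume *: "disjoint_family_on A {..<k} \<and> (\<forall>i<k. A i \<in> sets m \<and> emeasure m (A i) < \<infinity>)"
  have meas: "(\<lambda>\<xi>. emeasure \<xi> (A l)) \<in> borel_measurable P" if "l < k" for l
    using * that by (subst measurable_cong_sets[OF P(2) refl]) auto
  have j: "measure P {\<xi> \<in> space P. \<forall>l<k. emeasure \<xi> (A l) = of_nat (v l)} =
      (\<Prod>l<k. pmf (poisson_dist (measure m (A l))) (v l))" for v
    using * by (intro joint) auto
  show "prob_space.indep_vars P (\<lambda>_. borel) (\<lambda>i \<xi>. emeasure \<xi> (A i)) {..<k}"
    using P(1) meas j by (rule indep_vars_if_joint_pmf(1))
  fix i assume "i < k"
  show "distr P borel (\<lambda>\<xi>. emeasure \<xi> (A i)) =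
      distr (measure_pmf (poisson_dist (measure m (A i)))) borel (of_nat :: nat \<Rightarrow> ennreal)"
    using P(1) meas j \<open>i < k\<close> by (rule indep_vars_if_joint_pmf(2))
qed fact+

lemma is_poisson_measure_joint:
  fixes k :: nat
  assumes Q: "is_poisson_measure m P" and A: "disjoint_family_on A {..<k}"
    "\<And>i. i < k \<Longrightarrow> A i \<in> sets m" "\<And>i. i < k \<Longrightarrow> emeasure m (A i) < \<infinity>"
  shows "measure P {\<xi> \<in> space P. \<forall>l<k. emeasure \<xi> (A l) = of_nat (v l)} =
      (\<Prod>l<k. pmf (poisson_dist (measure m (A l))) (v l))"
proof -
  interpret prob_space P using Q by (simp add: is_poisson_measure_def)
  show ?thesis
  proof (cases "k = 0")
    case True
    then show ?thesis by (simp add: prob_space)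
  next
    case False
    have "indep_vars (\<lambda>_. borel) (\<lambda>i \<xi>. emeasure \<xi> (A i)) {..<k}"
      using Q A unfolding is_poisson_measure_def by blast
    then have "prob (\<Inter>l\<in>{..<k}. (\<lambda>\<xi>. emeasure \<xi> (A l)) -` {of_nat (v l)} \<inter> space P) =
        (\<Prod>l\<in>{..<k}. prob ((\<lambda>\<xi>. emeasure \<xi> (A l)) -` {of_nat (v l)} \<inter> space P))"
      using False by (intro indep_varsD_finite) auto
    also have "(\<Inter>l\<in>{..<k}. (\<lambda>\<xi>. emeasure \<xi> (A l)) -` {of_nat (v l)} \<inter> space P) =
        {\<xi> \<in> space P. \<forall>l<k. emeasure \<xi> (A l) = of_nat (v l)}"
      using False by auto
    also have "(\<Prod>l\<in>{..<k}. prob ((\<lambda>\<xi>. emeasure \<xi> (A l)) -` {of_nat (v l)} \<inter> space P)) =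
        (\<Prod>l<k. pmf (poisson_dist (measure m (A l))) (v l))"
    proof (rule prod.cong)
      fix l assume "l \<in> {..<k}"
      then have "prob {\<xi> \<in> space P. emeasure \<xi> (A l) \<in> {of_nat (v l)}} =
          measure (measure_pmf (poisson_dist (measure m (A l)))) {n. (of_nat n :: ennreal) \<in> {of_nat (v l)}}"
        using A by (intro is_poisson_measure_law[OF Q]) auto
      then show "prob ((\<lambda>\<xi>. emeasure \<xi> (A l)) -` {of_nat (v l)} \<inter> space P) =
          pmf (poisson_dist (measure m (A l))) (v l)"
        by (simp add: vimage_def Int_def conj_commute measure_pmf_single)
    qed simp
    finally show ?thesis .
  qed
qed

section \<open>Existence of Poisson measures\<close>

lemma sets_joint_counts:
  fixes k :: nat and v :: "nat \<Rightarrow> nat"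
  assumes "\<And>l. l < k \<Longrightarrow> A l \<in> sets m"
  shows "{\<xi> \<in> measures_on m. \<forall>l<k. emeasure \<xi> (A l) = of_nat (v l)} \<in> sets (measures_space m)"
proof -
  have "{\<xi> \<in> measures_on m. \<forall>l<k. emeasure \<xi> (A l) = of_nat (v l)} = space (measures_space m) -
      (\<Union>l\<in>{..<k}. space (measures_space m) - (\<lambda>\<xi>. emeasure \<xi> (A l)) -` {of_nat (v l)} \<inter> space (measures_space m))"
    by auto
  also have "\<dots> \<in> sets (measures_space m)"
    using assms by (intro sets.Diff sets.top sets.finite_UN
        measurable_sets[OF measurable_emeasure_measures_space]) auto
  finally show ?thesis .
qed

lemma sum_replicate_mset:
  fixes v :: "nat \<Rightarrow> nat" and K :: nat
  defines "V \<equiv> (\<Sum>l<K. replicate_mset (v l) l)"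
  shows "count V l = (if l < K then v l else 0)" "size V = (\<Sum>l<K. v l)" "set_mset V \<subseteq> {..<K}"
proof -
  have 1: "count V l = (if l < K then v l else 0)" for l
    unfolding V_def by (induction K) auto
  show "count V l = (if l < K then v l else 0)" by fact
  show "size V = (\<Sum>l<K. v l)" unfolding V_def by (induction K) auto
  show "set_mset V \<subseteq> {..<K}"
  proof
    fix l assume "l \<in># V"
    then show "l \<in> {..<K}" using 1[of l] by (auto split: if_splits simp flip: count_greater_zero_iff)
  qed
qed

lemma emeasure_distr_points:
  assumes x: "\<And>j. x j \<in> space m" and A: "A \<in> sets m"
  shows "emeasure (distr (count_space {..<n::nat}) m x) A = of_nat (card {j. j < n \<and> x j \<in> A})"
proof -
  have "emeasure (distr (count_space {..<n}) m x) A = emeasure (count_space {..<n}) (x -` A \<inter> {..<n})"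
    using x A by (subst emeasure_distr) auto
  also have "\<dots> = of_nat (card (x -` A \<inter> {..<n}))" by (subst emeasure_count_space) auto
  also have "x -` A \<inter> {..<n} = {j. j < n \<and> x j \<in> A}" by auto
  finally show ?thesis .
qed

lemma count_mset_nth: "count (mset w) l = card {j. j < length w \<and> w ! j = l}"
  by (simp add: count_mset count_list_eq_length_filter length_filter_conv_card eq_commute[of l])

text \<open>
  The process places a Poisson number of independent points with distribution \<open>m\<close> normalised. Given that
  the cells of a partition receive \<open>v 0, v 1, ...\<close> points, the sequence of the cells visited is one of the
  permutations of the multiset with these multiplicities. There are \<open>n! / (v 0! v 1! ...)\<close> of them, all
  equally likely, and the factor \<open>n!\<close> cancels against the Poisson weight of \<open>n\<close>: what remains is a
  product of Poisson weights.
\<close>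

lemma ex_is_poisson_measure_positive_finite:
  assumes fin: "emeasure m (space m) < \<infinity>" and pos: "0 < measure m (space m)"
  shows "\<exists>P. is_poisson_measure m P"
proof -
  define c where "c = measure m (space m)"
  have c: "0 < c" using pos by (simp add: c_def)
  interpret m: finite_measure m using fin by (intro finite_measureI) auto
  define m1 where "m1 = uniform_measure m (space m)"
  have em_pos: "emeasure m (space m) \<noteq> 0" using pos by (auto simp: measure_def)
  interpret m1: prob_space m1
    unfolding m1_def using em_pos fin by (intro prob_space_uniform_measure) auto
  have sets_m1 [simp, measurable_cong]: "sets m1 = sets m" by (simp add: m1_def)
  have space_m1 [simp]: "space m1 = space m" by (simp add: m1_def)
  have m1: "measure m1 A = measure m A / c" if "A \<in> sets m" for A
    using that em_pos fin sets.sets_into_space[OF that]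
    by (simp add: m1_def c_def measure_uniform_measure Int_absorb1)
  define X where "X = PiM (UNIV :: nat set) (\<lambda>_. m1)"
  interpret XP: product_prob_space "\<lambda>_::nat. m1" UNIV ..
  interpret X: prob_space X unfolding X_def by (rule XP.prob_space_axioms)
  define \<Omega> where "\<Omega> = measure_pmf (poisson_pmf c) \<Otimes>\<^sub>M X"
  interpret O: pair_prob_space "measure_pmf (poisson_pmf c)" X ..
  have space_X: "space X = {x. \<forall>j. x j \<in> space m}" by (auto simp: X_def space_PiM PiE_def)
  have space_\<Omega>: "space \<Omega> = UNIV \<times> space X" by (simp add: \<Omega>_def space_pair_measure)
  define \<xi> :: "nat \<times> (nat \<Rightarrow> 'a) \<Rightarrow> 'a measure" where
    "\<xi> = (\<lambda>\<omega>. distr (count_space {..<fst \<omega>}) m (snd \<omega>))"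
  have em: "emeasure (\<xi> \<omega>) A = of_nat (card {j. j < fst \<omega> \<and> snd \<omega> j \<in> A})"
    if "\<omega> \<in> space \<Omega>" "A \<in> sets m" for \<omega> A
    unfolding \<xi>_def using that by (intro emeasure_distr_points) (auto simp: space_\<Omega> space_X)
  have \<xi>_meas: "\<xi> \<in> \<Omega> \<rightarrow>\<^sub>M measures_space m"
  proof (rule measurable_measures_spaceI)
    fix A assume A[measurable]: "A \<in> sets m"
    have eq: "emeasure (\<xi> \<omega>) A = (\<Sum>j. if j < fst \<omega> then indicator A (snd \<omega> j) else 0)"
      if "\<omega> \<in> space \<Omega>" for \<omega>
    proof -
      have "(\<Sum>j. if j < fst \<omega> then indicator A (snd \<omega> j) else 0 :: ennreal) =
          (\<Sum>j<fst \<omega>. indicator A (snd \<omega> j))"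
        by (subst suminf_finite[of "{..<fst \<omega>}"]) auto
      also have "\<dots> = of_nat (card {j. j < fst \<omega> \<and> snd \<omega> j \<in> A})"
        by (auto simp: indicator_def sum.If_cases Int_def)
      finally show ?thesis using em[OF that A] by simp
    qed
    have "(\<lambda>\<omega>. \<Sum>j. if j < fst \<omega> then indicator A (snd \<omega> j) else 0 :: ennreal) \<in> borel_measurable \<Omega>"
      unfolding \<Omega>_def X_def by measurable
    then show "(\<lambda>\<omega>. emeasure (\<xi> \<omega>) A) \<in> borel_measurable \<Omega>"
      by (subst measurable_cong[OF eq])
  qed (simp add: \<xi>_def)
  define P where "P = distr \<Omega> (measures_space m) \<xi>"
  have sets_P: "sets P = sets (measures_space m)" by (simp add: P_def)
  interpret P: prob_space P
    unfolding P_def \<Omega>_def by (rule O.prob_space_distr) (use \<xi>_meas in \<open>simp add: \<Omega>_def\<close>)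
  have space_P: "space P = measures_on m" by (simp add: P_def)
  have cells: "measure P {\<xi> \<in> space P. \<forall>l<K. emeasure \<xi> (B l) = of_nat (v l)} =
      (\<Prod>l<K. pmf (poisson_dist (measure m (B l))) (v l))"
    if B: "disjoint_family_on B {..<K}" "\<And>l. l < K \<Longrightarrow> B l \<in> sets m" "(\<Union>l<K. B l) = space m"
    for K :: nat and B v
  proof -
    define V where "V = (\<Sum>l<K. replicate_mset (v l) l)"
    note V = sum_replicate_mset[where K = K and v = v, folded V_def]
    define n where "n = (\<Sum>l<K. v l)"
    define W where "W = permutations_of_multiset V"
    have lenW: "length w = n" if "w \<in> W" for w
      using that V(2) by (auto simp: W_def n_def permutations_of_multiset_def)
    have wK: "w ! j < K" if "w \<in> W" "j < n" for w j
      using that V(3) lenW[OF that(1)] nth_mem[of j w]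
      by (auto simp: W_def permutations_of_multiset_def simp flip: set_mset_mset)
    \<comment> \<open>the event that there are \<open>n\<close> points, the \<open>j\<close>-th of which lies in the cell \<open>w ! j\<close>\<close>
    define Z where "Z = (\<lambda>w. {n} \<times> {x \<in> space X. \<forall>j<n. x j \<in> B (w ! j)})"
    have cell_unique: "l = l'" if "y \<in> B l" "y \<in> B l'" "l < K" "l' < K" for y l l'
      using B(1) that by (auto simp: disjoint_family_on_def)
    have event: "{\<omega> \<in> space \<Omega>. \<forall>l<K. emeasure (\<xi> \<omega>) (B l) = of_nat (v l)} = (\<Union>w\<in>W. Z w)"
    proof (intro equalityI subsetI)
      fix \<omega> assume "\<omega> \<in> {\<omega> \<in> space \<Omega>. \<forall>l<K. emeasure (\<xi> \<omega>) (B l) = of_nat (v l)}"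
      then have \<omega>: "\<omega> \<in> space \<Omega>" and "\<And>l. l < K \<Longrightarrow> emeasure (\<xi> \<omega>) (B l) = of_nat (v l)" by auto
      then have cnt: "card {j. j < fst \<omega> \<and> snd \<omega> j \<in> B l} = v l" if "l < K" for l
        using em[OF \<omega> B(2)[OF that]] that by simp
      have x: "snd \<omega> \<in> space X" "\<And>j. snd \<omega> j \<in> space m" using \<omega> by (auto simp: space_\<Omega> space_X)
      then have "\<forall>j. \<exists>l<K. snd \<omega> j \<in> B l" using B(3) by blast
      then obtain lab where lab: "\<And>j. lab j < K" "\<And>j. snd \<omega> j \<in> B (lab j)" by metis
      have lab_iff: "snd \<omega> j \<in> B l \<longleftrightarrow> lab j = l" if "l < K" for j l
        using lab[of j] cell_unique[of "snd \<omega> j" "lab j" l] that by auto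
      define w where "w = map lab [0..<fst \<omega>]"
      have "mset w = V"
      proof (rule multiset_eqI)
        fix l
        have "count (mset w) l = card {j. j < fst \<omega> \<and> lab j = l}"
          unfolding count_mset_nth by (auto simp: w_def intro!: arg_cong[where f = card])
        also have "\<dots> = (if l < K then v l else 0)"
          using cnt[of l] lab_iff[of l] lab(1) by auto
        finally show "count (mset w) l = count V l" using V(1) by simp
      qed
      then have wW: "w \<in> W" by (simp add: W_def permutations_of_multiset_def)
      have "fst \<omega> = n" using lenW[OF wW] by (simp add: w_def)
      then have "\<omega> \<in> Z w" using x lab(2) by (cases \<omega>) (auto simp: Z_def w_def)
      then show "\<omega> \<in> (\<Union>w\<in>W. Z w)" using wW by blast
    next
      fix \<omega> assume "\<omega> \<in> (\<Union>w\<in>W. Z w)"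
      then obtain w where w: "w \<in> W" "fst \<omega> = n" "snd \<omega> \<in> space X" "\<And>j. j < n \<Longrightarrow> snd \<omega> j \<in> B (w ! j)"
        by (auto simp: Z_def)
      have \<omega>: "\<omega> \<in> space \<Omega>" using w(3) by (cases \<omega>) (auto simp: space_\<Omega>)
      have "emeasure (\<xi> \<omega>) (B l) = of_nat (v l)" if l: "l < K" for l
      proof -
        have "{j. j < fst \<omega> \<and> snd \<omega> j \<in> B l} = {j. j < length w \<and> w ! j = l}"
          using cell_unique[OF w(4) _ wK[OF w(1)] l] w(4) w(2) lenW[OF w(1)] by auto
        then have "card {j. j < fst \<omega> \<and> snd \<omega> j \<in> B l} = count (mset w) l"
          unfolding count_mset_nth by simp
        also have "\<dots> = v l" using w(1) V(1) l by (simp add: W_def permutations_of_multiset_def)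
        finally show ?thesis using em[OF \<omega> B(2)[OF l]] by simp
      qed
      then show "\<omega> \<in> {\<omega> \<in> space \<Omega>. \<forall>l<K. emeasure (\<xi> \<omega>) (B l) = of_nat (v l)}" using \<omega> by auto
    qed
    have Zx: "{x \<in> space X. \<forall>j<n. x j \<in> B (w ! j)} \<in> sets X \<and>
        measure X {x \<in> space X. \<forall>j<n. x j \<in> B (w ! j)} = (\<Prod>j<n. measure m1 (B (w ! j)))"
      if w: "w \<in> W" for w
    proof -
      have Bw: "B (w ! j) \<in> sets m1" if "j \<in> {..<n}" for j using wK[OF w] that B(2) by auto
      have e: "{x \<in> space X. \<forall>j<n. x j \<in> B (w ! j)} =
          prod_emb UNIV (\<lambda>_. m1) {..<n} (Pi\<^sub>E {..<n} (\<lambda>j. B (w ! j)))"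
        unfolding prod_emb_def X_def space_PiM by (auto simp: restrict_PiE_iff)
      show ?thesis
        unfolding e using Bw XP.measure_PiM_emb[of "{..<n}" "\<lambda>j. B (w ! j)"]
        by (auto simp: X_def intro!: sets_PiM_I)
    qed
    have Z: "Z w \<in> sets \<Omega>" "measure \<Omega> (Z w) =
        c ^ n / fact n * exp (- c) * (\<Prod>l<K. (measure m (B l) / c) ^ v l)" if w: "w \<in> W" for w
    proof -
      have sx: "{x \<in> space X. \<forall>j<n. x j \<in> B (w ! j)} \<in> sets X" using Zx[OF w] by blast
      show "Z w \<in> sets \<Omega>" unfolding Z_def \<Omega>_def by (rule pair_measureI[OF _ sx]) simp
      have "measure \<Omega> (Z w) = measure (measure_pmf (poisson_pmf c)) {n} *
          measure X {x \<in> space X. \<forall>j<n. x j \<in> B (w ! j)}"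
        unfolding Z_def \<Omega>_def measure_def
        by (subst X.emeasure_pair_measure_Times[OF _ sx]) (simp_all add: enn2real_mult)
      also have "measure (measure_pmf (poisson_pmf c)) {n} = c ^ n / fact n * exp (- c)"
        using c by (simp add: measure_pmf_single)
      also have "measure X {x \<in> space X. \<forall>j<n. x j \<in> B (w ! j)} =
          (\<Prod>j<n. measure m1 (B (w ! j)))"
        using Zx[OF w] by blast
      also have "\<dots> = (\<Prod>j<n. measure m (B (w ! j)) / c)"
        by (intro prod.cong refl m1 B(2) wK[OF w]) simp
      also have "\<dots> = prod_list (map (\<lambda>l. measure m (B l) / c) w)"
        using lenW[OF w] by (simp add: prod.list_conv_set_nth atLeast0LessThan)
      also have "\<dots> = prod_mset (image_mset (\<lambda>l. measure m (B l) / c) (mset w))"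
        by (simp flip: prod_mset_prod_list)
      also have "mset w = V" using w by (simp add: W_def permutations_of_multiset_def)
      also have "prod_mset (image_mset (\<lambda>l. measure m (B l) / c) V) =
          (\<Prod>l\<in>set_mset V. (measure m (B l) / c) ^ count V l)"
        by (rule image_prod_mset_multiplicity)
      also have "\<dots> = (\<Prod>l<K. (measure m (B l) / c) ^ v l)"
        using V(1,3) by (intro prod.mono_neutral_cong_left)
          (auto simp flip: count_greater_zero_iff)
      finally show "measure \<Omega> (Z w) =
        c ^ n / fact n * exp (- c) * (\<Prod>l<K. (measure m (B l) / c) ^ v l)" .
    qed
    have finW: "finite W" by (simp add: W_def)
    have disjZ: "disjoint_family_on Z W"
      unfolding disjoint_family_on_def
    proof (intro ballI impI)
      fix w w' assume w: "w \<in> W" "w' \<in> W" "w \<noteq> w'"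
      then obtain j where j: "j < n" "w ! j \<noteq> w' ! j" using lenW nth_equalityI by metis
      show "Z w \<inter> Z w' = {}"
        using cell_unique[OF _ _ wK[OF w(1) j(1)] wK[OF w(2) j(1)]] j by (auto simp: Z_def)
    qed
    have cardW: "real (card W) * (\<Prod>l<K. fact (v l)) = fact n"
    proof -
      have "card W * (\<Prod>l\<in>set_mset V. fact (count V l)) = fact (size V)"
        unfolding W_def by (rule card_permutations_of_multiset_aux)
      also have "(\<Prod>l\<in>set_mset V. fact (count V l)) = (\<Prod>l<K. fact (v l) :: nat)"
        using V(1,3) by (intro prod.mono_neutral_cong_left)
          (auto simp flip: count_greater_zero_iff)
      finally have "real (card W * (\<Prod>l<K. fact (v l))) = real (fact n)"
        using V(2) by (simp add: n_def)
      then show ?thesis by simp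
    qed
    have sumB: "(\<Sum>l<K. measure m (B l)) = c"
      unfolding c_def B(3)[symmetric] using B(1,2)
      by (subst m.finite_measure_finite_Union) auto
    define EV where "EV = {\<xi> \<in> measures_on m. \<forall>l<K. emeasure \<xi> (B l) = of_nat (v l)}"
    have EV: "EV \<in> sets (measures_space m)" unfolding EV_def using B(2) by (rule sets_joint_counts)
    have "measure P {\<xi> \<in> space P. \<forall>l<K. emeasure \<xi> (B l) = of_nat (v l)} = measure P EV"
      by (simp add: EV_def space_P)
    also have "measure P EV = measure \<Omega> (\<xi> -` EV \<inter> space \<Omega>)"
      unfolding P_def by (rule measure_distr[OF \<xi>_meas EV])
    also have "\<xi> -` EV \<inter> space \<Omega> = (\<Union>w\<in>W. Z w)"
      unfolding event[symmetric] EV_def using measurable_space[OF \<xi>_meas] by auto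
    also have "measure \<Omega> (\<Union>w\<in>W. Z w) = (\<Sum>w\<in>W. measure \<Omega> (Z w))"
      unfolding \<Omega>_def using Z(1) disjZ finW
      by (intro O.finite_measure_finite_Union) (auto simp: \<Omega>_def)
    also have "\<dots> = real (card W) * (c ^ n / fact n * exp (- c) * (\<Prod>l<K. (measure m (B l) / c) ^ v l))"
      using Z(2) by simp
    also have "(\<Prod>l<K. (measure m (B l) / c) ^ v l) = (\<Prod>l<K. measure m (B l) ^ v l) / c ^ n"
      by (simp add: power_divide prod_dividef n_def power_sum)
    also have "real (card W) * (c ^ n / fact n * exp (- c) * ((\<Prod>l<K. measure m (B l) ^ v l) / c ^ n)) =
        (real (card W) / fact n) * exp (- c) * (\<Prod>l<K. measure m (B l) ^ v l)"
      using c by (simp add: field_simps)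
    also have "real (card W) / fact n = 1 / (\<Prod>l<K. fact (v l))"
      using cardW by (subst frac_eq_eq) auto
    also have "exp (- c) = (\<Prod>l<K. exp (- measure m (B l)))"
      by (simp add: sumB[symmetric] exp_sum[symmetric] sum_negf)
    also have "1 / (\<Prod>l<K. fact (v l)) * (\<Prod>l<K. exp (- measure m (B l))) * (\<Prod>l<K. measure m (B l) ^ v l) =
        (\<Prod>l<K. pmf (poisson_dist (measure m (B l))) (v l))"
      by (simp add: pmf_poisson_dist prod.distrib prod_dividef)
    finally show ?thesis .
  qed
  have "is_poisson_measure m P"
    unfolding is_poisson_measure_def
  proof (intro conjI allI impI)
    fix k :: nat and A :: "nat \<Rightarrow> 'a set"
    assume *: "disjoint_family_on A {..<k} \<and> (\<forall>i<k. A i \<in> sets m \<and> emeasure m (A i) < \<infinity>)"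
    \<comment> \<open>the complement is added as a last cell so that the cells form a partition\<close>
    define B where "B = (\<lambda>l. if l < k then A l else space m - (\<Union>i<k. A i))"
    have BA: "B l = A l" if "l < k" for l using that by (simp add: B_def)
    have B: "disjoint_family_on B {..<Suc k}" "\<And>l. l < Suc k \<Longrightarrow> B l \<in> sets m"
      "(\<Union>l<Suc k. B l) = space m"
    proof -
      show "disjoint_family_on B {..<Suc k}"
        using * unfolding disjoint_family_on_def B_def by auto
      show "B l \<in> sets m" if "l < Suc k" for l using * by (auto simp: B_def)
      have "(\<Union>l<Suc k. B l) = (\<Union>l<k. A l) \<union> (space m - (\<Union>i<k. A i))"
        by (auto simp: B_def lessThan_Suc)
      also have "\<dots> = space m" using * sets.sets_into_space by blast
      finally show "(\<Union>l<Suc k. B l) = space m" .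
    qed
    have meas: "(\<lambda>\<xi>. emeasure \<xi> (B l)) \<in> borel_measurable P" if "l < Suc k" for l
      using B(2)[OF that] by (subst measurable_cong_sets[OF sets_P refl]) auto
    have "prob_space.indep_vars P (\<lambda>_. borel) (\<lambda>i \<xi>. emeasure \<xi> (B i)) {..<Suc k}"
      using P.prob_space_axioms meas cells[OF B] by (rule indep_vars_if_joint_pmf(1))
    then have "P.indep_vars (\<lambda>_. borel) (\<lambda>i \<xi>. emeasure \<xi> (B i)) {..<k}"
      by (rule P.indep_vars_subset) auto
    then show "P.indep_vars (\<lambda>_. borel) (\<lambda>i \<xi>. emeasure \<xi> (A i)) {..<k}"
      by (subst P.indep_vars_cong[of "{..<k}" "{..<k}" "\<lambda>i \<xi>. emeasure \<xi> (A i)" "\<lambda>i \<xi>. emeasure \<xi> (B i)"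
          "\<lambda>_. borel" "\<lambda>_. borel"]) (auto simp: BA)
    fix i assume "i < k"
    have "distr P borel (\<lambda>\<xi>. emeasure \<xi> (B i)) =
        distr (measure_pmf (poisson_dist (measure m (B i)))) borel (of_nat :: nat \<Rightarrow> ennreal)"
      using P.prob_space_axioms meas cells[OF B] less_SucI[OF \<open>i < k\<close>]
      by (rule indep_vars_if_joint_pmf(2))
    then show "distr P borel (\<lambda>\<xi>. emeasure \<xi> (A i)) =
        distr (measure_pmf (poisson_dist (measure m (A i)))) borel (of_nat :: nat \<Rightarrow> ennreal)"
      using BA[OF \<open>i < k\<close>] by simp
  qed (rule P.prob_space_axioms, rule sets_P)
  then show ?thesis by blast
qed

text \<open>
  The intensity 0 cannot be normalised to a distribution of points and is treated separately.
\<close>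

lemma is_poisson_measure_return_null:
  assumes "emeasure m (space m) = 0"
  shows "is_poisson_measure m (return (measures_space m) (null_measure m))"
proof (rule is_poisson_measureI)
  show "prob_space (return (measures_space m) (null_measure m))"
    by (intro prob_space_return) simp
  fix k :: nat and A v assume A: "\<And>i. i < k \<Longrightarrow> A i \<in> sets m"
  let ?R = "return (measures_space m) (null_measure m)"
  have S: "{\<xi> \<in> space ?R. \<forall>l<k. emeasure \<xi> (A l) = of_nat (v l)} \<in> sets (measures_space m)"
    unfolding space_return space_measures_space using A by (rule sets_joint_counts)
  have z: "measure m (A l) = 0" if "l < k" for l
    using emeasure_mono[of "A l" "space m" m] A[OF that] sets.sets_into_space[OF A[OF that]] assms
    by (simp add: measure_def)
  have "measure ?R {\<xi> \<in> space ?R. \<forall>l<k. emeasure \<xi> (A l) = of_nat (v l)} =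
      indicator {\<xi> \<in> space ?R. \<forall>l<k. emeasure \<xi> (A l) = of_nat (v l)} (null_measure m)"
    using S by (rule measure_return)
  also have "\<dots> = (if \<forall>l<k. v l = 0 then 1 else 0)" by (auto simp: indicator_def)
  also have "\<dots> = (\<Prod>l<k. if v l = 0 then 1 else 0)"
    by (auto simp: prod_zero_iff)
  also have "\<dots> = (\<Prod>l<k. pmf (poisson_dist (measure m (A l))) (v l))"
    using z by (intro prod.cong) (auto simp: poisson_dist_def indicator_def)
  finally show "measure ?R {\<xi> \<in> space ?R. \<forall>l<k. emeasure \<xi> (A l) = of_nat (v l)} =
      (\<Prod>l<k. pmf (poisson_dist (measure m (A l))) (v l))" .
qed simp

lemma ex_is_poisson_measure_finite:
  assumes "emeasure m (space m) < \<infinity>"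
  shows "\<exists>P. is_poisson_measure m P"
proof (cases "emeasure m (space m) = 0")
  case True
  then show ?thesis using is_poisson_measure_return_null by blast
next
  case False
  then have "0 < measure m (space m)"
    using assms by (auto simp: measure_def enn2real_positive_iff less_top[symmetric] zero_less_iff_neq_zero)
  then show ?thesis using ex_is_poisson_measure_positive_finite assms by blast
qed

lemma density_indicator:
  assumes "U \<in> sets m"
  shows "sets (density m (indicator U)) = sets m"
    and "A \<in> sets m \<Longrightarrow> emeasure (density m (indicator U)) A = emeasure m (A \<inter> U)"
proof -
  show "sets (density m (indicator U)) = sets m" by simp
  show "emeasure (density m (indicator U)) A = emeasure m (A \<inter> U)" if "A \<in> sets m"
  proof -
    have "emeasure (density m (indicator U)) A = (\<integral>\<^sup>+x. indicator U x * indicator A x \<partial>m)"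
      using that assms by (subst emeasure_density) auto
    also have "\<dots> = (\<integral>\<^sup>+x. indicator (A \<inter> U) x \<partial>m)"
      by (intro nn_integral_cong) (auto simp: indicator_def)
    also have "\<dots> = emeasure m (A \<inter> U)" using that assms by (subst nn_integral_indicator) auto
    finally show ?thesis .
  qed
qed

definition sum_measure :: "'a measure \<Rightarrow> (nat \<Rightarrow> 'a measure) \<Rightarrow> 'a measure" where
  "sum_measure m \<omega> = measure_of (space m) (sets m) (\<lambda>A. \<Sum>i. emeasure (\<omega> i) A)"

lemma sets_sum_measure [simp]: "sets (sum_measure m \<omega>) = sets m"
  by (simp add: sum_measure_def)

lemma emeasure_sum_measure:
  assumes "\<And>i. sets (\<omega> i) = sets m" and A: "A \<in> sets m"
  shows "emeasure (sum_measure m \<omega>) A = (\<Sum>i. emeasure (\<omega> i) A)"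
proof (rule emeasure_measure_of[OF sum_measure_def])
  show "countably_additive (sets (sum_measure m \<omega>)) (\<lambda>A. \<Sum>i. emeasure (\<omega> i) A)"
  proof (rule countably_additiveI)
    fix F :: "nat \<Rightarrow> 'a set"
    assume F: "range F \<subseteq> sets (sum_measure m \<omega>)" "disjoint_family F"
    have "(\<Sum>j. \<Sum>i. emeasure (\<omega> i) (F j)) = (\<Sum>j. \<integral>\<^sup>+i. emeasure (\<omega> i) (F j) \<partial>count_space UNIV)"
      by (simp add: nn_integral_count_space_nat)
    also have "\<dots> = (\<integral>\<^sup>+i. (\<Sum>j. emeasure (\<omega> i) (F j)) \<partial>count_space UNIV)"
      by (rule nn_integral_suminf[symmetric]) simp
    also have "\<dots> = (\<integral>\<^sup>+i. emeasure (\<omega> i) (\<Union>(range F)) \<partial>count_space UNIV)"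
      using F assms(1) by (simp add: suminf_emeasure)
    finally show "(\<Sum>j. \<Sum>i. emeasure (\<omega> i) (F j)) = (\<Sum>i. emeasure (\<omega> i) (\<Union>(range F)))"
      by (simp add: nn_integral_count_space_nat)
  qed
qed (use A in \<open>auto simp: positive_def sets.space_closed dest: sets.sets_into_space\<close>)

lemma suminf_01:
  fixes x :: "nat \<Rightarrow> ennreal"
  assumes "\<And>i. x i \<in> {0, 1}" and "\<And>i j. i \<noteq> j \<Longrightarrow> x i = 0 \<or> x j = 0"
  shows "(\<Sum>i. x i) \<in> {0, 1}"
proof (cases "\<forall>i. x i = 0")
  case True
  then show ?thesis by simp
next
  case False
  then obtain i where i: "x i \<noteq> 0" by blast
  have "(\<Sum>j. x j) = (\<Sum>j\<in>{i}. x j)"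
    using assms(2)[of i] i by (intro suminf_finite) auto
  then show ?thesis using assms(1)[of i] by simp
qed

text \<open>
  The intensity is cut into countably many finite pieces, and independent Poisson processes on the
  pieces are superposed. The avoidance probabilities multiply to \<open>exp (- (\<Sum>i. r i))\<close>, and the
  bound for multiple points follows from \<open>(\<Sum>i. r i)\<^sup>2 = (\<Sum>i. \<Sum>j. r i * r j)\<close>, where \<open>r i\<close> is the mass
  of \<open>A\<close> in the \<open>i\<close>-th piece.
\<close>

lemma ex_poisson_like:
  assumes "sigma_finite_measure m"
  shows "\<exists>P. poisson_like m P"
proof -
  interpret sigma_finite_measure m by fact
  obtain D :: "nat \<Rightarrow> 'a set" where D: "range D \<subseteq> sets m" "(\<Union>i. D i) = space m"
    "\<And>i. emeasure m (D i) \<noteq> \<infinity>" "disjoint_family D"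
    using sigma_finite_disjoint by metis
  define mm where "mm i = density m (indicator (D i))" for i
  have D_sets: "D i \<in> sets m" for i using D(1) by auto
  note mm = density_indicator[OF D_sets, folded mm_def]
  have space_mm: "space (mm i) = space m" for i by (simp add: mm_def)
  have msp: "measures_space (mm i) = measures_space m" for i
    by (rule measures_space_cong) (simp add: mm)
  have "\<exists>P. is_poisson_measure (mm i) P" for i
  proof (rule ex_is_poisson_measure_finite)
    have "emeasure (mm i) (space m) = emeasure m (D i)"
      using sets.sets_into_space[OF D_sets] by (simp add: mm Int_absorb1)
    then show "emeasure (mm i) (space (mm i)) < \<infinity>" using D(3)[of i] by (simp add: space_mm less_top)
  qed
  then obtain p where p: "\<And>i. is_poisson_measure (mm i) (p i)" by metis
  note pl = is_poisson_measure_imp_poisson_like[OF p]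
  have sets_p: "sets (p i) = sets (measures_space m)" for i using poisson_likeD(2)[OF pl] msp by simp
  interpret pi: prob_space "p i" for i by (rule poisson_likeD(1)[OF pl])
  interpret PP: product_prob_space p UNIV ..
  define \<Omega> where "\<Omega> = PiM UNIV p"
  interpret O: prob_space \<Omega> unfolding \<Omega>_def by (rule PP.prob_space_axioms)
  have space_p: "space (p i) = measures_on m" for i
    using sets_eq_imp_space_eq[OF sets_p] by simp
  have space_\<Omega>: "space \<Omega> = {\<omega>. \<forall>i. sets (\<omega> i) = sets m}"
    by (auto simp: \<Omega>_def space_PiM PiE_def space_p measures_on_def)
  have comp: "(\<lambda>\<omega>. \<omega> i) \<in> \<Omega> \<rightarrow>\<^sub>M measures_space m" for i
    unfolding \<Omega>_def measurable_cong_sets[OF refl sets_p[of i], symmetric] by simp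
  have comp_em: "(\<lambda>\<omega>. emeasure (\<omega> i) A) \<in> borel_measurable \<Omega>" if "A \<in> sets m" for i A
    using measurable_compose[OF comp measurable_emeasure_measures_space[OF that]] .
  have em: "emeasure (sum_measure m \<omega>) A = (\<Sum>i. emeasure (\<omega> i) A)"
    if "\<omega> \<in> space \<Omega>" "A \<in> sets m" for \<omega> A
    using that by (intro emeasure_sum_measure) (auto simp: space_\<Omega>)
  have sum_meas: "sum_measure m \<in> \<Omega> \<rightarrow>\<^sub>M measures_space m"
  proof (rule measurable_measures_spaceI)
    fix A assume A: "A \<in> sets m"
    have "(\<lambda>\<omega>. \<Sum>i. emeasure (\<omega> i) A) \<in> borel_measurable \<Omega>" using comp_em[OF A] by measurable
    then show "(\<lambda>\<omega>. emeasure (sum_measure m \<omega>) A) \<in> borel_measurable \<Omega>"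
      by (subst measurable_cong[OF em[OF _ A]])
  qed simp
  define P where "P = distr \<Omega> (measures_space m) (sum_measure m)"
  have "poisson_like m P"
    unfolding poisson_like_def
  proof (intro conjI ballI impI)
    show "prob_space P" unfolding P_def using sum_meas by (rule O.prob_space_distr)
    show "sets P = sets (measures_space m)" by (simp add: P_def)
    have space_P: "space P = measures_on m" by (simp add: P_def)
    fix A assume A: "A \<in> sets m" "emeasure m A < \<infinity>"
    have mA: "A \<in> sets (mm i)" "emeasure (mm i) A < \<infinity>" for i
    proof -
      show "A \<in> sets (mm i)" using A mm by simp
      have "emeasure (mm i) A \<le> emeasure m A"
        using A D_sets by (simp add: mm emeasure_mono)
      then show "emeasure (mm i) A < \<infinity>" using A by (auto intro: le_less_trans)
    qed
    define r where "r = (\<lambda>i. measure (mm i) A)"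
    have r_em: "emeasure (mm i) A = ennreal (r i)" for i
      using mA(2)[of i] by (simp add: r_def emeasure_eq_ennreal_measure)
    have r_suminf: "(\<Sum>i. ennreal (r i)) = ennreal (measure m A)"
    proof -
      have "emeasure m A = (\<Sum>i. emeasure m (A \<inter> D i))"
        using D A by (intro emeasure_eq_suminf_pieces) auto
      also have "\<dots> = (\<Sum>i. ennreal (r i))" using A by (simp add: mm flip: r_em)
      finally have "(\<Sum>i. ennreal (r i)) = emeasure m A" by (rule sym)
      also have "\<dots> = ennreal (measure m A)" using A by (intro emeasure_eq_ennreal_measure) auto
      finally show ?thesis .
    qed
    have r0: "0 \<le> r i" for i by (simp add: r_def)
    have r_sums: "r sums measure m A"
    proof -
      have "summable r" by (rule summable_suminf_not_top[OF r0]) (simp add: r_suminf)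
      moreover have "suminf r = measure m A"
      proof -
        have "ennreal (suminf r) = ennreal (measure m A)"
          using suminf_ennreal2[OF r0 \<open>summable r\<close>] r_suminf by simp
        then show ?thesis using suminf_nonneg[OF \<open>summable r\<close> r0] by simp
      qed
      ultimately show ?thesis by (simp add: sums_iff)
    qed
    have distr_P: "measure P {\<xi> \<in> space P. emeasure \<xi> A \<in> S} =
        measure \<Omega> {\<omega> \<in> space \<Omega>. (\<Sum>i. emeasure (\<omega> i) A) \<in> S}" if "S \<in> sets borel" for S
    proof -
      have "(\<lambda>\<xi>. emeasure \<xi> A) -` S \<inter> space (measures_space m) \<in> sets (measures_space m)"
        using measurable_emeasure_measures_space[OF A(1)] that by (rule measurable_sets)
      then have "measure P ((\<lambda>\<xi>. emeasure \<xi> A) -` S \<inter> space (measures_space m)) =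
          measure \<Omega> (sum_measure m -` ((\<lambda>\<xi>. emeasure \<xi> A) -` S \<inter> space (measures_space m)) \<inter> space \<Omega>)"
        unfolding P_def using sum_meas by (intro measure_distr)
      also have "sum_measure m -` ((\<lambda>\<xi>. emeasure \<xi> A) -` S \<inter> space (measures_space m)) \<inter> space \<Omega> =
          {\<omega> \<in> space \<Omega>. (\<Sum>i. emeasure (\<omega> i) A) \<in> S}"
        using measurable_space[OF sum_meas] em[OF _ A(1)] by auto
      also have "(\<lambda>\<xi>. emeasure \<xi> A) -` S \<inter> space (measures_space m) = {\<xi> \<in> space P. emeasure \<xi> A \<in> S}"
        by (auto simp: space_P)
      finally show ?thesis .
    qed
    have ev: "{\<xi> \<in> space (p i). emeasure \<xi> A \<in> S} \<in> sets (p i)" if "S \<in> sets borel" for S i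
    proof -
      have "(\<lambda>\<xi>. emeasure \<xi> A) -` S \<inter> space (measures_space m) \<in> sets (measures_space m)"
        using measurable_emeasure_measures_space[OF A(1)] that by (rule measurable_sets)
      then show ?thesis by (simp add: sets_p space_p vimage_def Int_def conj_commute)
    qed
    have evO: "{\<omega> \<in> space \<Omega>. emeasure (\<omega> i) A \<in> S} \<in> sets \<Omega>" if "S \<in> sets borel" for S i
      using measurable_sets[OF comp_em[OF A(1)] that] by (simp add: vimage_def Int_def conj_commute)
    have cyl: "measure \<Omega> {\<omega> \<in> space \<Omega>. \<forall>i\<in>J. emeasure (\<omega> i) A \<in> S i} =
        (\<Prod>i\<in>J. measure (p i) {\<xi> \<in> space (p i). emeasure \<xi> A \<in> S i})"
      if J: "finite J" "\<And>i. S i \<in> sets borel" for J S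
    proof -
      have "emeasure \<Omega> {\<omega> \<in> space \<Omega>. \<forall>i\<in>J. \<omega> i \<in> {\<xi> \<in> space (p i). emeasure \<xi> A \<in> S i}} =
        (\<Prod>i\<in>J. emeasure (p i) {\<xi> \<in> space (p i). emeasure \<xi> A \<in> S i})"
        unfolding \<Omega>_def using J ev by (intro PP.emeasure_PiM_Collect) auto
      also have "{\<omega> \<in> space \<Omega>. \<forall>i\<in>J. \<omega> i \<in> {\<xi> \<in> space (p i). emeasure \<xi> A \<in> S i}} =
          {\<omega> \<in> space \<Omega>. \<forall>i\<in>J. emeasure (\<omega> i) A \<in> S i}"
        by (auto simp: space_p space_\<Omega> measures_on_def)
      finally show ?thesis
        by (simp add: O.emeasure_eq_measure pi.emeasure_eq_measure prod_ennreal prod_nonneg)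
    qed
    show "measure P {\<xi> \<in> space P. emeasure \<xi> A = 0} = exp (- measure m A)"
    proof -
      define E where "E = (\<lambda>n. {\<omega> \<in> space \<Omega>. \<forall>i<n. emeasure (\<omega> i) A = 0})"
      have E: "measure \<Omega> (E n) = exp (- (\<Sum>i<n. r i))" for n
      proof -
        have "measure \<Omega> (E n) = (\<Prod>i<n. measure (p i) {\<xi> \<in> space (p i). emeasure \<xi> A = 0})"
          using cyl[of "{..<n}" "\<lambda>_. {0}"] by (simp add: E_def Ball_def)
        also have "\<dots> = (\<Prod>i<n. exp (- r i))"
          using poisson_likeD(4)[OF pl mA] by (simp add: r_def)
        also have "\<dots> = exp (- (\<Sum>i<n. r i))" by (simp add: exp_sum[symmetric] sum_negf)
        finally show ?thesis .
      qed
      have E_sets: "E n \<in> sets \<Omega>" for n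
      proof -
        have "E n = space \<Omega> - (\<Union>i\<in>{..<n}. space \<Omega> - {\<omega> \<in> space \<Omega>. emeasure (\<omega> i) A \<in> {0}})"
          by (auto simp: E_def)
        also have "\<dots> \<in> sets \<Omega>" using evO[of "{0}"]
          by (intro sets.Diff sets.top sets.finite_UN) auto
        finally show ?thesis .
      qed
      have "(\<lambda>n. measure \<Omega> (E n)) \<longlonglongrightarrow> measure \<Omega> (\<Inter>n. E n)"
      proof (rule O.finite_Lim_measure_decseq)
        show "decseq E"
        proof (rule decseq_SucI)
          show "E (Suc n) \<subseteq> E n" for n unfolding E_def by fastforce
        qed
      qed (use E_sets in blast)
      moreover have "(\<lambda>n. measure \<Omega> (E n)) \<longlonglongrightarrow> exp (- measure m A)"
        unfolding E using r_sums by (intro tendsto_intros) (simp add: sums_def)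
      ultimately have "measure \<Omega> (\<Inter>n. E n) = exp (- measure m A)" by (rule LIMSEQ_unique)
      moreover have "(\<Inter>n. E n) = {\<omega> \<in> space \<Omega>. (\<Sum>i. emeasure (\<omega> i) A) \<in> {0}}"
        by (auto simp: E_def suminf_eq_zero_iff)
      ultimately show ?thesis using distr_P[of "{0}"] by simp
    qed
    \<comment> \<open>a value other than 0 and 1 needs a multiple count in one piece or two occupied pieces\<close>
    show "measure P {\<xi> \<in> space P. emeasure \<xi> A \<notin> {0, 1}} \<le> (measure m A)\<^sup>2"
    proof -
      define B where "B = (\<lambda>i j. if i = j then {\<omega> \<in> space \<Omega>. emeasure (\<omega> i) A \<in> - {0, 1}}
        else {\<omega> \<in> space \<Omega>. \<forall>l\<in>{i, j}. emeasure (\<omega> l) A \<in> - {0}})"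
      have B: "B i j \<in> sets \<Omega> \<and> measure \<Omega> (B i j) \<le> r i * r j" for i j
      proof (cases "i = j")
        case True
        have "measure \<Omega> (B i j) = measure (p i) {\<xi> \<in> space (p i). emeasure \<xi> A \<notin> {0, 1}}"
          using cyl[of "{i}" "\<lambda>_. - {0, 1}"] True by (simp add: B_def)
        also have "\<dots> \<le> (r i)\<^sup>2" using poisson_likeD(5)[OF pl mA] by (simp add: r_def)
        finally show ?thesis using True evO[of "- {0, 1}" i] by (simp add: B_def power2_eq_square)
      next
        case False
        have ne: "measure (p i) {\<xi> \<in> space (p i). emeasure \<xi> A \<in> - {0}} \<le> r i" for i
        proof -
          have "measure (p i) (space (p i) - {\<xi> \<in> space (p i). emeasure \<xi> A \<in> {0}}) =
              1 - measure (p i) {\<xi> \<in> space (p i). emeasure \<xi> A \<in> {0}}"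
            using ev[of "{0}"] by (intro pi.prob_compl) auto
          also have "\<dots> = 1 - exp (- r i)" using poisson_likeD(4)[OF pl mA] by (simp add: r_def)
          also have "\<dots> \<le> r i" using exp_ge_add_one_self[of "- r i"] by simp
          also have "space (p i) - {\<xi> \<in> space (p i). emeasure \<xi> A \<in> {0}} =
            {\<xi> \<in> space (p i). emeasure \<xi> A \<in> - {0}}" by auto
          finally show ?thesis .
        qed
        have "measure \<Omega> (B i j) = (\<Prod>l\<in>{i,j}. measure (p l) {\<xi> \<in> space (p l). emeasure \<xi> A \<in> - {0}})"
          using cyl[of "{i, j}" "\<lambda>_. - {0}"] False unfolding B_def by simp
        also have "\<dots> \<le> r i * r j" using False ne r0 by (simp add: mult_mono)
        finally have "measure \<Omega> (B i j) \<le> r i * r j" .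
        moreover have "B i j = {\<omega> \<in> space \<Omega>. emeasure (\<omega> i) A \<in> - {0}} \<inter> {\<omega> \<in> space \<Omega>. emeasure (\<omega> j) A \<in> - {0}}"
          using False by (auto simp: B_def)
        ultimately show ?thesis using evO[of "- {0}"] by auto
      qed
      have BU: "(\<Union>i. \<Union>j. B i j) \<in> sets \<Omega>" using B by auto
      have sub: "{\<omega> \<in> space \<Omega>. (\<Sum>i. emeasure (\<omega> i) A) \<in> - {0, 1}} \<subseteq> (\<Union>i. \<Union>j. B i j)"
      proof
        fix \<omega> assume \<omega>: "\<omega> \<in> {\<omega> \<in> space \<Omega>. (\<Sum>i. emeasure (\<omega> i) A) \<in> - {0, 1}}"
        show "\<omega> \<in> (\<Union>i. \<Union>j. B i j)"
        proof (rule ccontr)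
          assume n: "\<omega> \<notin> (\<Union>i. \<Union>j. B i j)"
          have "(\<Sum>i. emeasure (\<omega> i) A) \<in> {0, 1}"
          proof (rule suminf_01)
            fix i
            have "\<omega> \<notin> B i i" using n by blast
            then show "emeasure (\<omega> i) A \<in> {0, 1}" using \<omega> by (auto simp: B_def)
          next
            fix i j :: nat assume "i \<noteq> j"
            moreover have "\<omega> \<notin> B i j" using n by blast
            ultimately show "emeasure (\<omega> i) A = 0 \<or> emeasure (\<omega> j) A = 0" using \<omega> by (auto simp: B_def)
          qed
          then show False using \<omega> by blast
        qed
      qed
      have "emeasure \<Omega> (\<Union>i. \<Union>j. B i j) \<le> (\<Sum>i. emeasure \<Omega> (\<Union>j. B i j))"
        using B by (intro emeasure_subadditive_countably) auto
      also have "\<dots> \<le> (\<Sum>i. \<Sum>j. emeasure \<Omega> (B i j))"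
        using B by (intro suminf_le emeasure_subadditive_countably) auto
      also have "\<dots> \<le> (\<Sum>i. \<Sum>j. ennreal (r i) * ennreal (r j))"
        using B r0 by (intro suminf_le) (auto simp: O.emeasure_eq_measure ennreal_mult[symmetric] intro!: ennreal_leI)
      also have "\<dots> = ennreal (measure m A) * ennreal (measure m A)"
        by (simp add: r_suminf)
      finally have "measure \<Omega> (\<Union>i. \<Union>j. B i j) \<le> (measure m A)\<^sup>2"
        by (simp add: O.emeasure_eq_measure ennreal_mult[symmetric] power2_eq_square)
      moreover have "measure \<Omega> {\<omega> \<in> space \<Omega>. (\<Sum>i. emeasure (\<omega> i) A) \<in> - {0, 1}} \<le>
          measure \<Omega> (\<Union>i. \<Union>j. B i j)"
        using sub BU by (rule O.finite_measure_mono)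
      ultimately show ?thesis using distr_P[of "- {0, 1}"] by simp
    qed
  qed
  then show ?thesis by blast
qed

text \<open>
  A version of Renyi's theorem. The counts of finitely many sets of finite measure depend only on the
  restriction of the process to their union \<open>U\<close>. The restricted process has the avoidance function of the
  Poisson process with the finite intensity \<open>m\<close> restricted to \<open>U\<close>, so by uniqueness it is that process.
\<close>

theorem poisson_like_imp_is_poisson_measure:
  assumes dm: "diffuse m" and P: "poisson_like m P"
  shows "is_poisson_measure m P"
proof (rule is_poisson_measureI)
  note PD = poisson_likeD[OF P]
  show "prob_space P" "sets P = sets (measures_space m)" by fact+
  interpret P: prob_space P by fact
  fix k :: nat and A v
  assume A: "disjoint_family_on A {..<k}" "\<And>i. i < k \<Longrightarrow> A i \<in> sets m" "\<And>i. i < k \<Longrightarrow> emeasure m (A i) < \<infinity>"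
  define U where "U = (\<Union>i<k. A i)"
  have U: "U \<in> sets m" using A(2) by (auto simp: U_def)
  define mU where "mU = density m (indicator U)"
  note mU = density_indicator[OF U, folded mU_def]
  have U_fin: "emeasure m U < \<infinity>"
  proof -
    have "emeasure m U \<le> (\<Sum>i<k. emeasure m (A i))"
      unfolding U_def using A(2) by (intro emeasure_subadditive_finite) auto
    also have "\<dots> < \<infinity>" using A(3) by (auto simp: less_top)
    finally show ?thesis .
  qed
  have fin_mU: "emeasure mU (space mU) < \<infinity>"
    using sets.sets_into_space[OF U] U_fin mU(2)[of "space m"] by (simp add: mU_def Int_absorb1)
  then have sf: "sigma_finite_measure mU"
    by (intro finite_measure.axioms(1) finite_measureI) auto
  have dU: "diffuse mU" using dm
    by (rule diffuse_if_le) (use U in \<open>auto simp: mU intro!: emeasure_mono\<close>)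
  have msp: "measures_space mU = measures_space m" by (rule measures_space_cong) (simp add: mU)
  obtain Q where Q: "is_poisson_measure mU Q" using ex_is_poisson_measure_finite[OF fin_mU] by blast
  define R where "R = (\<lambda>\<xi> :: 'a measure. density \<xi> (indicator U))"
  have R_em: "emeasure (R \<xi>) C = emeasure \<xi> (C \<inter> U)" if "\<xi> \<in> measures_on m" "C \<in> sets m" for \<xi> C
    unfolding R_def using that U by (intro density_indicator(2)) (auto simp: measures_on_def)
  have R_meas: "R \<in> P \<rightarrow>\<^sub>M measures_space m"
  proof (rule measurable_measures_spaceI)
    show "sets (R \<xi>) = sets m" if "\<xi> \<in> space P" for \<xi>
      using that PD(3) by (auto simp: R_def measures_on_def)
    fix C assume C: "C \<in> sets m"
    have "(\<lambda>\<xi>. emeasure \<xi> (C \<inter> U)) \<in> borel_measurable P"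
      using C U by (subst measurable_cong_sets[OF PD(2) refl]) auto
    then show "(\<lambda>\<xi>. emeasure (R \<xi>) C) \<in> borel_measurable P"
      using R_em[OF _ C] PD(3) by (subst measurable_cong[where g = "\<lambda>\<xi>. emeasure \<xi> (C \<inter> U)"]) auto
  qed
  define P' where "P' = distr P (measures_space m) R"
  have space_P': "space P' = measures_on m" by (simp add: P'_def)
  have dist: "measure P' E = measure P (R -` E \<inter> space P)" if "E \<in> sets (measures_space m)" for E
    unfolding P'_def using R_meas that by (rule measure_distr)
  have law: "measure P' {\<xi> \<in> space P'. emeasure \<xi> C \<in> S} = measure P {\<xi> \<in> space P. emeasure \<xi> (C \<inter> U) \<in> S}"
    if C: "C \<in> sets m" and S: "S \<in> sets borel" for C S
  proof -
    have "(\<lambda>\<xi>. emeasure \<xi> C) -` S \<inter> space (measures_space m) \<in> sets (measures_space m)"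
      using measurable_emeasure_measures_space[OF C] S by (rule measurable_sets)
    from dist[OF this]
    have "measure P' ((\<lambda>\<xi>. emeasure \<xi> C) -` S \<inter> space (measures_space m)) =
      measure P (R -` ((\<lambda>\<xi>. emeasure \<xi> C) -` S \<inter> space (measures_space m)) \<inter> space P)" .
    also have "R -` ((\<lambda>\<xi>. emeasure \<xi> C) -` S \<inter> space (measures_space m)) \<inter> space P =
        {\<xi> \<in> space P. emeasure \<xi> (C \<inter> U) \<in> S}"
      using measurable_space[OF R_meas] R_em[OF _ C] PD(3) by auto
    also have "(\<lambda>\<xi>. emeasure \<xi> C) -` S \<inter> space (measures_space m) = {\<xi> \<in> space P'. emeasure \<xi> C \<in> S}"
      by (auto simp: space_P')
    finally show ?thesis .
  qed
  have "poisson_like mU P'"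
    unfolding poisson_like_def
  proof (intro conjI ballI impI)
    show "prob_space P'" unfolding P'_def using R_meas by (rule P.prob_space_distr)
    show "sets P' = sets (measures_space mU)" by (simp add: P'_def msp)
    fix C assume "C \<in> sets mU"
    then have C: "C \<in> sets m" "C \<inter> U \<in> sets m" using mU U by auto
    have CU: "emeasure m (C \<inter> U) < \<infinity>"
      using emeasure_mono[of "C \<inter> U" U m] U U_fin by (auto intro: le_less_trans)
    have me: "measure mU C = measure m (C \<inter> U)" using mU(2)[OF C(1)] by (simp add: measure_def)
    show "measure P' {\<xi> \<in> space P'. emeasure \<xi> C = 0} = exp (- measure mU C)"
      using law[OF C(1), of "{0}"] PD(4)[OF C(2) CU] me by simp
    show "measure P' {\<xi> \<in> space P'. emeasure \<xi> C \<notin> {0, 1}} \<le> (measure mU C)\<^sup>2"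
      using law[OF C(1), of "- {0, 1}"] PD(5)[OF C(2) CU] me by simp
  qed
  then have P'Q: "P' = Q"
    using sf dU is_poisson_measure_imp_poisson_like[OF Q] by (intro poisson_like_unique)
  have AU: "A l \<inter> U = A l" if "l < k" for l using that by (auto simp: U_def)
  have meA: "measure mU (A l) = measure m (A l)" "emeasure mU (A l) < \<infinity>" "A l \<in> sets mU" if "l < k" for l
    using mU(2)[OF A(2)[OF that]] AU[OF that] A(3)[OF that] A(2)[OF that] by (auto simp: measure_def mU)
  note S = sets_joint_counts[where k = k and A = A and v = v and m = m, OF A(2)]
  have "{\<xi> \<in> space P. \<forall>l<k. emeasure \<xi> (A l) = of_nat (v l)} =
      R -` {\<xi> \<in> measures_on m. \<forall>l<k. emeasure \<xi> (A l) = of_nat (v l)} \<inter> space P"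
    using measurable_space[OF R_meas] R_em A(2) AU PD(3) by auto
  also have "measure P \<dots> = measure P' {\<xi> \<in> space P'. \<forall>l<k. emeasure \<xi> (A l) = of_nat (v l)}"
    using dist[OF S] space_P' by simp
  also have "\<dots> = (\<Prod>l<k. pmf (poisson_dist (measure mU (A l))) (v l))"
    unfolding P'Q using A(1) meA by (intro is_poisson_measure_joint[OF Q]) auto
  also have "\<dots> = (\<Prod>l<k. pmf (poisson_dist (measure m (A l))) (v l))"
    using meA(1) by simp
  finally show "measure P {\<xi> \<in> space P. \<forall>l<k. emeasure \<xi> (A l) = of_nat (v l)} =
      (\<Prod>l<k. pmf (poisson_dist (measure m (A l))) (v l))" .
qed

theorem is_poisson_measure_poisson_measure:
  assumes "sigma_finite_measure m" "diffuse m"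
  shows "is_poisson_measure m (poisson_measure m)"
  unfolding poisson_measure_def
proof (rule theI')
  obtain P where "poisson_like m P" using ex_poisson_like[OF assms(1)] by blast
  then have "is_poisson_measure m P" using assms(2) by (intro poisson_like_imp_is_poisson_measure)
  then show "\<exists>!P. is_poisson_measure m P"
    using poisson_like_unique[OF assms] is_poisson_measure_imp_poisson_like by blast
qed

lemma poisson_like_poisson_measure:
  assumes "sigma_finite_measure m" "diffuse m"
  shows "poisson_like m (poisson_measure m)"
  using is_poisson_measure_poisson_measure[OF assms] by (rule is_poisson_measure_imp_poisson_like)

section \<open>Pairs of random measures\<close>

text \<open>
  The sum of the two masses vanishes exactly if both do; so a pair of sets can be treated like a single
  set of the disjoint union of the two spaces, and \<open>prob_eq_if_avoidance_eq\<close> applies.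
\<close>

definition count_pair :: "'a set \<Rightarrow> 'b set \<Rightarrow> 'a measure \<times> 'b measure \<Rightarrow> ennreal" where
  "count_pair A B p = emeasure (fst p) A + emeasure (snd p) B"

definition vacancy :: "('a measure \<times> 'b measure) measure \<Rightarrow> 'a set \<Rightarrow> 'b set \<Rightarrow> real" where
  "vacancy P A B = measure P {p \<in> space P. count_pair A B p = 0}"

definition multiplicity_prob :: "('a measure \<times> 'b measure) measure \<Rightarrow> 'a set \<Rightarrow> 'b set \<Rightarrow> real" where
  "multiplicity_prob P A B = measure P {p \<in> space P. count_pair A B p \<notin> {0, 1}}"

lemma space_pair_measures_space: "space (pair_measures_space M N) = measures_on M \<times> measures_on N"
  by (simp add: space_pair_measure)

lemma measurable_count_pair [measurable]:
  assumes "A \<in> sets M" "B \<in> sets N"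
  shows "count_pair A B \<in> borel_measurable (pair_measures_space M N)"
proof -
  have "(\<lambda>p. emeasure (fst p) A) \<in> borel_measurable (pair_measures_space M N)"
    by (rule measurable_compose[OF measurable_fst measurable_emeasure_measures_space[OF assms(1)]])
  moreover have "(\<lambda>p. emeasure (snd p) B) \<in> borel_measurable (pair_measures_space M N)"
    by (rule measurable_compose[OF measurable_snd measurable_emeasure_measures_space[OF assms(2)]])
  ultimately show ?thesis unfolding count_pair_def by measurable
qed

lemma count_pair_event:
  assumes "A \<in> sets M" "B \<in> sets N" "S \<in> sets borel"
  shows "{p \<in> measures_on M \<times> measures_on N. count_pair A B p \<in> S} \<in> sets (pair_measures_space M N)"
proof -
  have "count_pair A B -` S \<inter> space (pair_measures_space M N) \<in> sets (pair_measures_space M N)"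
    using measurable_count_pair[OF assms(1,2)] assms(3) by (rule measurable_sets)
  then show ?thesis by (simp add: space_pair_measures_space vimage_def Int_def conj_commute)
qed

lemma measure_distr_count_pair:
  assumes f: "f \<in> K \<rightarrow>\<^sub>M pair_measures_space M N" and AB: "A \<in> sets M" "B \<in> sets N" and S: "S \<in> sets borel"
  shows "measure (distr K (pair_measures_space M N) f)
      {p \<in> space (distr K (pair_measures_space M N) f). count_pair A B p \<in> S} =
    measure K {\<omega> \<in> space K. count_pair A B (f \<omega>) \<in> S}"
proof -
  have "measure (distr K (pair_measures_space M N) f)
      {p \<in> measures_on M \<times> measures_on N. count_pair A B p \<in> S} =
    measure K (f -` {p \<in> measures_on M \<times> measures_on N. count_pair A B p \<in> S} \<inter> space K)"
    using f count_pair_event[OF AB S] by (rule measure_distr)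
  also have "f -` {p \<in> measures_on M \<times> measures_on N. count_pair A B p \<in> S} \<inter> space K =
      {\<omega> \<in> space K. count_pair A B (f \<omega>) \<in> S}"
    using measurable_space[OF f] by (auto simp: space_pair_measures_space)
  finally show ?thesis by (simp add: space_pair_measures_space)
qed

definition add_pair :: "('a measure \<times> 'b measure) \<times> ('a measure \<times> 'b measure) \<Rightarrow> 'a measure \<times> 'b measure" where
  "add_pair = (\<lambda>((\<xi>, \<eta>), (\<xi>', \<eta>')). (add_measure \<xi> \<xi>', add_measure \<eta> \<eta>'))"

lemma add_pair_measurable:
  "add_pair \<in> pair_measures_space M N \<Otimes>\<^sub>M pair_measures_space M N \<rightarrow>\<^sub>M pair_measures_space M N"
proof (rule measurable_pair)
  let ?K = "pair_measures_space M N \<Otimes>\<^sub>M pair_measures_space M N"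
  have sp: "sets (fst (fst p)) = sets M" "sets (snd (fst p)) = sets N"
    "sets (fst (snd p)) = sets M" "sets (snd (snd p)) = sets N" if "p \<in> space ?K" for p
    using that by (auto simp: space_pair_measure measures_on_def)
  show "fst \<circ> add_pair \<in> ?K \<rightarrow>\<^sub>M measures_space M"
  proof (rule measurable_measures_spaceI)
    fix A assume A: "A \<in> sets M"
    have "(\<lambda>p. emeasure (fst (fst p)) A + emeasure (fst (snd p)) A) \<in> borel_measurable ?K"
      by (intro borel_measurable_add
        measurable_compose[OF _ measurable_emeasure_measures_space[OF A]]) auto
    then show "(\<lambda>p. emeasure ((fst \<circ> add_pair) p) A) \<in> borel_measurable ?K"
      by (rule measurable_cong[THEN iffD1, rotated])
        (auto simp: add_pair_def split_beta emeasure_add_measure sp)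
  qed (auto simp: add_pair_def split_beta sp)
  show "snd \<circ> add_pair \<in> ?K \<rightarrow>\<^sub>M measures_space N"
  proof (rule measurable_measures_spaceI)
    fix A assume A: "A \<in> sets N"
    have "(\<lambda>p. emeasure (snd (fst p)) A + emeasure (snd (snd p)) A) \<in> borel_measurable ?K"
      by (intro borel_measurable_add
        measurable_compose[OF _ measurable_emeasure_measures_space[OF A]]) auto
    then show "(\<lambda>p. emeasure ((snd \<circ> add_pair) p) A) \<in> borel_measurable ?K"
      by (rule measurable_cong[THEN iffD1, rotated])
        (auto simp: add_pair_def split_beta emeasure_add_measure sp)
  qed (auto simp: add_pair_def split_beta sp)
qed

lemma count_pair_add_pair:
  assumes "p \<in> measures_on M \<times> measures_on N" "q \<in> measures_on M \<times> measures_on N"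
  shows "count_pair A B (add_pair (p, q)) = count_pair A B p + count_pair A B q"
  using assms by (auto simp: count_pair_def add_pair_def split_beta measures_on_def emeasure_add_measure)

lemma ennreal_sum_01:
  fixes x y :: ennreal
  shows "x + y \<notin> {0, 1} \<Longrightarrow> x \<notin> {0, 1} \<or> y \<notin> {0, 1} \<or> (x \<noteq> 0 \<and> y \<noteq> 0)"
  by auto

context
  fixes M :: "'a measure" and N :: "'b measure" and P Q :: "('a measure \<times> 'b measure) measure"
  assumes P: "prob_space P" "sets P = sets (pair_measures_space M N)"
    and Q: "prob_space Q" "sets Q = sets (pair_measures_space M N)"
begin

interpretation P: prob_space P by (rule P)
interpretation Q: prob_space Q by (rule Q)
interpretation PQ: pair_prob_space P Q ..

lemma space_laws: "space P = measures_on M \<times> measures_on N" "space Q = measures_on M \<times> measures_on N"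
  using sets_eq_imp_space_eq[OF P(2)] sets_eq_imp_space_eq[OF Q(2)]
  by (auto simp: space_pair_measures_space)

lemma add_pair_measurable_laws: "add_pair \<in> P \<Otimes>\<^sub>M Q \<rightarrow>\<^sub>M pair_measures_space M N"
  using add_pair_measurable[of M N]
  by (subst measurable_cong_sets[OF sets_pair_measure_cong[OF P(2) Q(2)] refl])

lemma convolution_pair_eq: "convolution_pair M N P Q = distr (P \<Otimes>\<^sub>M Q) (pair_measures_space M N) add_pair"
  unfolding convolution_pair_def add_pair_def ..

lemma prob_space_convolution_pair: "prob_space (convolution_pair M N P Q)"
  unfolding convolution_pair_eq by (rule PQ.prob_space_distr[OF add_pair_measurable_laws])

lemma sets_convolution_pair: "sets (convolution_pair M N P Q) = sets (pair_measures_space M N)"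
  by (simp add: convolution_pair_eq)

lemma measure_convolution_pair:
  assumes AB: "A \<in> sets M" "B \<in> sets N" and S: "S \<in> sets borel"
  shows "measure (convolution_pair M N P Q) {p \<in> space (convolution_pair M N P Q). count_pair A B p \<in> S} =
    measure (P \<Otimes>\<^sub>M Q) {\<omega> \<in> space P \<times> space Q. count_pair A B (fst \<omega>) + count_pair A B (snd \<omega>) \<in> S}"
proof -
  have "measure (convolution_pair M N P Q) {p \<in> space (convolution_pair M N P Q). count_pair A B p \<in> S} =
    measure (P \<Otimes>\<^sub>M Q) {\<omega> \<in> space (P \<Otimes>\<^sub>M Q). count_pair A B (add_pair \<omega>) \<in> S}"
    unfolding convolution_pair_eq using add_pair_measurable_laws AB S by (rule measure_distr_count_pair)
  also have "{\<omega> \<in> space (P \<Otimes>\<^sub>M Q). count_pair A B (add_pair \<omega>) \<in> S} =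
      {\<omega> \<in> space P \<times> space Q. count_pair A B (fst \<omega>) + count_pair A B (snd \<omega>) \<in> S}"
  proof (rule Collect_cong)
    fix \<omega>
    have "count_pair A B (add_pair \<omega>) = count_pair A B (fst \<omega>) + count_pair A B (snd \<omega>)"
      if "\<omega> \<in> space (P \<Otimes>\<^sub>M Q)"
      using count_pair_add_pair[of "fst \<omega>" M N "snd \<omega>" A B] that
      by (auto simp: space_pair_measure space_laws)
    then show "\<omega> \<in> space (P \<Otimes>\<^sub>M Q) \<and> count_pair A B (add_pair \<omega>) \<in> S \<longleftrightarrow>
        \<omega> \<in> space P \<times> space Q \<and> count_pair A B (fst \<omega>) + count_pair A B (snd \<omega>) \<in> S"
      by (auto simp: space_pair_measure)
  qed
  finally show ?thesis .
qed

lemma law_event: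
  assumes AB: "A \<in> sets M" "B \<in> sets N" and S: "S \<in> sets borel"
  shows "{p \<in> space P. count_pair A B p \<in> S} \<in> sets P" "{p \<in> space Q. count_pair A B p \<in> S} \<in> sets Q"
  unfolding P Q space_laws using count_pair_event[OF AB S] by auto

lemma measure_times:
  assumes "E \<in> sets P" "F \<in> sets Q"
  shows "measure (P \<Otimes>\<^sub>M Q) (E \<times> F) = measure P E * measure Q F"
  using assms unfolding measure_def
  by (subst Q.emeasure_pair_measure_Times) (simp_all add: enn2real_mult)

lemma vacancy_convolution_pair:
  assumes AB: "A \<in> sets M" "B \<in> sets N"
  shows "vacancy (convolution_pair M N P Q) A B = vacancy P A B * vacancy Q A B"
proof -
  have "vacancy (convolution_pair M N P Q) A B =
      measure (P \<Otimes>\<^sub>M Q) {\<omega> \<in> space P \<times> space Q. count_pair A B (fst \<omega>) + count_pair A B (snd \<omega>) \<in> {0}}"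
    unfolding vacancy_def using measure_convolution_pair[OF AB, of "{0}"] by simp
  also have "{\<omega> \<in> space P \<times> space Q. count_pair A B (fst \<omega>) + count_pair A B (snd \<omega>) \<in> {0}} =
      {p \<in> space P. count_pair A B p \<in> {0}} \<times> {p \<in> space Q. count_pair A B p \<in> {0}}"
    by auto
  also have "measure (P \<Otimes>\<^sub>M Q) \<dots> = vacancy P A B * vacancy Q A B"
    using law_event[OF AB, of "{0}"] by (subst measure_times) (auto simp: vacancy_def)
  finally show ?thesis .
qed

text \<open>
  A sum of two masses that is neither 0 nor 1 needs a summand that is neither 0 nor 1 or two nonzero
  summands.
\<close>

lemma multiplicity_prob_convolution_pair:
  assumes AB: "A \<in> sets M" "B \<in> sets N"
  shows "multiplicity_prob (convolution_pair M N P Q) A B \<le>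
    multiplicity_prob P A B + multiplicity_prob Q A B + (1 - vacancy P A B) * (1 - vacancy Q A B)"
proof -
  define E1 where "E1 = {p \<in> space P. count_pair A B p \<in> - {0, 1}}"
  define F1 where "F1 = {p \<in> space Q. count_pair A B p \<in> - {0, 1}}"
  define E2 where "E2 = {p \<in> space P. count_pair A B p \<in> - {0}}"
  define F2 where "F2 = {p \<in> space Q. count_pair A B p \<in> - {0}}"
  have s [measurable]: "E1 \<in> sets P" "F1 \<in> sets Q" "E2 \<in> sets P" "F2 \<in> sets Q"
    unfolding E1_def F1_def E2_def F2_def by (intro law_event[OF AB]; simp)+
  have v: "measure P E2 = 1 - vacancy P A B" "measure Q F2 = 1 - vacancy Q A B"
  proof -
    have "E2 = space P - {p \<in> space P. count_pair A B p \<in> {0}}" by (auto simp: E2_def)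
    then show "measure P E2 = 1 - vacancy P A B"
      using P.prob_compl[OF law_event(1)[OF AB, of "{0}"]] by (simp add: vacancy_def)
    have "F2 = space Q - {p \<in> space Q. count_pair A B p \<in> {0}}" by (auto simp: F2_def)
    then show "measure Q F2 = 1 - vacancy Q A B"
      using Q.prob_compl[OF law_event(2)[OF AB, of "{0}"]] by (simp add: vacancy_def)
  qed
  have "multiplicity_prob (convolution_pair M N P Q) A B = measure (P \<Otimes>\<^sub>M Q)
      {\<omega> \<in> space P \<times> space Q. count_pair A B (fst \<omega>) + count_pair A B (snd \<omega>) \<in> - {0, 1}}"
    unfolding multiplicity_prob_def using measure_convolution_pair[OF AB, of "- {0, 1}"] by simp
  also have "\<dots> \<le> measure (P \<Otimes>\<^sub>M Q) ((E1 \<times> space Q \<union> space P \<times> F1) \<union> E2 \<times> F2)"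
  proof (rule PQ.finite_measure_mono)
    show "{\<omega> \<in> space P \<times> space Q. count_pair A B (fst \<omega>) + count_pair A B (snd \<omega>) \<in> - {0, 1}}
        \<subseteq> (E1 \<times> space Q \<union> space P \<times> F1) \<union> E2 \<times> F2"
    proof
      fix \<omega> assume \<omega>: "\<omega> \<in> {\<omega> \<in> space P \<times> space Q. count_pair A B (fst \<omega>) + count_pair A B (snd \<omega>) \<in> - {0, 1}}"
      then have "count_pair A B (fst \<omega>) \<notin> {0, 1} \<or> count_pair A B (snd \<omega>) \<notin> {0, 1} \<or>
          (count_pair A B (fst \<omega>) \<noteq> 0 \<and> count_pair A B (snd \<omega>) \<noteq> 0)"
        by (intro ennreal_sum_01) simp
      then show "\<omega> \<in> (E1 \<times> space Q \<union> space P \<times> F1) \<union> E2 \<times> F2"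
        using \<omega> unfolding E1_def F1_def E2_def F2_def by (cases \<omega>) auto
    qed
  qed measurable
  also have "\<dots> \<le> measure (P \<Otimes>\<^sub>M Q) (E1 \<times> space Q \<union> space P \<times> F1) + measure (P \<Otimes>\<^sub>M Q) (E2 \<times> F2)"
    by (rule measure_Un_le) measurable
  also have "\<dots> \<le> (measure (P \<Otimes>\<^sub>M Q) (E1 \<times> space Q) + measure (P \<Otimes>\<^sub>M Q) (space P \<times> F1)) + measure (P \<Otimes>\<^sub>M Q) (E2 \<times> F2)"
    by (intro add_mono measure_Un_le) measurable
  also have "\<dots> = measure P E1 + measure Q F1 + (1 - vacancy P A B) * (1 - vacancy Q A B)"
    using v by (simp add: measure_times P.prob_space Q.prob_space)
  finally show ?thesis by (simp add: multiplicity_prob_def E1_def F1_def)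
qed

end

lemma convolution_power_law:
  assumes Q: "prob_space Q" "sets Q = sets (pair_measures_space M N)"
  shows "prob_space (convolution_power M N Q n) \<and>
    sets (convolution_power M N Q n) = sets (pair_measures_space M N) \<and>
    (\<forall>A\<in>sets M. \<forall>B\<in>sets N. vacancy (convolution_power M N Q n) A B = vacancy Q A B ^ n)"
proof (induction n)
  case 0
  have "vacancy (return (pair_measures_space M N) (null_measure M, null_measure N)) A B = 1"
    if "A \<in> sets M" "B \<in> sets N" for A B
  proof -
    have "measure (return (pair_measures_space M N) (null_measure M, null_measure N))
        {p \<in> measures_on M \<times> measures_on N. count_pair A B p \<in> {0}} =
      indicator {p \<in> measures_on M \<times> measures_on N. count_pair A B p \<in> {0}} (null_measure M, null_measure N)"
      using that by (intro measure_return count_pair_event) auto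
    also have "\<dots> = 1" by (simp add: count_pair_def)
    finally show ?thesis by (simp add: vacancy_def space_pair_measures_space)
  qed
  then show ?case
    by (auto intro!: prob_space_return simp: space_pair_measures_space)
next
  case (Suc n)
  then show ?case
    using Q prob_space_convolution_pair[OF Q] sets_convolution_pair[OF Q] vacancy_convolution_pair[OF Q]
    by simp
qed

lemma vacancy_nonneg: "0 \<le> vacancy P A B"
  by (simp add: vacancy_def)

text \<open>
  Only the pairs \<open>(A, {})\<close> and \<open>({}, B)\<close> occur as pieces, since the two coordinates are dissected
  separately; so bounds for the multiple points of the marginals are enough.
\<close>

theorem pair_law_eq_if_vacancy_eq:
  assumes M: "sigma_finite_measure M" "diffuse M" and N: "sigma_finite_measure N" "diffuse N"
    and P: "prob_space P" "sets P = sets (pair_measures_space M N)"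
    and Q: "prob_space Q" "sets Q = sets (pair_measures_space M N)"
    and vac: "\<And>A B. A \<in> sets M \<Longrightarrow> emeasure M A < \<infinity> \<Longrightarrow> B \<in> sets N \<Longrightarrow> emeasure N B < \<infinity> \<Longrightarrow>
      vacancy P A B = vacancy Q A B"
    and mult: "\<And>A R. R \<in> {P, Q} \<Longrightarrow> A \<in> sets M \<Longrightarrow> emeasure M A < \<infinity> \<Longrightarrow>
        multiplicity_prob R A {} \<le> (measure M A)\<^sup>2"
      "\<And>B R. R \<in> {P, Q} \<Longrightarrow> B \<in> sets N \<Longrightarrow> emeasure N B < \<infinity> \<Longrightarrow>
        multiplicity_prob R {} B \<le> (measure N B)\<^sup>2"
  shows "P = Q"
proof -
  define I where "I = {(A, B). A \<in> sets M \<and> emeasure M A < \<infinity> \<and> B \<in> sets N \<and> emeasure N B < \<infinity>}"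
  define cp where "cp = (\<lambda>c :: 'a set \<times> 'b set. count_pair (fst c) (snd c))"
  have sp: "space P = measures_on M \<times> measures_on N" "space Q = space P"
    using sets_eq_imp_space_eq[OF P(2)] sets_eq_imp_space_eq[OF Q(2)]
    by (auto simp: space_pair_measures_space)
  show ?thesis
  proof (rule prob_eq_if_avoidance_eq[where I = I and N = cp])
    show "prob_space P" "prob_space Q" by fact+
    show "sets Q = sets P" using P Q by simp
    show "cp c \<in> borel_measurable P" if "c \<in> I" for c
      using that by (subst measurable_cong_sets[OF P(2) refl]) (auto simp: I_def cp_def)
    show "measure P {\<omega> \<in> space P. cp c \<omega> = 0} = measure Q {\<omega> \<in> space P. cp c \<omega> = 0}" if "c \<in> I" for c
      using that vac[of "fst c" "snd c"] by (auto simp: I_def cp_def vacancy_def sp(2))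
  next
    fix K :: "('a measure \<times> 'b measure) measure"
    assume K: "space K = space P" and meas: "\<And>c. c \<in> I \<Longrightarrow> cp c \<in> borel_measurable K"
    have fst_K: "fst \<in> K \<rightarrow>\<^sub>M measures_space M"
    proof (rule measurable_measures_space_sigma_finiteI[OF M(1)])
      fix A assume "A \<in> sets M" "emeasure M A < \<infinity>"
      then have "cp (A, {}) \<in> borel_measurable K" by (intro meas) (auto simp: I_def)
      then show "(\<lambda>p. emeasure (fst p) A) \<in> borel_measurable K" by (simp add: cp_def count_pair_def[abs_def])
    qed (auto simp: K sp measures_on_def)
    have snd_K: "snd \<in> K \<rightarrow>\<^sub>M measures_space N"
    proof (rule measurable_measures_space_sigma_finiteI[OF N(1)])
      fix B assume "B \<in> sets N" "emeasure N B < \<infinity>"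
      then have "cp ({}, B) \<in> borel_measurable K" by (intro meas) (auto simp: I_def)
      then show "(\<lambda>p. emeasure (snd p) B) \<in> borel_measurable K" by (simp add: cp_def count_pair_def[abs_def])
    qed (auto simp: K sp measures_on_def)
    have "(\<lambda>p. (fst p, snd p)) \<in> K \<rightarrow>\<^sub>M pair_measures_space M N"
      using fst_K snd_K by (rule measurable_Pair)
    then have id: "(\<lambda>p. p) \<in> K \<rightarrow>\<^sub>M pair_measures_space M N" by simp
    show "sets P \<subseteq> sets K"
    proof
      fix E assume E: "E \<in> sets P"
      then have "(\<lambda>p. p) -` E \<inter> space K \<in> sets K" using id P(2) by (intro measurable_sets) auto
      moreover have "(\<lambda>p. p) -` E \<inter> space K = E" using sets.sets_into_space[OF E] K by auto
      ultimately show "E \<in> sets K" by simp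
    qed
  next
    fix c c' assume c: "c \<in> I" "c' \<in> I"
    obtain A B A' B' where AB: "c = (A, B)" "c' = (A', B')" by (metis surj_pair)
    have "emeasure M (A \<union> A') \<le> emeasure M A + emeasure M A'" "emeasure N (B \<union> B') \<le> emeasure N B + emeasure N B'"
      using c by (auto simp: AB I_def intro!: emeasure_subadditive)
    then have "(A \<union> A', B \<union> B') \<in> I" using c by (auto simp: AB I_def intro: le_less_trans)
    moreover have "cp (A \<union> A', B \<union> B') \<omega> = 0 \<longleftrightarrow> cp c \<omega> = 0 \<and> cp c' \<omega> = 0" if "\<omega> \<in> space P" for \<omega>
    proof -
      have "sets (fst \<omega>) = sets M" "sets (snd \<omega>) = sets N" using that by (auto simp: sp measures_on_def)
      then have "emeasure (fst \<omega>) (A \<union> A') = 0 \<longleftrightarrow> emeasure (fst \<omega>) A = 0 \<and> emeasure (fst \<omega>) A' = 0"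
        "emeasure (snd \<omega>) (B \<union> B') = 0 \<longleftrightarrow> emeasure (snd \<omega>) B = 0 \<and> emeasure (snd \<omega>) B' = 0"
        using c by (auto simp: AB I_def emeasure_Un_eq_0_iff)
      then show ?thesis by (auto simp: AB cp_def count_pair_def)
    qed
    ultimately show "\<exists>d\<in>I. \<forall>\<omega>\<in>space P. cp d \<omega> = 0 \<longleftrightarrow> cp c \<omega> = 0 \<and> cp c' \<omega> = 0"
      by (intro bexI[of _ "(A \<union> A', B \<union> B')"]) auto
  next
    fix c and \<epsilon> :: real assume c: "c \<in> I" and \<epsilon>: "0 < \<epsilon>"
    obtain A B where AB: "c = (A, B)" by (metis surj_pair)
    have A: "A \<in> sets M" "emeasure M A < \<infinity>" and B: "B \<in> sets N" "emeasure N B < \<infinity>"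
      using c by (auto simp: AB I_def)
    have \<epsilon>2: "0 < \<epsilon> / 2" using \<epsilon> by simp
    obtain k :: nat and D where D: "disjoint_family_on D {..<k}"
      "\<And>j. j < k \<Longrightarrow> D j \<in> sets M" "\<And>j. j < k \<Longrightarrow> emeasure M (D j) < \<infinity>" "A = (\<Union>j<k. D j)"
      "(\<Sum>j<k. (measure M (D j))\<^sup>2) \<le> \<epsilon> / 2"
      using diffuse_dissection_squares[OF M(2) A \<epsilon>2] by metis
    obtain l :: nat and F where F: "disjoint_family_on F {..<l}"
      "\<And>j. j < l \<Longrightarrow> F j \<in> sets N" "\<And>j. j < l \<Longrightarrow> emeasure N (F j) < \<infinity>" "B = (\<Union>j<l. F j)"
      "(\<Sum>j<l. (measure N (F j))\<^sup>2) \<le> \<epsilon> / 2"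
      using diffuse_dissection_squares[OF N(2) B \<epsilon>2] by metis
    define d where "d = (\<lambda>j. if j < k then (D j, {}) else ({}, F (j - k)))"
    have split: "(\<Sum>j<k + l. g (d j)) = (\<Sum>j<k. g (D j, {})) + (\<Sum>j<l. g ({}, F j))"
      for g :: "_ \<Rightarrow> 'x :: comm_monoid_add"
    proof -
      have "(\<Sum>j<k + n. g (d j)) = (\<Sum>j<k. g (D j, {})) + (\<Sum>j<n. g ({}, F j))" for n
        by (induction n) (simp_all add: d_def add.assoc)
      then show ?thesis .
    qed
    have dI: "d j \<in> I" if "j < k + l" for j using that D(2,3) F(2,3) by (auto simp: d_def I_def)
    have small: "(\<Sum>j<k + l. measure R {\<omega> \<in> space P. cp (d j) \<omega> \<notin> {0, 1}}) \<le> \<epsilon>" if R: "R \<in> {P, Q}" for R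
    proof -
      have spR: "space R = space P" using R sp by auto
      have "(\<Sum>j<k + l. measure R {\<omega> \<in> space P. cp (d j) \<omega> \<notin> {0, 1}}) =
          (\<Sum>j<k. multiplicity_prob R (D j) {}) + (\<Sum>j<l. multiplicity_prob R {} (F j))"
        using split[of "\<lambda>c. measure R {\<omega> \<in> space P. cp c \<omega> \<notin> {0, 1}}"]
        by (simp add: cp_def multiplicity_prob_def spR)
      also have "\<dots> \<le> (\<Sum>j<k. (measure M (D j))\<^sup>2) + (\<Sum>j<l. (measure N (F j))\<^sup>2)"
        using D(2,3) F(2,3) by (intro add_mono sum_mono mult R) auto
      also have "\<dots> \<le> \<epsilon>" using D(5) F(5) by simp
      finally show ?thesis .
    qed
    have total: "cp c \<omega> = (\<Sum>j<k + l. cp (d j) \<omega>)" if \<omega>: "\<omega> \<in> space P" for \<omega>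
    proof -
      have s: "sets (fst \<omega>) = sets M" "sets (snd \<omega>) = sets N" using \<omega> by (auto simp: sp measures_on_def)
      have "emeasure (fst \<omega>) A = (\<Sum>j<k. emeasure (fst \<omega>) (D j))"
        unfolding D(4) using D(1,2) s by (intro sum_emeasure[symmetric]) auto
      moreover have "emeasure (snd \<omega>) B = (\<Sum>j<l. emeasure (snd \<omega>) (F j))"
        unfolding F(4) using F(1,2) s by (intro sum_emeasure[symmetric]) auto
      ultimately show ?thesis
        using split[of "\<lambda>c. cp c \<omega>"] by (simp add: cp_def count_pair_def AB)
    qed
    show "\<exists>(k::nat) d. (\<forall>j<k. d j \<in> I) \<and> (\<forall>\<omega>\<in>space P. cp c \<omega> = (\<Sum>j<k. cp (d j) \<omega>)) \<and>
        (\<Sum>j<k. measure P {\<omega> \<in> space P. cp (d j) \<omega> \<notin> {0, 1}}) \<le> \<epsilon> \<and>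
        (\<Sum>j<k. measure Q {\<omega> \<in> space P. cp (d j) \<omega> \<notin> {0, 1}}) \<le> \<epsilon>"
      using dI small total by (intro exI[of _ "k + l"] exI[of _ d]) blast
  qed
qed

section \<open>The bimeasure of an infinitely divisible pair\<close>

lemma (in prob_space) prob_neither:
  assumes "E \<in> events" "F \<in> events"
  shows "prob (space M - (E \<union> F)) = 1 - prob E - prob F + prob (E \<inter> F)"
proof -
  have "prob (space M - (E \<union> F)) = 1 - prob (E \<union> F)" using assms by (intro prob_compl) auto
  also have "prob (E \<union> F) = prob E + prob (F - E)" using assms by (rule finite_measure_Union')
  also have "prob (F - E) = prob F - prob (F \<inter> E)" using assms by (intro finite_measure_Diff') auto
  finally show ?thesis by (simp add: Int_commute)
qed

lemma (in prob_space) bonferroni: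
  fixes m :: nat
  assumes "\<And>i. i < m \<Longrightarrow> H i \<in> events"
  shows "(\<Sum>i<m. prob (H i)) \<le> prob (\<Union>i<m. H i) + (\<Sum>i<m. \<Sum>j<i. prob (H i \<inter> H j))"
  using assms
proof (induction m)
  case (Suc m)
  have H: "H i \<in> events" if "i \<le> m" for i using Suc.prems that by auto
  define U where "U = (\<Union>i<m. H i)"
  have U: "U \<in> events" using H by (auto simp: U_def)
  have "prob (H m \<inter> U) = prob (\<Union>j\<in>{..<m}. H m \<inter> H j)" by (auto simp: U_def intro!: arg_cong[where f = prob])
  also have "\<dots> \<le> (\<Sum>j<m. prob (H m \<inter> H j))"
    using H by (intro finite_measure_subadditive_finite) auto
  finally have 1: "prob (H m \<inter> U) \<le> (\<Sum>j<m. prob (H m \<inter> H j))" .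
  have "prob (U \<union> H m) = prob U + prob (H m - U)" using U H by (intro finite_measure_Union') auto
  also have "prob (H m - U) = prob (H m) - prob (H m \<inter> U)" using U H by (intro finite_measure_Diff') auto
  finally have 2: "prob (U \<union> H m) = prob U + prob (H m) - prob (H m \<inter> U)" by simp
  have 3: "(\<Union>i<Suc m. H i) = U \<union> H m" by (auto simp: U_def less_Suc_eq)
  have "(\<Sum>i<m. prob (H i)) \<le> prob U + (\<Sum>i<m. \<Sum>j<i. prob (H i \<inter> H j))"
    unfolding U_def using Suc by auto
  then show ?case unfolding 3 using 1 2 by simp
qed simp

text \<open>
  After removal of the null ones among the \<open>E i\<close>, either nothing is left of \<open>E0\<close>, or a point \<open>x\<close> is left.
  In the latter case the sections at \<open>x\<close> of the rectangles cover \<open>F0\<close>, and they are null because the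
  corresponding \<open>E i\<close> are not.
\<close>

lemma rectangle_null_cover:
  fixes E :: "nat \<Rightarrow> 'a set" and F :: "nat \<Rightarrow> 'b set"
  assumes \<xi>: "\<And>i. E i \<in> sets \<xi>" "E0 \<in> sets \<xi>" and \<eta>: "\<And>i. F i \<in> sets \<eta>" "F0 \<in> sets \<eta>"
    and cover: "E0 \<times> F0 \<subseteq> (\<Union>i. E i \<times> F i)"
    and null: "\<And>i. emeasure \<xi> (E i) = 0 \<or> emeasure \<eta> (F i) = 0"
  shows "emeasure \<xi> E0 = 0 \<or> emeasure \<eta> F0 = 0"
proof -
  define I where "I = {i. emeasure \<xi> (E i) = 0}"
  have nullI: "(\<Union>i\<in>I. E i) \<in> null_sets \<xi>"
    using \<xi> by (intro null_sets_UN') (auto simp: I_def)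
  show ?thesis
  proof (cases "E0 \<subseteq> (\<Union>i\<in>I. E i)")
    case True
    then have "emeasure \<xi> E0 = 0" using nullI \<xi>(2) null_sets_subset by blast
    then show ?thesis ..
  next
    case False
    then obtain x where x: "x \<in> E0" "x \<notin> (\<Union>i\<in>I. E i)" by blast
    have "(\<Union>i\<in>{i. x \<in> E i}. F i) \<in> null_sets \<eta>"
    proof (rule null_sets_UN')
      fix i assume "i \<in> {i. x \<in> E i}"
      then have "i \<notin> I" using x by blast
      then show "F i \<in> null_sets \<eta>" using null[of i] \<eta> by (auto simp: I_def)
    qed simp
    moreover have "F0 \<subseteq> (\<Union>i\<in>{i. x \<in> E i}. F i)" using cover x by blast
    ultimately have "emeasure \<eta> F0 = 0" using \<eta>(2) null_sets_subset by blast
    then show ?thesis ..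
  qed
qed

lemma one_minus_exp_le: "1 - exp (- (x::real)) \<le> x"
  using exp_ge_add_one_self[of "- x"] by simp

lemma nth_root_exp:
  fixes x y :: real
  assumes "0 \<le> x" "x ^ n = exp (- y)" "1 \<le> n"
  shows "x = exp (- y / real n)"
proof (rule power_eq_imp_eq_base[of x n])
  have "exp (- y / real n) ^ n = exp (real n * (- y / real n))" by (rule exp_of_nat_mult[symmetric])
  then show "x ^ n = exp (- y / real n) ^ n" using assms by simp
qed (use assms in auto)

locale divisible_pair =
  M: sigma_finite_measure M + N: sigma_finite_measure N + P: prob_space P
  for M :: "'a measure" and N :: "'b measure" and P :: "('a measure \<times> 'b measure) measure" +
  assumes sets_P: "sets P = sets (pair_measures_space M N)"
    and vacancy_fst: "\<And>A. A \<in> sets M \<Longrightarrow> emeasure M A < \<infinity> \<Longrightarrow> vacancy P A {} = exp (- measure M A)"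
    and vacancy_snd: "\<And>B. B \<in> sets N \<Longrightarrow> emeasure N B < \<infinity> \<Longrightarrow> vacancy P {} B = exp (- measure N B)"
    and divisible: "infinitely_divisible M N P"
begin

definition conv_root :: "nat \<Rightarrow> ('a measure \<times> 'b measure) measure" where
  "conv_root n = (SOME Q. prob_space Q \<and> sets Q = sets (pair_measures_space M N) \<and> P = convolution_power M N Q n)"

lemma conv_root:
  assumes "1 \<le> n"
  shows "prob_space (conv_root n)" "sets (conv_root n) = sets (pair_measures_space M N)"
    "A \<in> sets M \<Longrightarrow> B \<in> sets N \<Longrightarrow> vacancy (conv_root n) A B ^ n = vacancy P A B"
proof -
  have ex: "\<exists>Q. prob_space Q \<and> sets Q = sets (pair_measures_space M N) \<and> P = convolution_power M N Q n"
    using divisible assms unfolding infinitely_divisible_def by simp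
  have *: "prob_space (conv_root n) \<and> sets (conv_root n) = sets (pair_measures_space M N) \<and>
      P = convolution_power M N (conv_root n) n"
    unfolding conv_root_def by (rule someI_ex[OF ex])
  then show "prob_space (conv_root n)" "sets (conv_root n) = sets (pair_measures_space M N)" by blast+
  assume AB: "A \<in> sets M" "B \<in> sets N"
  have "vacancy (convolution_power M N (conv_root n) n) A B = vacancy (conv_root n) A B ^ n"
    using * AB by (intro convolution_power_law[THEN conjunct2, THEN conjunct2, rule_format]) auto
  then show "vacancy (conv_root n) A B ^ n = vacancy P A B" using * by simp
qed

definition finM :: "'a set set" where "finM = {A \<in> sets M. emeasure M A < \<infinity>}"
definition finN :: "'b set set" where "finN = {B \<in> sets N. emeasure N B < \<infinity>}"

lemma empty_fin [simp]: "{} \<in> finM" "{} \<in> finN" by (auto simp: finM_def finN_def)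

definition vacant :: "nat \<Rightarrow> 'a set \<Rightarrow> 'b set \<Rightarrow> ('a measure \<times> 'b measure) set" where
  "vacant n A B = {p \<in> space (conv_root n). count_pair A B p = 0}"

lemma space_root: "1 \<le> n \<Longrightarrow> space (conv_root n) = measures_on M \<times> measures_on N"
  using sets_eq_imp_space_eq[OF conv_root(2)] by (simp add: space_pair_measures_space)

lemma vacant_sets:
  assumes "1 \<le> n" "A \<in> finM" "B \<in> finN"
  shows "vacant n A B \<in> sets (conv_root n)"
  using count_pair_event[of A M B N "{0}"] assms
  by (simp add: vacant_def conv_root(2) space_root finM_def finN_def)

lemma measure_vacant: "measure (conv_root n) (vacant n A B) = vacancy (conv_root n) A B"
  by (simp add: vacant_def vacancy_def)

text \<open>
  The pairs of measures that charge both \<open>A\<close> and \<open>B\<close>, written as a complement so that inclusion and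
  exclusion applies.
\<close>

definition hit :: "nat \<Rightarrow> 'a set \<Rightarrow> 'b set \<Rightarrow> ('a measure \<times> 'b measure) set" where
  "hit n A B = space (conv_root n) - (vacant n A {} \<union> vacant n {} B)"

lemma hit_sets:
  assumes "1 \<le> n" "A \<in> finM" "B \<in> finN"
  shows "hit n A B \<in> sets (conv_root n)"
  unfolding hit_def using assms by (intro sets.Diff sets.Un sets.top vacant_sets) auto

lemma mem_hit: "p \<in> hit n A B \<longleftrightarrow> p \<in> space (conv_root n) \<and> emeasure (fst p) A \<noteq> 0 \<and> emeasure (snd p) B \<noteq> 0"
  by (auto simp: hit_def vacant_def count_pair_def)

lemma vacancy_root_fst:
  assumes "1 \<le> n" "A \<in> finM"
  shows "vacancy (conv_root n) A {} = exp (- measure M A / real n)"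
  using assms conv_root(3)[OF assms(1), of A "{}"] vacancy_fst[of A]
  by (intro nth_root_exp) (auto simp: finM_def vacancy_nonneg)

lemma vacancy_root_snd:
  assumes "1 \<le> n" "B \<in> finN"
  shows "vacancy (conv_root n) {} B = exp (- measure N B / real n)"
  using assms conv_root(3)[OF assms(1), of "{}" B] vacancy_snd[of B]
  by (intro nth_root_exp) (auto simp: finN_def vacancy_nonneg)

lemma measure_hit_vacancy:
  assumes n: "1 \<le> n" and AB: "A \<in> finM" "B \<in> finN"
  shows "measure (conv_root n) (hit n A B) = 1 - exp (- measure M A / real n) - exp (- measure N B / real n) +
    vacancy (conv_root n) A B"
proof -
  interpret R: prob_space "conv_root n" by (rule conv_root(1)[OF n])
  have "vacant n A {} \<inter> vacant n {} B = vacant n A B"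
    by (auto simp: vacant_def count_pair_def)
  then show ?thesis
    unfolding hit_def using R.prob_neither[of "vacant n A {}" "vacant n {} B"] n AB
    by (simp add: vacant_sets measure_vacant vacancy_root_fst vacancy_root_snd)
qed

text \<open>
  A convolution root of high order avoids \<open>A\<close> and \<open>B\<close> with probability close to one, and the avoidance
  probability of \<open>P\<close> is a power of that of the root.
\<close>

lemma vacancy_pos:
  assumes AB: "A \<in> finM" "B \<in> finN"
  shows "0 < vacancy P A B"
proof -
  have "(\<lambda>n. exp (- measure M A / real n) + exp (- measure N B / real n)) \<longlonglongrightarrow> 2"
    by real_asymp
  then have "eventually (\<lambda>n. 1 < exp (- measure M A / real n) + exp (- measure N B / real n)) sequentially"
    by (rule order_tendstoD) simp
  then have "eventually (\<lambda>n. 1 \<le> n \<and> 1 < exp (- measure M A / real n) + exp (- measure N B / real n)) sequentially"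
    using eventually_ge_at_top[of 1] by eventually_elim auto
  then obtain n where n: "1 \<le> n" "1 < exp (- measure M A / real n) + exp (- measure N B / real n)"
    by (auto dest: eventually_happens)
  have "0 \<le> measure (conv_root n) (hit n A B)" by simp
  then have "0 < vacancy (conv_root n) A B" using n(2) unfolding measure_hit_vacancy[OF n(1) AB] by linarith
  then have "0 < vacancy (conv_root n) A B ^ n" by (rule zero_less_power)
  then show ?thesis using conv_root(3)[OF n(1), of A B] AB by (simp add: finM_def finN_def)
qed

text \<open>
  The mass that the joining has to give to \<open>A \<times> B\<close>: minus the logarithm of the vacancy is the mass that the
  Levy measure gives to the pairs charging \<open>A\<close> or \<open>B\<close>, and \<open>\<mu> A + \<nu> B\<close> counts those charging both twice.
\<close>

definition bimeasure :: "'a set \<Rightarrow> 'b set \<Rightarrow> real" where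
  "bimeasure A B = measure M A + measure N B + ln (vacancy P A B)"

lemma vacancy_bimeasure:
  assumes "A \<in> finM" "B \<in> finN"
  shows "vacancy P A B = exp (- (measure M A + measure N B - bimeasure A B))"
  using vacancy_pos[OF assms] by (simp add: bimeasure_def)

lemma measure_hit:
  assumes n: "1 \<le> n" and AB: "A \<in> finM" "B \<in> finN"
  shows "measure (conv_root n) (hit n A B) = 1 - exp (- measure M A / real n) - exp (- measure N B / real n) +
    exp (- (measure M A + measure N B - bimeasure A B) / real n)"
proof -
  have "vacancy (conv_root n) A B = exp (- (measure M A + measure N B - bimeasure A B) / real n)"
    using conv_root(3)[OF n, of A B] AB vacancy_bimeasure[OF AB] n
    by (intro nth_root_exp) (auto simp: finM_def finN_def vacancy_nonneg)
  then show ?thesis using measure_hit_vacancy[OF n AB] by simp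
qed

lemma hit_limit:
  assumes AB: "A \<in> finM" "B \<in> finN"
  shows "(\<lambda>n. real n * measure (conv_root n) (hit n A B)) \<longlonglongrightarrow> bimeasure A B"
proof (rule Lim_transform_eventually)
  define a b g where "a = measure M A" and "b = measure N B" and "g = bimeasure A B"
  show "(\<lambda>n. real n * (1 - exp (- a / real n) - exp (- b / real n) + exp (- (a + b - g) / real n)))
      \<longlonglongrightarrow> bimeasure A B"
    unfolding g_def[symmetric] by real_asymp
  show "\<forall>\<^sub>F n in sequentially. real n * (1 - exp (- a / real n) - exp (- b / real n) + exp (- (a + b - g) / real n)) =
      real n * measure (conv_root n) (hit n A B)"
    using eventually_ge_at_top[of 1] by eventually_elim (simp add: measure_hit AB a_def b_def g_def)
qed

lemma bimeasure_nonneg: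
  assumes AB: "A \<in> finM" "B \<in> finN"
  shows "0 \<le> bimeasure A B"
  by (rule LIMSEQ_le_const[OF hit_limit[OF AB]]) auto

text \<open>
  With \<open>a\<close>, \<open>b\<close> and \<open>g\<close> the three masses divided by \<open>n\<close> and \<open>X \<le> 1\<close> the vacancy of the root, the hitting
  probability is \<open>(1 - exp (- a)) * (1 - exp (- b)) + X * (1 - exp (- g))\<close>. The first summand is what
  independent coordinates would give; it is of second order and, being bounded by a product, it can be
  summed over disjoint rectangles.
\<close>

lemma hit_bound:
  assumes n: "1 \<le> n" and AB: "A \<in> finM" "B \<in> finN"
  shows "real n * measure (conv_root n) (hit n A B) \<le> measure M A * measure N B / real n + bimeasure A B"
proof -
  define a b g where "a = measure M A / real n" and "b = measure N B / real n" and "g = bimeasure A B / real n"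
  have ab: "0 \<le> a" "0 \<le> b" by (auto simp: a_def b_def)
  interpret R: prob_space "conv_root n" by (rule conv_root(1)[OF n])
  have g: "0 \<le> g" using bimeasure_nonneg[OF AB] by (simp add: g_def)
  define X where "X = vacancy (conv_root n) A B"
  have X: "0 \<le> X" "X \<le> 1" by (auto simp: X_def vacancy_def)
  have q: "measure (conv_root n) (hit n A B) = 1 - exp (- a) - exp (- b) + X"
    using measure_hit_vacancy[OF n AB] by (simp add: a_def b_def X_def)
  have "measure (conv_root n) (hit n A B) = 1 - exp (- a) - exp (- b) + exp (- (a + b - g))"
    using measure_hit[OF n AB] by (simp add: a_def b_def g_def diff_divide_distrib add_divide_distrib)
  with q have Xe: "X = exp (- a) * exp (- b) * exp g" by (simp add: exp_add[symmetric] algebra_simps)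
  have "exp (- a) * exp (- b) = X * exp (- g)" by (simp add: Xe exp_minus field_simps)
  then have "measure (conv_root n) (hit n A B) = (1 - exp (- a)) * (1 - exp (- b)) + X * (1 - exp (- g))"
    unfolding q by (simp add: algebra_simps)
  also have "\<dots> \<le> a * b + 1 * g"
    using ab g X one_minus_exp_le by (intro add_mono mult_mono) auto
  finally have "real n * measure (conv_root n) (hit n A B) \<le> real n * (a * b + g)"
    by (intro mult_left_mono) auto
  also have "\<dots> = measure M A * measure N B / real n + bimeasure A B"
    using n by (simp add: a_def b_def g_def field_simps)
  finally show ?thesis .
qed

lemma bimeasure_le:
  assumes AB: "A \<in> finM" "B \<in> finN"
  shows "bimeasure A B \<le> measure M A" "bimeasure A B \<le> measure N B"
proof -
  have ev: "{p \<in> space P. count_pair A B p = 0} \<in> sets P" if "A \<in> finM" "B \<in> finN" for A B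
    using count_pair_event[of A M B N "{0}"] that sets_eq_imp_space_eq[OF sets_P]
    by (simp add: sets_P space_pair_measures_space finM_def finN_def)
  have "vacancy P A B \<le> vacancy P A {}" "vacancy P A B \<le> vacancy P {} B"
    unfolding vacancy_def using AB
    by (intro P.finite_measure_mono ev; force simp: count_pair_def)+
  moreover have "vacancy P A {} = exp (- measure M A)" "vacancy P {} B = exp (- measure N B)"
    using AB vacancy_fst vacancy_snd by (auto simp: finM_def finN_def)
  ultimately show "bimeasure A B \<le> measure M A" "bimeasure A B \<le> measure N B"
    unfolding vacancy_bimeasure[OF AB] by auto
qed

lemma Un_finM: "A \<in> finM \<Longrightarrow> A' \<in> finM \<Longrightarrow> A \<union> A' \<in> finM"
  by (auto simp: finM_def intro!: le_less_trans[OF emeasure_subadditive])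

lemma Un_finN: "B \<in> finN \<Longrightarrow> B' \<in> finN \<Longrightarrow> B \<union> B' \<in> finN"
  by (auto simp: finN_def intro!: le_less_trans[OF emeasure_subadditive])

lemma double_hit_fst:
  assumes n: "1 \<le> n" and A: "A \<in> finM" "A' \<in> finM" "A \<inter> A' = {}"
  shows "measure (conv_root n) (space (conv_root n) - (vacant n A {} \<union> vacant n A' {})) \<le> measure M A * measure M A' / (real n)\<^sup>2"
proof -
  interpret R: prob_space "conv_root n" by (rule conv_root(1)[OF n])
  have "vacant n A {} \<inter> vacant n A' {} = vacant n (A \<union> A') {}"
    using A(1,2) by (auto simp: vacant_def count_pair_def space_root[OF n] finM_def measures_on_def emeasure_Un_eq_0_iff)
  moreover have "measure M (A \<union> A') = measure M A + measure M A'"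
    using A by (intro measure_Union) (auto simp: finM_def)
  ultimately have "measure (conv_root n) (space (conv_root n) - (vacant n A {} \<union> vacant n A' {})) =
      1 - exp (- measure M A / real n) - exp (- measure M A' / real n) + exp (- (measure M A + measure M A') / real n)"
    using R.prob_neither[of "vacant n A {}" "vacant n A' {}"] n A Un_finM[of A A']
    by (simp add: vacant_sets measure_vacant vacancy_root_fst)
  also have "\<dots> = (1 - exp (- (measure M A / real n))) * (1 - exp (- (measure M A' / real n)))"
    by (simp add: algebra_simps add_divide_distrib exp_add[symmetric] diff_divide_distrib)
  also have "\<dots> \<le> (measure M A / real n) * (measure M A' / real n)"
    using one_minus_exp_le by (intro mult_mono) auto
  finally show ?thesis by (simp add: power2_eq_square)
qed

lemma double_hit_snd:
  assumes n: "1 \<le> n" and B: "B \<in> finN" "B' \<in> finN" "B \<inter> B' = {}"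
  shows "measure (conv_root n) (space (conv_root n) - (vacant n {} B \<union> vacant n {} B')) \<le> measure N B * measure N B' / (real n)\<^sup>2"
proof -
  interpret R: prob_space "conv_root n" by (rule conv_root(1)[OF n])
  have "vacant n {} B \<inter> vacant n {} B' = vacant n {} (B \<union> B')"
    using B(1,2) by (auto simp: vacant_def count_pair_def space_root[OF n] finN_def measures_on_def emeasure_Un_eq_0_iff)
  moreover have "measure N (B \<union> B') = measure N B + measure N B'"
    using B by (intro measure_Union) (auto simp: finN_def)
  ultimately have "measure (conv_root n) (space (conv_root n) - (vacant n {} B \<union> vacant n {} B')) =
      1 - exp (- measure N B / real n) - exp (- measure N B' / real n) + exp (- (measure N B + measure N B') / real n)"
    using R.prob_neither[of "vacant n {} B" "vacant n {} B'"] n B Un_finN[of B B']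
    by (simp add: vacant_sets measure_vacant vacancy_root_snd)
  also have "\<dots> = (1 - exp (- (measure N B / real n))) * (1 - exp (- (measure N B' / real n)))"
    by (simp add: algebra_simps add_divide_distrib exp_add[symmetric] diff_divide_distrib)
  also have "\<dots> \<le> (measure N B / real n) * (measure N B' / real n)"
    using one_minus_exp_le by (intro mult_mono) auto
  finally show ?thesis by (simp add: power2_eq_square)
qed

text \<open>
  Disjoint rectangles have a pair of disjoint sides; both of these are charged only if two of the
  rare points are present.
\<close>

lemma double_hit:
  assumes n: "1 \<le> n" and A: "A \<in> finM" "A' \<in> finM" and B: "B \<in> finN" "B' \<in> finN"
    and disj: "(A \<times> B) \<inter> (A' \<times> B') = {}"
  shows "measure (conv_root n) (hit n A B \<inter> hit n A' B') \<le>
    (measure M A * measure M A' + measure N B * measure N B') / (real n)\<^sup>2"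
proof -
  interpret R: prob_space "conv_root n" by (rule conv_root(1)[OF n])
  have s: "space (conv_root n) - (vacant n A {} \<union> vacant n A' {}) \<in> sets (conv_root n)"
     "space (conv_root n) - (vacant n {} B \<union> vacant n {} B') \<in> sets (conv_root n)"
    using n A B by (auto intro!: sets.Diff sets.Un sets.top vacant_sets)
  consider "A \<inter> A' = {}" | "B \<inter> B' = {}" using disj by blast
  then show ?thesis
  proof cases
    case 1
    have "measure (conv_root n) (hit n A B \<inter> hit n A' B') \<le>
        measure (conv_root n) (space (conv_root n) - (vacant n A {} \<union> vacant n A' {}))"
      using s(1) by (rule R.finite_measure_mono[rotated]) (auto simp: hit_def)
    also have "\<dots> \<le> measure M A * measure M A' / (real n)\<^sup>2" using n A 1 by (rule double_hit_fst)
    also have "\<dots> \<le> (measure M A * measure M A' + measure N B * measure N B') / (real n)\<^sup>2"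
      by (intro divide_right_mono) auto
    finally show ?thesis .
  next
    case 2
    have "measure (conv_root n) (hit n A B \<inter> hit n A' B') \<le>
        measure (conv_root n) (space (conv_root n) - (vacant n {} B \<union> vacant n {} B'))"
      using s(2) by (rule R.finite_measure_mono[rotated]) (auto simp: hit_def)
    also have "\<dots> \<le> measure N B * measure N B' / (real n)\<^sup>2" using n B 2 by (rule double_hit_snd)
    also have "\<dots> \<le> (measure M A * measure M A' + measure N B * measure N B') / (real n)\<^sup>2"
      by (intro divide_right_mono) auto
    finally show ?thesis .
  qed
qed

lemma emeasure_ne_0_mono:
  assumes "emeasure \<xi> B \<noteq> 0" "B \<subseteq> A" "A \<in> sets \<xi>"
  shows "emeasure \<xi> A \<noteq> 0"
  using emeasure_mono[OF assms(2,3)] assms(1) by auto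

lemma hit_empty:
  assumes "A \<times> B = {}"
  shows "hit n A B = {}"
  using assms by (auto simp: mem_hit)

text \<open>
  The Bonferroni inequality under the root of order \<open>n\<close>, multiplied by \<open>n\<close>: by \<open>double_hit\<close> the
  correction terms are of order \<open>1 / n\<close>.
\<close>

lemma bimeasure_superadditive:
  fixes e :: "nat \<Rightarrow> 'a set" and f :: "nat \<Rightarrow> 'b set" and m :: nat
  assumes EF: "E \<in> finM" "F \<in> finN" and ef: "\<And>i. e i \<in> finM" "\<And>i. f i \<in> finN"
    and disj: "disjoint_family (\<lambda>i::nat. e i \<times> f i)" and sub: "\<And>i. e i \<times> f i \<subseteq> E \<times> F"
  shows "(\<Sum>i<m. bimeasure (e i) (f i)) \<le> bimeasure E F"
proof -
  define C where "C = (\<Sum>i<m. \<Sum>j<i. measure M (e i) * measure M (e j) + measure N (f i) * measure N (f j))"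
  have hit_sub: "hit n (e i) (f i) \<subseteq> hit n E F" if n: "1 \<le> n" for n i
  proof (cases "e i \<times> f i = {}")
    case True
    then show ?thesis by (simp add: hit_empty)
  next
    case False
    then have ef_sub: "e i \<subseteq> E" "f i \<subseteq> F" using sub[of i] by blast+
    show ?thesis
    proof
      fix p assume "p \<in> hit n (e i) (f i)"
      then have p: "p \<in> space (conv_root n)" "emeasure (fst p) (e i) \<noteq> 0" "emeasure (snd p) (f i) \<noteq> 0"
        by (auto simp: mem_hit)
      then have "E \<in> sets (fst p)" "F \<in> sets (snd p)"
        using EF by (auto simp: space_root[OF n] measures_on_def finM_def finN_def)
      then show "p \<in> hit n E F"
        unfolding mem_hit
        using p(1) emeasure_ne_0_mono[OF p(2) ef_sub(1)] emeasure_ne_0_mono[OF p(3) ef_sub(2)] by simp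
    qed
  qed
  have "(\<Sum>i<m. real n * measure (conv_root n) (hit n (e i) (f i))) \<le>
      real n * measure (conv_root n) (hit n E F) + C / real n" if n: "1 \<le> n" for n
  proof -
    interpret R: prob_space "conv_root n" by (rule conv_root(1)[OF n])
    have "(\<Sum>i<m. R.prob (hit n (e i) (f i))) \<le> R.prob (\<Union>i<m. hit n (e i) (f i)) +
        (\<Sum>i<m. \<Sum>j<i. R.prob (hit n (e i) (f i) \<inter> hit n (e j) (f j)))"
      using n ef by (intro R.bonferroni hit_sets) auto
    also have "R.prob (\<Union>i<m. hit n (e i) (f i)) \<le> R.prob (hit n E F)"
      using n EF hit_sub[OF n] by (intro R.finite_measure_mono hit_sets) auto
    also have "(\<Sum>i<m. \<Sum>j<i. R.prob (hit n (e i) (f i) \<inter> hit n (e j) (f j))) \<le>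
        (\<Sum>i<m. \<Sum>j<i. (measure M (e i) * measure M (e j) + measure N (f i) * measure N (f j)) / (real n)\<^sup>2)"
    proof (intro sum_mono double_hit n ef)
      fix i j :: nat assume "j \<in> {..<i}"
      then show "e i \<times> f i \<inter> e j \<times> f j = {}"
        using disjoint_family_onD[OF disj, of i j] by simp
    qed
    also have "\<dots> = C / (real n)\<^sup>2" by (simp add: C_def sum_divide_distrib)
    finally have "real n * (\<Sum>i<m. R.prob (hit n (e i) (f i))) \<le> real n * (R.prob (hit n E F) + C / (real n)\<^sup>2)"
      by (intro mult_left_mono) auto
    then show ?thesis using n by (simp add: sum_distrib_left algebra_simps power2_eq_square)
  qed
  then have ev: "\<exists>K. \<forall>n\<ge>K. (\<Sum>i<m. real n * measure (conv_root n) (hit n (e i) (f i))) \<le>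
      real n * measure (conv_root n) (hit n E F) + C / real n" by blast
  have l1: "(\<lambda>n. \<Sum>i<m. real n * measure (conv_root n) (hit n (e i) (f i))) \<longlonglongrightarrow> (\<Sum>i<m. bimeasure (e i) (f i))"
    using ef by (intro tendsto_sum hit_limit) auto
  have "(\<lambda>n. C / real n) \<longlonglongrightarrow> 0" by real_asymp
  then have l2: "(\<lambda>n. real n * measure (conv_root n) (hit n E F) + C / real n) \<longlonglongrightarrow> bimeasure E F + 0"
    using EF by (intro tendsto_add hit_limit)
  show ?thesis using LIMSEQ_le[OF l1 l2 ev] by simp
qed

text \<open>
  Under each root the hitting probabilities are countably subadditive by \<open>rectangle_null_cover\<close>.
  In the limit the infinite sum is controlled by \<open>hit_bound\<close>: the terms
  \<open>\<mu> (e i) * \<nu> (f i) / n\<close> add up to \<open>\<mu> E * \<nu> F / n\<close> because the rectangles are disjoint.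
\<close>

lemma bimeasure_subadditive:
  fixes e :: "nat \<Rightarrow> 'a set" and f :: "nat \<Rightarrow> 'b set"
  assumes EF: "E \<in> finM" "F \<in> finN" and ef: "\<And>i. e i \<in> finM" "\<And>i. f i \<in> finN"
    and disj: "disjoint_family (\<lambda>i::nat. e i \<times> f i)" and cover: "(\<Union>i. e i \<times> f i) = E \<times> F"
  shows "ennreal (bimeasure E F) \<le> (\<Sum>i. ennreal (bimeasure (e i) (f i)))"
proof -
  interpret MN: pair_sigma_finite M N ..
  have ms: "E \<in> sets M" "F \<in> sets N" "\<And>i. e i \<in> sets M" "\<And>i. f i \<in> sets N"
    using EF ef by (auto simp: finM_def finN_def)
  have em: "emeasure M A = ennreal (measure M A)" if "A \<in> finM" for A
    using that by (intro emeasure_eq_ennreal_measure) (auto simp: finM_def)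
  have en: "emeasure N A = ennreal (measure N A)" if "A \<in> finN" for A
    using that by (intro emeasure_eq_ennreal_measure) (auto simp: finN_def)
  have area: "(\<Sum>i. ennreal (measure M (e i) * measure N (f i))) = ennreal (measure M E * measure N F)"
  proof -
    have "(\<Sum>i. emeasure (M \<Otimes>\<^sub>M N) (e i \<times> f i)) = emeasure (M \<Otimes>\<^sub>M N) (\<Union>i. e i \<times> f i)"
      using ms disj by (intro suminf_emeasure) auto
    then show ?thesis
      unfolding cover using ms EF ef
      by (simp add: N.emeasure_pair_measure_Times em en ennreal_mult)
  qed
  have main: "ennreal (real n * measure (conv_root n) (hit n E F)) \<le>
      ennreal (measure M E * measure N F / real n) + (\<Sum>i. ennreal (bimeasure (e i) (f i)))" if n: "1 \<le> n" for n
  proof -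
    interpret R: prob_space "conv_root n" by (rule conv_root(1)[OF n])
    have "hit n E F \<subseteq> (\<Union>i. hit n (e i) (f i))"
    proof
      fix p assume p: "p \<in> hit n E F"
      then have sp: "p \<in> space (conv_root n)" and ne: "emeasure (fst p) E \<noteq> 0" "emeasure (snd p) F \<noteq> 0"
        by (auto simp: mem_hit)
      have st: "sets (fst p) = sets M" "sets (snd p) = sets N"
        using sp by (auto simp: space_root[OF n] measures_on_def)
      show "p \<in> (\<Union>i. hit n (e i) (f i))"
      proof (rule ccontr)
        assume no: "p \<notin> (\<Union>i. hit n (e i) (f i))"
        have "emeasure (fst p) E = 0 \<or> emeasure (snd p) F = 0"
        proof (rule rectangle_null_cover[of e "fst p" E f "snd p" F])
          show "emeasure (fst p) (e i) = 0 \<or> emeasure (snd p) (f i) = 0" for i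
            using no sp by (auto simp: mem_hit)
        qed (use ms st cover in auto)
        then show False using ne by blast
      qed
    qed
    then have "emeasure (conv_root n) (hit n E F) \<le> emeasure (conv_root n) (\<Union>i. hit n (e i) (f i))"
      using n ef hit_sets by (intro emeasure_mono) blast+
    also have "\<dots> \<le> (\<Sum>i. emeasure (conv_root n) (hit n (e i) (f i)))"
      using n ef hit_sets by (intro emeasure_subadditive_countably) blast
    finally have "ennreal (real n) * emeasure (conv_root n) (hit n E F) \<le>
        ennreal (real n) * (\<Sum>i. emeasure (conv_root n) (hit n (e i) (f i)))" by (rule mult_left_mono) simp
    also have "\<dots> = (\<Sum>i. ennreal (real n * measure (conv_root n) (hit n (e i) (f i))))"
      by (simp add: R.emeasure_eq_measure ennreal_mult)
    also have "\<dots> \<le> (\<Sum>i. ennreal (measure M (e i) * measure N (f i) / real n) + ennreal (bimeasure (e i) (f i)))"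
    proof (intro suminf_le)
      fix i
      have "ennreal (real n * measure (conv_root n) (hit n (e i) (f i))) \<le>
          ennreal (measure M (e i) * measure N (f i) / real n + bimeasure (e i) (f i))"
        using hit_bound[OF n ef] by (rule ennreal_leI)
      also have "\<dots> = ennreal (measure M (e i) * measure N (f i) / real n) + ennreal (bimeasure (e i) (f i))"
        using bimeasure_nonneg[OF ef] by (intro ennreal_plus) auto
      finally show "ennreal (real n * measure (conv_root n) (hit n (e i) (f i))) \<le>
          ennreal (measure M (e i) * measure N (f i) / real n) + ennreal (bimeasure (e i) (f i))" .
    qed auto
    also have "\<dots> = (\<Sum>i. ennreal (measure M (e i) * measure N (f i) / real n)) + (\<Sum>i. ennreal (bimeasure (e i) (f i)))"
      by (rule suminf_add[symmetric]) auto
    also have "(\<Sum>i. ennreal (measure M (e i) * measure N (f i) / real n)) =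
        (\<Sum>i. ennreal (1 / real n) * ennreal (measure M (e i) * measure N (f i)))"
      by (intro suminf_cong) (simp flip: ennreal_mult)
    also have "\<dots> = ennreal (1 / real n) * ennreal (measure M E * measure N F)"
      unfolding area[symmetric] by (rule ennreal_suminf_cmult)
    also have "\<dots> = ennreal (measure M E * measure N F / real n)"
      by (simp flip: ennreal_mult)
    also have "ennreal (real n) * emeasure (conv_root n) (hit n E F) = ennreal (real n * measure (conv_root n) (hit n E F))"
      by (simp add: R.emeasure_eq_measure ennreal_mult)
    finally show ?thesis .
  qed
  then have ev: "\<exists>K. \<forall>n\<ge>K. ennreal (real n * measure (conv_root n) (hit n E F)) \<le>
      ennreal (measure M E * measure N F / real n) + (\<Sum>i. ennreal (bimeasure (e i) (f i)))" by blast
  have l1: "(\<lambda>n. ennreal (real n * measure (conv_root n) (hit n E F))) \<longlonglongrightarrow> ennreal (bimeasure E F)"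
    using EF by (intro tendsto_ennrealI hit_limit)
  have "(\<lambda>n. measure M E * measure N F / real n) \<longlonglongrightarrow> 0" by real_asymp
  then have "(\<lambda>n. ennreal (measure M E * measure N F / real n)) \<longlonglongrightarrow> ennreal 0" by (rule tendsto_ennrealI)
  then have l2: "(\<lambda>n. ennreal (measure M E * measure N F / real n) + (\<Sum>i. ennreal (bimeasure (e i) (f i))))
      \<longlonglongrightarrow> ennreal 0 + (\<Sum>i. ennreal (bimeasure (e i) (f i)))"
    by (intro tendsto_add tendsto_const)
  show ?thesis using LIMSEQ_le[OF l1 l2 ev] by simp
qed

definition rectangles :: "('a \<times> 'b) set set" where
  "rectangles = {A \<times> B | A B. A \<in> finM \<and> B \<in> finN}"

lemma Int_finM: "A \<in> finM \<Longrightarrow> A' \<in> sets M \<Longrightarrow> A \<inter> A' \<in> finM"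
  using emeasure_mono[of "A \<inter> A'" A M] by (auto simp: finM_def intro: le_less_trans)

lemma Int_finN: "B \<in> finN \<Longrightarrow> B' \<in> sets N \<Longrightarrow> B \<inter> B' \<in> finN"
  using emeasure_mono[of "B \<inter> B'" B N] by (auto simp: finN_def intro: le_less_trans)

lemma Diff_finM: "A \<in> finM \<Longrightarrow> A' \<in> sets M \<Longrightarrow> A - A' \<in> finM"
  using emeasure_mono[of "A - A'" A M] by (auto simp: finM_def intro: le_less_trans)

lemma Diff_finN: "B \<in> finN \<Longrightarrow> B' \<in> sets N \<Longrightarrow> B - B' \<in> finN"
  using emeasure_mono[of "B - B'" B N] by (auto simp: finN_def intro: le_less_trans)

lemma semiring_rectangles: "semiring_of_sets (space M \<times> space N) rectangles"
proof
  show "rectangles \<subseteq> Pow (space M \<times> space N)"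
    by (auto simp: rectangles_def finM_def finN_def dest: sets.sets_into_space)
  show "{} \<in> rectangles" unfolding rectangles_def by (auto intro!: exI[of _ "{}"])
  fix a b assume "a \<in> rectangles" "b \<in> rectangles"
  then obtain A B A' B' where ab: "a = A \<times> B" "b = A' \<times> B'" and
    fin: "A \<in> finM" "B \<in> finN" "A' \<in> finM" "B' \<in> finN" by (auto simp: rectangles_def)
  have s: "A' \<in> sets M" "B' \<in> sets N" using fin by (auto simp: finM_def finN_def)
  have "a \<inter> b = (A \<inter> A') \<times> (B \<inter> B')" by (auto simp: ab)
  then show "a \<inter> b \<in> rectangles"
    unfolding rectangles_def using Int_finM[OF fin(1) s(1)] Int_finN[OF fin(2) s(2)] by blast
  show "\<exists>C\<subseteq>rectangles. finite C \<and> disjoint C \<and> a - b = \<Union>C"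
  proof (intro exI conjI)
    show "{(A - A') \<times> B, (A \<inter> A') \<times> (B - B')} \<subseteq> rectangles"
      unfolding rectangles_def
      using Int_finM[OF fin(1) s(1)] Diff_finM[OF fin(1) s(1)] Diff_finN[OF fin(2) s(2)] fin by blast
    show "disjoint {(A - A') \<times> B, (A \<inter> A') \<times> (B - B')}" by (auto simp: disjoint_def)
    show "a - b = \<Union>{(A - A') \<times> B, (A \<inter> A') \<times> (B - B')}" by (auto simp: ab)
  qed simp
qed

lemma exhaustion:
  obtains D D' where "range D \<subseteq> finM" "range D' \<subseteq> finN" "incseq D" "incseq D'"
    "(\<Union>i::nat. D i) = space M" "(\<Union>i::nat. D' i) = space N"
proof -
  obtain D :: "nat \<Rightarrow> 'a set" where D: "range D \<subseteq> sets M" "(\<Union>i. D i) = space M"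
    "\<And>i. emeasure M (D i) \<noteq> \<infinity>" "incseq D" using M.sigma_finite_incseq by metis
  obtain D' :: "nat \<Rightarrow> 'b set" where D': "range D' \<subseteq> sets N" "(\<Union>i. D' i) = space N"
    "\<And>i. emeasure N (D' i) \<noteq> \<infinity>" "incseq D'" using N.sigma_finite_incseq by metis
  show ?thesis
    by (rule that[of D D']) (use D D' in \<open>auto simp: finM_def finN_def less_top\<close>)
qed

lemma sigma_sets_rectangles: "sigma_sets (space M \<times> space N) rectangles = sets (M \<Otimes>\<^sub>M N)"
proof
  show "sigma_sets (space M \<times> space N) rectangles \<subseteq> sets (M \<Otimes>\<^sub>M N)"
    unfolding space_pair_measure[symmetric]
    by (rule sets.sigma_sets_subset) (auto simp: rectangles_def finM_def finN_def)
  obtain D D' where D: "range D \<subseteq> finM" "range D' \<subseteq> finN" "incseq D" "incseq D'"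
    "(\<Union>i::nat. D i) = space M" "(\<Union>i::nat. D' i) = space N" by (rule exhaustion)
  show "sets (M \<Otimes>\<^sub>M N) \<subseteq> sigma_sets (space M \<times> space N) rectangles"
    unfolding sets_pair_measure
  proof (rule sigma_sets_mono, safe)
    fix A B assume AB: "A \<in> sets M" "B \<in> sets N"
    have "A \<times> B = (\<Union>i. (D i \<inter> A) \<times> (D' i \<inter> B))"
    proof (intro equalityI subsetI)
      fix z assume z: "z \<in> A \<times> B"
      then have "fst z \<in> space M" "snd z \<in> space N" using AB[THEN sets.sets_into_space] by auto
      then obtain i j where "fst z \<in> D i" "snd z \<in> D' j" using D(5,6) by blast
      then have "fst z \<in> D (max i j)" "snd z \<in> D' (max i j)"
        using incseqD[OF D(3), of i "max i j"] incseqD[OF D(4), of j "max i j"] by auto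
      then show "z \<in> (\<Union>i. (D i \<inter> A) \<times> (D' i \<inter> B))" using z by (cases z) auto
    qed auto
    also have "\<dots> \<in> sigma_sets (space M \<times> space N) rectangles"
    proof (rule sigma_sets.Union, rule sigma_sets.Basic)
      fix i
      have "D i \<inter> A \<in> finM" using D(1) by (intro Int_finM AB(1)) auto
      moreover have "D' i \<inter> B \<in> finN" using D(2) by (intro Int_finN AB(2)) auto
      ultimately show "(D i \<inter> A) \<times> (D' i \<inter> B) \<in> rectangles" by (auto simp: rectangles_def)
    qed
    finally show "A \<times> B \<in> sigma_sets (space M \<times> space N) rectangles" .
  qed
qed

text \<open>
  Caratheodory's theorem for the semiring of rectangles with sides of finite measure. The set function
  recovers the sides of a rectangle as its projections, which fails for an empty rectangle; there both
  values are 0.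
\<close>

theorem bimeasure_extends:
  "\<exists>\<gamma>. sets \<gamma> = sets (M \<Otimes>\<^sub>M N) \<and> (\<forall>A\<in>finM. \<forall>B\<in>finN. emeasure \<gamma> (A \<times> B) = ennreal (bimeasure A B))"
proof -
  interpret semiring_of_sets "space M \<times> space N" rectangles by (rule semiring_rectangles)
  define G where "G = (\<lambda>C :: ('a \<times> 'b) set. ennreal (bimeasure (fst ` C) (snd ` C)))"
  have z: "bimeasure A B = 0" if "A \<in> finM" "B \<in> finN" "A \<times> B = {}" for A B
    using bimeasure_le[OF that(1,2)] bimeasure_nonneg[OF that(1,2)] that(3) by auto
  have G: "G (A \<times> B) = ennreal (bimeasure A B)" if "A \<in> finM" "B \<in> finN" for A B
  proof (cases "A \<times> B = {}")
    case True
    then show ?thesis using z[OF that True] z[of "{}" "{}"] by (simp add: G_def)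
  next
    case False
    then show ?thesis by (auto simp: G_def)
  qed
  have pos: "positive rectangles G"
    using G[of "{}" "{}"] z[of "{}" "{}"] by (simp add: positive_def)
  have ca: "countably_additive rectangles G"
  proof (rule countably_additiveI)
    fix C :: "nat \<Rightarrow> ('a \<times> 'b) set"
    assume C: "range C \<subseteq> rectangles" "disjoint_family C" "(\<Union>i. C i) \<in> rectangles"
    have "\<forall>i. C i \<in> rectangles" using C(1) by blast
    then have "\<forall>i. \<exists>A B. C i = A \<times> B \<and> A \<in> finM \<and> B \<in> finN" by (auto simp: rectangles_def)
    then obtain e f where ef: "\<And>i. C i = e i \<times> f i" "\<And>i. e i \<in> finM" "\<And>i. f i \<in> finN" by metis
    obtain E F where EF: "(\<Union>i. C i) = E \<times> F" "E \<in> finM" "F \<in> finN" using C(3) by (auto simp: rectangles_def)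
    have disj: "disjoint_family (\<lambda>i. e i \<times> f i)" using C(2) by (simp add: ef(1)[symmetric])
    have cover: "(\<Union>i. e i \<times> f i) = E \<times> F" using EF(1) by (simp add: ef(1)[symmetric])
    have "(\<Sum>i. ennreal (bimeasure (e i) (f i))) \<le> ennreal (bimeasure E F)"
    proof (rule suminf_le_const)
      fix m
      have "(\<Sum>i<m. ennreal (bimeasure (e i) (f i))) = ennreal (\<Sum>i<m. bimeasure (e i) (f i))"
        using bimeasure_nonneg ef by (intro sum_ennreal) auto
      also have "\<dots> \<le> ennreal (bimeasure E F)"
        using EF ef disj cover by (intro ennreal_leI bimeasure_superadditive) blast+
      finally show "(\<Sum>i<m. ennreal (bimeasure (e i) (f i))) \<le> ennreal (bimeasure E F)" .
    qed simp
    moreover have "ennreal (bimeasure E F) \<le> (\<Sum>i. ennreal (bimeasure (e i) (f i)))"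
      using EF(2,3) ef(2,3) disj cover by (rule bimeasure_subadditive)
    ultimately show "(\<Sum>i. G (C i)) = G (\<Union>i. C i)"
      using G ef EF by (simp add: antisym)
  qed
  obtain \<mu>' where \<mu>': "\<And>s. s \<in> rectangles \<Longrightarrow> \<mu>' s = G s"
    "measure_space (space M \<times> space N) (sigma_sets (space M \<times> space N) rectangles) \<mu>'"
    using caratheodory[OF pos ca] by blast
  define \<gamma> where "\<gamma> = measure_of (space M \<times> space N) rectangles \<mu>'"
  have "sets \<gamma> = sets (M \<Otimes>\<^sub>M N)"
    unfolding \<gamma>_def using space_closed by (simp add: sigma_sets_rectangles)
  moreover have "emeasure \<gamma> (A \<times> B) = ennreal (bimeasure A B)" if "A \<in> finM" "B \<in> finN" for A B
  proof -
    have r: "A \<times> B \<in> rectangles" using that by (auto simp: rectangles_def)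
    have "emeasure \<gamma> (A \<times> B) = \<mu>' (A \<times> B)"
    proof (rule emeasure_measure_of[OF \<gamma>_def])
      show "positive (sets \<gamma>) \<mu>'" "countably_additive (sets \<gamma>) \<mu>'"
        using \<mu>'(2) space_closed by (auto simp: \<gamma>_def measure_space_def)
      show "A \<times> B \<in> sets \<gamma>" using r space_closed by (auto simp: \<gamma>_def)
    qed (rule space_closed)
    then show ?thesis using \<mu>'(1)[OF r] G[OF that] by simp
  qed
  ultimately show ?thesis by blast
qed

end

section \<open>Sub-measures and marginals\<close>

lemma measure_eqI_finite_measure_sets:
  assumes "sigma_finite_measure m" "sets \<kappa> = sets m" "sets \<kappa>' = sets m"
    and eq: "\<And>A. A \<in> sets m \<Longrightarrow> emeasure m A < \<infinity> \<Longrightarrow> emeasure \<kappa> A = emeasure \<kappa>' A"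
  shows "\<kappa> = \<kappa>'"
proof (rule measure_eqI)
  interpret sigma_finite_measure m by fact
  obtain D :: "nat \<Rightarrow> 'a set" where D: "range D \<subseteq> sets m" "(\<Union>i. D i) = space m"
    "\<And>i. emeasure m (D i) \<noteq> \<infinity>" "disjoint_family D"
    using sigma_finite_disjoint by metis
  fix A assume "A \<in> sets \<kappa>"
  then have A: "A \<in> sets m" using assms by simp
  have "emeasure \<kappa> (A \<inter> D i) = emeasure \<kappa>' (A \<inter> D i)" for i
  proof (rule eq)
    show "A \<inter> D i \<in> sets m" using A D by auto
    have "emeasure m (A \<inter> D i) \<le> emeasure m (D i)" using D by (intro emeasure_mono) auto
    then show "emeasure m (A \<inter> D i) < \<infinity>" using D(3)[of i] by (auto simp: less_top[symmetric] top_unique)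
  qed
  moreover have "emeasure \<kappa> A = (\<Sum>i. emeasure \<kappa> (A \<inter> D i))"
    using D A assms(2) sets_eq_imp_space_eq[OF assms(2)] by (intro emeasure_eq_suminf_pieces) auto
  moreover have "emeasure \<kappa>' A = (\<Sum>i. emeasure \<kappa>' (A \<inter> D i))"
    using D A assms(3) sets_eq_imp_space_eq[OF assms(3)] by (intro emeasure_eq_suminf_pieces) auto
  ultimately show "emeasure \<kappa> A = emeasure \<kappa>' A" by simp
qed (use assms in simp)

lemma sigma_finite_if_le:
  assumes "sigma_finite_measure m" "sets m' = sets m" "\<And>A. A \<in> sets m \<Longrightarrow> emeasure m' A \<le> emeasure m A"
  shows "sigma_finite_measure m'"
proof -
  interpret sigma_finite_measure m by fact
  obtain D :: "nat \<Rightarrow> 'a set" where D: "range D \<subseteq> sets m" "(\<Union>i. D i) = space m"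
    "\<And>i. emeasure m (D i) \<noteq> \<infinity>"
    using sigma_finite by metis
  have "emeasure m' (D i) \<noteq> \<infinity>" for i
    using assms(3)[of "D i"] D(1) D(3)[of i] by (auto simp: top_unique)
  then show ?thesis
    using D assms(2) sets_eq_imp_space_eq[OF assms(2)]
    by (intro sigma_finite_measure.intro exI[of _ "range D"]) auto
qed

text \<open>
  Subtraction of infinite masses is avoided by means of the density \<open>f\<close> of the smaller measure:
  \<open>f \<le> 1\<close> almost everywhere, and \<open>1 - f\<close> is the density of the difference.
\<close>

lemma complementary_measure:
  assumes "sigma_finite_measure m" and sets: "sets m' = sets m"
    and le: "\<And>A. A \<in> sets m \<Longrightarrow> emeasure m' A \<le> emeasure m A"
  obtains m'' where "sets m'' = sets m" "m = add_measure m'' m'"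
proof -
  interpret sigma_finite_measure m by fact
  have ac: "absolutely_continuous m m'"
    using le sets by (force simp: absolutely_continuous_def null_sets_def)
  obtain f where f[measurable]: "f \<in> borel_measurable m" and dens: "density m f = m'"
    using Radon_Nikodym[OF ac sets] by blast
  obtain D :: "nat \<Rightarrow> 'a set" where D: "range D \<subseteq> sets m" "(\<Union>i. D i) = space m"
    "\<And>i. emeasure m (D i) \<noteq> \<infinity>"
    using sigma_finite by metis
  have f1: "AE x in m. f x \<le> 1"
  proof -
    have "AE x in m. x \<notin> {x \<in> D i. 1 < f x}" for i
    proof -
      define E where "E = {x \<in> D i. 1 < f x}"
      have [measurable]: "D i \<in> sets m" using D by auto
      have "E = D i \<inter> {x \<in> space m. 1 < f x}"
        using sets.sets_into_space[OF \<open>D i \<in> sets m\<close>] by (auto simp: E_def)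
      then have E[measurable]: "E \<in> sets m" by simp
      have fin: "emeasure m E \<noteq> \<infinity>"
        using emeasure_mono[of E "D i" m] D(3)[of i] by (auto simp: E_def top_unique)
      have "(\<integral>\<^sup>+x. f x * indicator E x \<partial>m) = emeasure m' E" unfolding dens[symmetric] by (simp add: emeasure_density)
      also have "\<dots> \<le> emeasure m E" by (rule le) measurable
      finally have up: "(\<integral>\<^sup>+x. f x * indicator E x \<partial>m) \<le> emeasure m E" .
      have "(\<integral>\<^sup>+x. f x * indicator E x \<partial>m) =
          (\<integral>\<^sup>+x. indicator E x + (f x - 1) * indicator E x \<partial>m)"
      proof (rule nn_integral_cong)
        fix x
        have "1 + (f x - 1) = f x" if "1 < f x"
          using diff_add_cancel_ennreal[OF less_imp_le[OF that]] by (simp add: add.commute)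
        then have *: "x \<in> E \<Longrightarrow> 1 + (f x - 1) = f x" by (simp only: E_def mem_Collect_eq)
        show "f x * indicator E x = indicator E x + (f x - 1) * indicator E x"
        proof (cases "x \<in> E")
          case True
          show ?thesis using *[OF True] True by (simp only: indicator_simps mult_1_right)
        qed simp
      qed
      also have "\<dots> = emeasure m E + (\<integral>\<^sup>+x. (f x - 1) * indicator E x \<partial>m)"
        by (subst nn_integral_add) auto
      finally have "emeasure m E + (\<integral>\<^sup>+x. (f x - 1) * indicator E x \<partial>m) \<le> emeasure m E + 0"
        using up by simp
      then have "(\<integral>\<^sup>+x. (f x - 1) * indicator E x \<partial>m) = 0"
        using fin by (simp add: ennreal_add_left_cancel_le)
      then have "AE x in m. (f x - 1) * indicator E x = 0"
        by (subst (asm) nn_integral_0_iff_AE) auto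
      then show ?thesis unfolding E_def[symmetric]
      proof eventually_elim
        case (elim x)
        have "f x - 1 \<noteq> 0" if "x \<in> E" using that by (auto simp: E_def diff_eq_0_iff_ennreal)
        then show ?case using elim by (auto simp: indicator_def)
      qed
    qed
    then have "AE x in m. \<forall>i. x \<notin> {x \<in> D i. 1 < f x}" unfolding AE_all_countable by blast
    then show ?thesis using AE_space
    proof eventually_elim
      case (elim x)
      then obtain i where "x \<in> D i" using D(2) by blast
      then show ?case using elim by (auto simp: not_less)
    qed
  qed
  define m'' where "m'' = density m (\<lambda>x. 1 - f x)"
  have sets'': "sets m'' = sets m" by (simp add: m''_def)
  have "m = add_measure m'' m'"
  proof (rule measure_eqI)
    fix A assume [measurable]: "A \<in> sets m"
    have "emeasure (add_measure m'' m') A = emeasure m'' A + emeasure m' A"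
      by (rule emeasure_add_measure) (simp add: sets sets'')
    also have "\<dots> = (\<integral>\<^sup>+x. (1 - f x) * indicator A x \<partial>m) + (\<integral>\<^sup>+x. f x * indicator A x \<partial>m)"
      unfolding dens[symmetric] m''_def by (simp add: emeasure_density)
    also have "\<dots> = (\<integral>\<^sup>+x. (1 - f x) * indicator A x + f x * indicator A x \<partial>m)"
      by (rule nn_integral_add[symmetric]) auto
    also have "\<dots> = (\<integral>\<^sup>+x. indicator A x \<partial>m)"
      using f1 by (intro nn_integral_cong_AE) (auto elim!: eventually_mono simp: indicator_def diff_add_cancel_ennreal)
    also have "\<dots> = emeasure m A" by simp
    finally show "emeasure m A = emeasure (add_measure m'' m') A" by simp
  qed (simp add: sets'')
  then show ?thesis using that sets'' by blast
qed

lemma invariant_complement: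
  assumes "sigma_finite_measure m" "T \<in> m \<rightarrow>\<^sub>M m" "distr m m T = m"
    and m': "sets m' = sets m" "distr m' m T = m'" and m'': "sets m'' = sets m" "m = add_measure m'' m'"
  shows "distr m'' m T = m''"
proof (rule measure_eqI_finite_measure_sets[OF assms(1)])
  fix A assume A: "A \<in> sets m" "emeasure m A < \<infinity>"
  have sp: "space m' = space m" "space m'' = space m"
    using m'(1) m''(1) by (auto dest: sets_eq_imp_space_eq)
  have meas: "T \<in> m' \<rightarrow>\<^sub>M m" "T \<in> m'' \<rightarrow>\<^sub>M m"
    using assms(2) by (simp_all add: measurable_cong_sets[OF m'(1) refl] measurable_cong_sets[OF m''(1) refl])
  define B where "B = T -` A \<inter> space m"
  have B: "B \<in> sets m" unfolding B_def using assms(2) A(1) by (rule measurable_sets)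
  have add: "emeasure m C = emeasure m'' C + emeasure m' C" for C
  proof -
    have "emeasure (add_measure m'' m') C = emeasure m'' C + emeasure m' C"
      by (rule emeasure_add_measure) (simp add: m'(1) m''(1))
    then show ?thesis by (simp flip: m''(2))
  qed
  have mB: "emeasure m B = emeasure m A"
    unfolding B_def using emeasure_distr[OF assms(2) A(1)] assms(3) by simp
  have m'B: "emeasure m' B = emeasure m' A"
    unfolding B_def using emeasure_distr[OF meas(1) A(1)] m'(2) by (simp add: sp)
  have fin: "emeasure m' A \<noteq> \<infinity>" using add[of A] A(2) by auto
  have "emeasure m' A + emeasure m'' B = emeasure m' A + emeasure m'' A"
    using mB add[of B] add[of A] m'B by (simp add: add.commute)
  then have "emeasure m'' B = emeasure m'' A" using fin by (simp add: ennreal_add_left_cancel)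
  then show "emeasure (distr m'' m T) A = emeasure m'' A"
    using emeasure_distr[OF meas(2) A(1)] by (simp add: B_def sp)
qed (simp_all add: m''(1))

section \<open>Marginals and products of laws\<close>

lemma measure_fst_marginal:
  assumes R: "sets R = sets (pair_measures_space M N)" and K: "sets K = sets (measures_space M)"
    and A: "A \<in> sets M" and S: "S \<in> sets borel"
  shows "measure R {p \<in> space R. count_pair A {} p \<in> S} = measure (distr R K fst) {\<xi> \<in> space (distr R K fst). emeasure \<xi> A \<in> S}"
proof -
  have sp: "space K = measures_on M" "space R = measures_on M \<times> measures_on N"
    using sets_eq_imp_space_eq[OF K] sets_eq_imp_space_eq[OF R] by (auto simp: space_pair_measures_space)
  have f: "fst \<in> R \<rightarrow>\<^sub>M K"
    unfolding measurable_cong_sets[OF R K] by (rule measurable_fst)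
  have "(\<lambda>\<xi>. emeasure \<xi> A) -` S \<inter> space (measures_space M) \<in> sets K"
    unfolding K using measurable_emeasure_measures_space[OF A] S by (rule measurable_sets)
  from measure_distr[OF f this]
  have "measure (distr R K fst) ((\<lambda>\<xi>. emeasure \<xi> A) -` S \<inter> space (measures_space M)) =
    measure R (fst -` ((\<lambda>\<xi>. emeasure \<xi> A) -` S \<inter> space (measures_space M)) \<inter> space R)" .
  also have "fst -` ((\<lambda>\<xi>. emeasure \<xi> A) -` S \<inter> space (measures_space M)) \<inter> space R =
      {p \<in> space R. count_pair A {} p \<in> S}"
    by (auto simp: sp count_pair_def)
  also have "(\<lambda>\<xi>. emeasure \<xi> A) -` S \<inter> space (measures_space M) =
      {\<xi> \<in> space (distr R K fst). emeasure \<xi> A \<in> S}" by (auto simp: sp)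
  finally show ?thesis by simp
qed

lemma measure_snd_marginal:
  assumes R: "sets R = sets (pair_measures_space M N)" and K: "sets K = sets (measures_space N)"
    and B: "B \<in> sets N" and S: "S \<in> sets borel"
  shows "measure R {p \<in> space R. count_pair {} B p \<in> S} = measure (distr R K snd) {\<xi> \<in> space (distr R K snd). emeasure \<xi> B \<in> S}"
proof -
  have sp: "space K = measures_on N" "space R = measures_on M \<times> measures_on N"
    using sets_eq_imp_space_eq[OF K] sets_eq_imp_space_eq[OF R] by (auto simp: space_pair_measures_space)
  have f: "snd \<in> R \<rightarrow>\<^sub>M K"
    unfolding measurable_cong_sets[OF R K] by (rule measurable_snd)
  have "(\<lambda>\<xi>. emeasure \<xi> B) -` S \<inter> space (measures_space N) \<in> sets K"
    unfolding K using measurable_emeasure_measures_space[OF B] S by (rule measurable_sets)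
  from measure_distr[OF f this]
  have "measure (distr R K snd) ((\<lambda>\<xi>. emeasure \<xi> B) -` S \<inter> space (measures_space N)) =
    measure R (snd -` ((\<lambda>\<xi>. emeasure \<xi> B) -` S \<inter> space (measures_space N)) \<inter> space R)" .
  also have "snd -` ((\<lambda>\<xi>. emeasure \<xi> B) -` S \<inter> space (measures_space N)) \<inter> space R =
      {p \<in> space R. count_pair {} B p \<in> S}"
    by (auto simp: sp count_pair_def)
  also have "(\<lambda>\<xi>. emeasure \<xi> B) -` S \<inter> space (measures_space N) =
      {\<xi> \<in> space (distr R K snd). emeasure \<xi> B \<in> S}" by (auto simp: sp)
  finally show ?thesis by simp
qed

lemma
  assumes P1: "prob_space P1" "sets P1 = sets (measures_space M)"
    and P2: "prob_space P2" "sets P2 = sets (measures_space N)"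
    and AB: "A \<in> sets M" "B \<in> sets N"
  shows vacancy_product: "vacancy (P1 \<Otimes>\<^sub>M P2) A B =
      measure P1 {\<xi> \<in> space P1. emeasure \<xi> A = 0} * measure P2 {\<eta> \<in> space P2. emeasure \<eta> B = 0}"
    and multiplicity_prob_product_fst: "multiplicity_prob (P1 \<Otimes>\<^sub>M P2) A {} =
      measure P1 {\<xi> \<in> space P1. emeasure \<xi> A \<notin> {0, 1}}"
    and multiplicity_prob_product_snd: "multiplicity_prob (P1 \<Otimes>\<^sub>M P2) {} B =
      measure P2 {\<eta> \<in> space P2. emeasure \<eta> B \<notin> {0, 1}}"
proof -
  interpret P1: prob_space P1 by fact
  interpret P2: prob_space P2 by fact
  have times: "measure (P1 \<Otimes>\<^sub>M P2) (E \<times> F) = measure P1 E * measure P2 F"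
    if "E \<in> sets P1" "F \<in> sets P2" for E F
    using that unfolding measure_def
    by (subst P2.emeasure_pair_measure_Times) (simp_all add: enn2real_mult)
  have e1: "{\<xi> \<in> space P1. emeasure \<xi> A \<in> S} \<in> sets P1" if "S \<in> sets borel" for S
  proof -
    have "(\<lambda>\<xi>. emeasure \<xi> A) -` S \<inter> space P1 \<in> sets P1"
      using measurable_emeasure_measures_space[OF AB(1)] that
      by (intro measurable_sets) (simp add: measurable_cong_sets[OF P1(2) refl])
    then show ?thesis by (simp add: vimage_def Int_def conj_commute)
  qed
  have e2: "{\<xi> \<in> space P2. emeasure \<xi> B \<in> S} \<in> sets P2" if "S \<in> sets borel" for S
  proof -
    have "(\<lambda>\<xi>. emeasure \<xi> B) -` S \<inter> space P2 \<in> sets P2"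
      using measurable_emeasure_measures_space[OF AB(2)] that
      by (intro measurable_sets) (simp add: measurable_cong_sets[OF P2(2) refl])
    then show ?thesis by (simp add: vimage_def Int_def conj_commute)
  qed
  have "{p \<in> space (P1 \<Otimes>\<^sub>M P2). count_pair A B p = 0} =
      {\<xi> \<in> space P1. emeasure \<xi> A \<in> {0}} \<times> {\<eta> \<in> space P2. emeasure \<eta> B \<in> {0}}"
    by (auto simp: space_pair_measure count_pair_def)
  then show "vacancy (P1 \<Otimes>\<^sub>M P2) A B =
      measure P1 {\<xi> \<in> space P1. emeasure \<xi> A = 0} * measure P2 {\<eta> \<in> space P2. emeasure \<eta> B = 0}"
    using times[OF e1 e2, of "{0}" "{0}"] by (simp add: vacancy_def)
  have "{p \<in> space (P1 \<Otimes>\<^sub>M P2). count_pair A {} p \<notin> {0, 1}} =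
      {\<xi> \<in> space P1. emeasure \<xi> A \<in> - {0, 1}} \<times> space P2"
    by (auto simp: space_pair_measure count_pair_def)
  then show "multiplicity_prob (P1 \<Otimes>\<^sub>M P2) A {} = measure P1 {\<xi> \<in> space P1. emeasure \<xi> A \<notin> {0, 1}}"
    using times[OF e1 sets.top, of "- {0, 1}"] by (simp add: multiplicity_prob_def P2.prob_space)
  have "{p \<in> space (P1 \<Otimes>\<^sub>M P2). count_pair {} B p \<notin> {0, 1}} =
      space P1 \<times> {\<eta> \<in> space P2. emeasure \<eta> B \<in> - {0, 1}}"
    by (auto simp: space_pair_measure count_pair_def)
  then show "multiplicity_prob (P1 \<Otimes>\<^sub>M P2) {} B = measure P2 {\<eta> \<in> space P2. emeasure \<eta> B \<notin> {0, 1}}"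
    using times[OF sets.top e2, of "- {0, 1}"] by (simp add: multiplicity_prob_def P1.prob_space)
qed

lemma measure_return_null:
  assumes "A \<in> sets M" "S \<in> sets borel"
  shows "measure (return (measures_space M) (null_measure M)) {\<xi> \<in> measures_on M. emeasure \<xi> A \<in> S} = indicator S 0"
proof -
  have "(\<lambda>\<xi>. emeasure \<xi> A) -` S \<inter> space (measures_space M) \<in> sets (measures_space M)"
    using measurable_emeasure_measures_space[OF assms(1)] assms(2) by (rule measurable_sets)
  from measure_return[OF this, of "null_measure M"] show ?thesis
    by (simp add: vimage_def Int_def conj_commute indicator_def)
qed

lemma marginals_map_measurable_count_pair:
  assumes "sets \<gamma> = sets (M \<Otimes>\<^sub>M N)"
  shows "marginals_map M N \<in> measures_space \<gamma> \<rightarrow>\<^sub>M pair_measures_space M N"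
    and "\<zeta> \<in> measures_on \<gamma> \<Longrightarrow> A \<in> sets M \<Longrightarrow> B \<in> sets N \<Longrightarrow> count_pair A B (marginals_map M N \<zeta>) =
      emeasure \<zeta> (A \<times> space N) + emeasure \<zeta> (space M \<times> B)"
proof -
  have sp: "space \<zeta> = space M \<times> space N" "sets \<zeta> = sets (M \<Otimes>\<^sub>M N)" if "\<zeta> \<in> measures_on \<gamma>" for \<zeta>
  proof -
    show s: "sets \<zeta> = sets (M \<Otimes>\<^sub>M N)" using that assms by (simp add: measures_on_def)
    show "space \<zeta> = space M \<times> space N"
      using sets_eq_imp_space_eq[OF s] by (simp add: space_pair_measure)
  qed
  have 1: "emeasure (distr \<zeta> M fst) A = emeasure \<zeta> (A \<times> space N)" if "\<zeta> \<in> measures_on \<gamma>" "A \<in> sets M" for \<zeta> A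
  proof -
    have "emeasure (distr \<zeta> M fst) A = emeasure \<zeta> (fst -` A \<inter> space \<zeta>)"
      using that(2) by (intro emeasure_distr) (simp_all add: measurable_cong_sets[OF sp(2)[OF that(1)] refl])
    also have "fst -` A \<inter> space \<zeta> = A \<times> space N"
      using sets.sets_into_space[OF that(2)] by (auto simp: sp[OF that(1)])
    finally show ?thesis .
  qed
  have 2: "emeasure (distr \<zeta> N snd) B = emeasure \<zeta> (space M \<times> B)" if "\<zeta> \<in> measures_on \<gamma>" "B \<in> sets N" for \<zeta> B
  proof -
    have "emeasure (distr \<zeta> N snd) B = emeasure \<zeta> (snd -` B \<inter> space \<zeta>)"
      using that(2) by (intro emeasure_distr) (simp_all add: measurable_cong_sets[OF sp(2)[OF that(1)] refl])
    also have "snd -` B \<inter> space \<zeta> = space M \<times> B"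
      using sets.sets_into_space[OF that(2)] by (auto simp: sp[OF that(1)])
    finally show ?thesis .
  qed
  show "count_pair A B (marginals_map M N \<zeta>) = emeasure \<zeta> (A \<times> space N) + emeasure \<zeta> (space M \<times> B)"
    if "\<zeta> \<in> measures_on \<gamma>" "A \<in> sets M" "B \<in> sets N"
    using that by (simp add: count_pair_def marginals_map_def 1 2)
  have "(\<lambda>\<zeta>. distr \<zeta> M fst) \<in> measures_space \<gamma> \<rightarrow>\<^sub>M measures_space M"
  proof (rule measurable_measures_spaceI)
    fix A assume A: "A \<in> sets M"
    have "(\<lambda>\<zeta>. emeasure \<zeta> (A \<times> space N)) \<in> borel_measurable (measures_space \<gamma>)"
      using A by (intro measurable_emeasure_measures_space) (simp add: assms)
    then show "(\<lambda>\<zeta>. emeasure (distr \<zeta> M fst) A) \<in> borel_measurable (measures_space \<gamma>)"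
      by (subst measurable_cong[OF 1[OF _ A]]) simp_all
  qed simp
  moreover have "(\<lambda>\<zeta>. distr \<zeta> N snd) \<in> measures_space \<gamma> \<rightarrow>\<^sub>M measures_space N"
  proof (rule measurable_measures_spaceI)
    fix B assume B: "B \<in> sets N"
    have "(\<lambda>\<zeta>. emeasure \<zeta> (space M \<times> B)) \<in> borel_measurable (measures_space \<gamma>)"
      using B by (intro measurable_emeasure_measures_space) (simp add: assms)
    then show "(\<lambda>\<zeta>. emeasure (distr \<zeta> N snd) B) \<in> borel_measurable (measures_space \<gamma>)"
      by (subst measurable_cong[OF 2[OF _ B]]) simp_all
  qed simp
  ultimately have "(\<lambda>\<zeta>. (distr \<zeta> M fst, distr \<zeta> N snd)) \<in> measures_space \<gamma> \<rightarrow>\<^sub>M pair_measures_space M N"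
    by (rule measurable_Pair)
  then show "marginals_map M N \<in> measures_space \<gamma> \<rightarrow>\<^sub>M pair_measures_space M N"
    by (simp add: marginals_map_def[abs_def])
qed

lemma suspension_map_measurable_emeasure:
  assumes T: "T \<in> M \<rightarrow>\<^sub>M M"
  shows "suspension_map M T \<in> measures_space M \<rightarrow>\<^sub>M measures_space M"
    and "\<xi> \<in> measures_on M \<Longrightarrow> A \<in> sets M \<Longrightarrow> emeasure (suspension_map M T \<xi>) A = emeasure \<xi> (T -` A \<inter> space M)"
proof -
  have em: "emeasure (suspension_map M T \<xi>) A = emeasure \<xi> (T -` A \<inter> space M)" if "\<xi> \<in> measures_on M" "A \<in> sets M" for \<xi> A
  proof -
    have s: "sets \<xi> = sets M" using that by (simp add: measures_on_def)
    show ?thesis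
      unfolding suspension_map_def sets_eq_imp_space_eq[OF s, symmetric]
      using that T by (intro emeasure_distr) (simp_all add: measurable_cong_sets[OF s refl])
  qed
  then show "\<xi> \<in> measures_on M \<Longrightarrow> A \<in> sets M \<Longrightarrow> emeasure (suspension_map M T \<xi>) A = emeasure \<xi> (T -` A \<inter> space M)" .
  show "suspension_map M T \<in> measures_space M \<rightarrow>\<^sub>M measures_space M"
  proof (rule measurable_measures_spaceI)
    fix A assume A: "A \<in> sets M"
    have "(\<lambda>\<xi>. emeasure \<xi> (T -` A \<inter> space M)) \<in> borel_measurable (measures_space M)"
      using T A by (intro measurable_emeasure_measures_space measurable_sets)
    then show "(\<lambda>\<xi>. emeasure (suspension_map M T \<xi>) A) \<in> borel_measurable (measures_space M)"
      by (subst measurable_cong[OF em[OF _ A]]) simp_all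
  qed (simp add: suspension_map_def)
qed

section \<open>The joining and the decomposition of the law\<close>

context divisible_pair
begin

lemma measure_eqI_rectangles:
  assumes "sets \<kappa> = sets (M \<Otimes>\<^sub>M N)" "sets \<kappa>' = sets (M \<Otimes>\<^sub>M N)"
    and eq: "\<And>A B. A \<in> finM \<Longrightarrow> B \<in> finN \<Longrightarrow> emeasure \<kappa> (A \<times> B) = emeasure \<kappa>' (A \<times> B)"
    and fin: "\<And>A B. A \<in> finM \<Longrightarrow> B \<in> finN \<Longrightarrow> emeasure \<kappa> (A \<times> B) \<noteq> \<infinity>"
  shows "\<kappa> = \<kappa>'"
proof -
  interpret semiring_of_sets "space M \<times> space N" rectangles by (rule semiring_rectangles)
  obtain D D' where D: "range D \<subseteq> finM" "range D' \<subseteq> finN" "incseq D" "incseq D'"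
    "(\<Union>i::nat. D i) = space M" "(\<Union>i::nat. D' i) = space N" by (rule exhaustion)
  show ?thesis
  proof (rule measure_eqI_generator_eq[where E = rectangles and \<Omega> = "space M \<times> space N" and A = "\<lambda>i. D i \<times> D' i"])
    show "Int_stable rectangles" by (auto intro: Int_stableI)
    show "rectangles \<subseteq> Pow (space M \<times> space N)" by (rule space_closed)
    show "sets \<kappa> = sigma_sets (space M \<times> space N) rectangles"
      "sets \<kappa>' = sigma_sets (space M \<times> space N) rectangles"
      using assms by (simp_all add: sigma_sets_rectangles)
    show "range (\<lambda>i. D i \<times> D' i) \<subseteq> rectangles"
      using D(1,2) unfolding rectangles_def by blast
    show "emeasure \<kappa> (D i \<times> D' i) \<noteq> \<infinity>" for i using D(1,2) by (intro fin) auto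
    show "emeasure \<kappa> X = emeasure \<kappa>' X" if "X \<in> rectangles" for X
      using that eq by (auto simp: rectangles_def)
    show "(\<Union>i. D i \<times> D' i) = space M \<times> space N"
    proof (intro equalityI subsetI)
      fix z assume "z \<in> space M \<times> space N"
      then obtain i j where "fst z \<in> D i" "snd z \<in> D' j" using D(5,6) by force
      then have "fst z \<in> D (max i j)" "snd z \<in> D' (max i j)"
        using incseqD[OF D(3), of i "max i j"] incseqD[OF D(4), of j "max i j"] by auto
      then show "z \<in> (\<Union>i. D i \<times> D' i)" by (cases z) auto
    qed (use D in auto)
  qed
qed

context
  fixes \<gamma> :: "('a \<times> 'b) measure"
  assumes sets_\<gamma>: "sets \<gamma> = sets (M \<Otimes>\<^sub>M N)"
    and \<gamma>: "\<And>A B. A \<in> finM \<Longrightarrow> B \<in> finN \<Longrightarrow> emeasure \<gamma> (A \<times> B) = ennreal (bimeasure A B)"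
begin

lemma space_\<gamma>: "space \<gamma> = space M \<times> space N"
  using sets_eq_imp_space_eq[OF sets_\<gamma>] by (simp add: space_pair_measure)

lemma marginal_fst:
  assumes "A \<in> sets M"
  shows "emeasure (distr \<gamma> M fst) A = emeasure \<gamma> (A \<times> space N)"
proof -
  have "emeasure (distr \<gamma> M fst) A = emeasure \<gamma> (fst -` A \<inter> space \<gamma>)"
    using assms by (intro emeasure_distr) (simp_all add: measurable_cong_sets[OF sets_\<gamma> refl])
  also have "fst -` A \<inter> space \<gamma> = A \<times> space N"
    using sets.sets_into_space[OF assms] by (auto simp: space_\<gamma>)
  finally show ?thesis .
qed

lemma marginal_snd:
  assumes "B \<in> sets N"
  shows "emeasure (distr \<gamma> N snd) B = emeasure \<gamma> (space M \<times> B)"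
proof -
  have "emeasure (distr \<gamma> N snd) B = emeasure \<gamma> (snd -` B \<inter> space \<gamma>)"
    using assms by (intro emeasure_distr) (simp_all add: measurable_cong_sets[OF sets_\<gamma> refl])
  also have "snd -` B \<inter> space \<gamma> = space M \<times> B"
    using sets.sets_into_space[OF assms] by (auto simp: space_\<gamma>)
  finally show ?thesis .
qed

text \<open>
  By \<open>bimeasure_le\<close> the mass of \<open>A \<times> B\<close> is at most that of \<open>A\<close> for every \<open>B\<close> of finite measure; such sets
  exhaust the second factor.
\<close>

lemma marginal_fst_le:
  assumes A: "A \<in> sets M"
  shows "emeasure (distr \<gamma> M fst) A \<le> emeasure M A"
proof (cases "emeasure M A < \<infinity>")
  case True
  then have A': "A \<in> finM" using A by (simp add: finM_def)
  obtain D D' where D: "range D \<subseteq> finM" "range D' \<subseteq> finN" "incseq D" "incseq D'"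
    "(\<Union>i::nat. D i) = space M" "(\<Union>i::nat. D' i) = space N" by (rule exhaustion)
  have inN: "D' i \<in> finN" for i using D(2) by auto
  have "(\<lambda>i. emeasure \<gamma> (A \<times> D' i)) \<longlonglongrightarrow> emeasure \<gamma> (\<Union>i. A \<times> D' i)"
  proof (rule Lim_emeasure_incseq)
    show "range (\<lambda>i. A \<times> D' i) \<subseteq> sets \<gamma>"
      using A inN by (auto simp: sets_\<gamma> finN_def)
    show "incseq (\<lambda>i. A \<times> D' i)" using D(4) by (auto simp: incseq_def)
  qed
  also have "(\<Union>i. A \<times> D' i) = A \<times> space N" using D(6) by auto
  finally have "(\<lambda>i. emeasure \<gamma> (A \<times> D' i)) \<longlonglongrightarrow> emeasure \<gamma> (A \<times> space N)" .
  moreover have "emeasure \<gamma> (A \<times> D' i) \<le> emeasure M A" for i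
    using \<gamma>[OF A' inN] bimeasure_le(1)[OF A' inN] True
    by (simp add: emeasure_eq_ennreal_measure ennreal_leI less_top)
  ultimately have "emeasure \<gamma> (A \<times> space N) \<le> emeasure M A" by (intro LIMSEQ_le_const2) auto
  then show ?thesis using marginal_fst[OF A] by simp
qed (simp add: not_less top_unique)

lemma marginal_snd_le:
  assumes B: "B \<in> sets N"
  shows "emeasure (distr \<gamma> N snd) B \<le> emeasure N B"
proof (cases "emeasure N B < \<infinity>")
  case True
  then have B': "B \<in> finN" using B by (simp add: finN_def)
  obtain D D' where D: "range D \<subseteq> finM" "range D' \<subseteq> finN" "incseq D" "incseq D'"
    "(\<Union>i::nat. D i) = space M" "(\<Union>i::nat. D' i) = space N" by (rule exhaustion)
  have inM: "D i \<in> finM" for i using D(1) by auto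
  have "(\<lambda>i. emeasure \<gamma> (D i \<times> B)) \<longlonglongrightarrow> emeasure \<gamma> (\<Union>i. D i \<times> B)"
  proof (rule Lim_emeasure_incseq)
    show "range (\<lambda>i. D i \<times> B) \<subseteq> sets \<gamma>"
      using B inM by (auto simp: sets_\<gamma> finM_def)
    show "incseq (\<lambda>i. D i \<times> B)" using D(3) by (auto simp: incseq_def)
  qed
  also have "(\<Union>i. D i \<times> B) = space M \<times> B" using D(5) by auto
  finally have "(\<lambda>i. emeasure \<gamma> (D i \<times> B)) \<longlonglongrightarrow> emeasure \<gamma> (space M \<times> B)" .
  moreover have "emeasure \<gamma> (D i \<times> B) \<le> emeasure N B" for i
    using \<gamma>[OF inM B'] bimeasure_le(2)[OF inM B'] True
    by (simp add: emeasure_eq_ennreal_measure ennreal_leI less_top)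
  ultimately have "emeasure \<gamma> (space M \<times> B) \<le> emeasure N B" by (intro LIMSEQ_le_const2) auto
  then show ?thesis using marginal_snd[OF B] by simp
qed (simp add: not_less top_unique)

lemma sigma_finite_\<gamma>: "sigma_finite_measure \<gamma>"
proof -
  interpret m: sigma_finite_measure "distr \<gamma> M fst"
    by (rule sigma_finite_if_le[OF M.sigma_finite_measure_axioms]) (simp_all add: marginal_fst_le)
  obtain D :: "nat \<Rightarrow> 'a set" where D: "range D \<subseteq> sets M" "(\<Union>i. D i) = space M"
    "\<And>i. emeasure (distr \<gamma> M fst) (D i) \<noteq> \<infinity>"
    using m.sigma_finite_incseq by (metis sets_distr space_distr)
  have D_sets: "D i \<in> sets M" for i using D(1) by auto
  show ?thesis
  proof (rule sigma_finite_measure.intro, intro exI conjI ballI)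
    show "countable (range (\<lambda>i. D i \<times> space N))" by simp
    show "range (\<lambda>i. D i \<times> space N) \<subseteq> sets \<gamma>" using D_sets by (auto simp: sets_\<gamma>)
    show "\<Union>(range (\<lambda>i. D i \<times> space N)) = space \<gamma>" using D(2) by (auto simp: space_\<gamma>)
    fix a assume "a \<in> range (\<lambda>i. D i \<times> space N)"
    then obtain i where "a = D i \<times> space N" by blast
    then show "emeasure \<gamma> a \<noteq> \<infinity>" using D(3)[of i] marginal_fst[OF D_sets[of i]] by simp
  qed
qed

lemma \<gamma>_invariant:
  assumes T: "T \<in> M \<rightarrow>\<^sub>M M" "distr M M T = M" and S: "S \<in> N \<rightarrow>\<^sub>M N" "distr N N S = N"
    and vac: "\<And>A B. A \<in> sets M \<Longrightarrow> B \<in> sets N \<Longrightarrow>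
      vacancy P (T -` A \<inter> space M) (S -` B \<inter> space N) = vacancy P A B"
  shows "distr \<gamma> (M \<Otimes>\<^sub>M N) (map_prod T S) = \<gamma>"
proof (rule sym, rule measure_eqI_rectangles)
  show "sets \<gamma> = sets (M \<Otimes>\<^sub>M N)" by fact
  show "sets (distr \<gamma> (M \<Otimes>\<^sub>M N) (map_prod T S)) = sets (M \<Otimes>\<^sub>M N)" by simp
  fix A B assume AB: "A \<in> finM" "B \<in> finN"
  then show "emeasure \<gamma> (A \<times> B) \<noteq> \<infinity>" by (simp add: \<gamma>)
  define A' B' where "A' = T -` A \<inter> space M" and "B' = S -` B \<inter> space N"
  have s: "A \<in> sets M" "B \<in> sets N" using AB by (auto simp: finM_def finN_def)
  have eA: "emeasure M A' = emeasure M A" using emeasure_distr[OF T(1) s(1)] T(2) by (simp add: A'_def)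
  have eB: "emeasure N B' = emeasure N B" using emeasure_distr[OF S(1) s(2)] S(2) by (simp add: B'_def)
  have "A' \<in> sets M" "B' \<in> sets N" unfolding A'_def B'_def using T(1) S(1) s by (auto intro: measurable_sets)
  then have AB': "A' \<in> finM" "B' \<in> finN" using AB eA eB by (auto simp: finM_def finN_def)
  have mp: "map_prod T S \<in> \<gamma> \<rightarrow>\<^sub>M M \<Otimes>\<^sub>M N"
    unfolding measurable_cong_sets[OF sets_\<gamma> refl] map_prod_def using T(1) S(1) by measurable
  have "emeasure (distr \<gamma> (M \<Otimes>\<^sub>M N) (map_prod T S)) (A \<times> B) = emeasure \<gamma> (map_prod T S -` (A \<times> B) \<inter> space \<gamma>)"
    using mp s by (intro emeasure_distr) auto
  also have "map_prod T S -` (A \<times> B) \<inter> space \<gamma> = A' \<times> B'" by (auto simp: space_\<gamma> A'_def B'_def)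
  also have "emeasure \<gamma> (A' \<times> B') = ennreal (bimeasure A' B')" using AB' by (rule \<gamma>)
  also have "bimeasure A' B' = bimeasure A B"
    unfolding bimeasure_def using eA eB vac[OF s] by (simp add: measure_def A'_def B'_def)
  also have "ennreal (bimeasure A B) = emeasure \<gamma> (A \<times> B)" using AB by (rule \<gamma>[symmetric])
  finally show "emeasure \<gamma> (A \<times> B) = emeasure (distr \<gamma> (M \<Otimes>\<^sub>M N) (map_prod T S)) (A \<times> B)" ..
qed

lemma marginals_invariant:
  assumes T: "T \<in> M \<rightarrow>\<^sub>M M" and S: "S \<in> N \<rightarrow>\<^sub>M N" and inv: "distr \<gamma> (M \<Otimes>\<^sub>M N) (map_prod T S) = \<gamma>"
  shows "distr (distr \<gamma> M fst) M T = distr \<gamma> M fst" "distr (distr \<gamma> N snd) N S = distr \<gamma> N snd"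
proof -
  have mp: "map_prod T S \<in> \<gamma> \<rightarrow>\<^sub>M M \<Otimes>\<^sub>M N"
    unfolding measurable_cong_sets[OF sets_\<gamma> refl] map_prod_def using T S by measurable
  have f: "fst \<in> \<gamma> \<rightarrow>\<^sub>M M" "snd \<in> \<gamma> \<rightarrow>\<^sub>M N" by (simp_all add: measurable_cong_sets[OF sets_\<gamma> refl])
  have "distr (distr \<gamma> M fst) M T = distr \<gamma> M (T \<circ> fst)" using T f(1) by (rule distr_distr)
  also have "T \<circ> fst = fst \<circ> map_prod T S" by (simp add: fun_eq_iff)
  also have "distr \<gamma> M (fst \<circ> map_prod T S) = distr (distr \<gamma> (M \<Otimes>\<^sub>M N) (map_prod T S)) M fst"
    using mp by (intro distr_distr[symmetric]) simp
  finally show "distr (distr \<gamma> M fst) M T = distr \<gamma> M fst" by (simp add: inv)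
  have "distr (distr \<gamma> N snd) N S = distr \<gamma> N (S \<circ> snd)" using S f(2) by (rule distr_distr)
  also have "S \<circ> snd = snd \<circ> map_prod T S" by (simp add: fun_eq_iff)
  also have "distr \<gamma> N (snd \<circ> map_prod T S) = distr (distr \<gamma> (M \<Otimes>\<^sub>M N) (map_prod T S)) N snd"
    using mp by (intro distr_distr[symmetric]) simp
  finally show "distr (distr \<gamma> N snd) N S = distr \<gamma> N snd" by (simp add: inv)
qed

text \<open>
  By \<open>pair_law_eq_if_vacancy_eq\<close> it remains to compare avoidance functions, where the middle factor
  avoids \<open>(A, B)\<close> exactly if the Poisson process of intensity \<open>\<gamma>\<close> avoids \<open>A \<times> space N \<union> space M \<times> B\<close>,
  and to bound the multiple points of the convolution. In the first coordinate, for instance, the third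
  factor vanishes and the first two have intensities with sum \<open>M\<close>, so \<open>poly\<close> gives the bound \<open>M(A)\<^sup>2\<close>.
\<close>

theorem law_decomposition:
  assumes dM: "diffuse M" and dN: "diffuse N"
    and mult_fst: "\<And>A. A \<in> finM \<Longrightarrow> multiplicity_prob P A {} \<le> (measure M A)\<^sup>2"
    and mult_snd: "\<And>B. B \<in> finN \<Longrightarrow> multiplicity_prob P {} B \<le> (measure N B)\<^sup>2"
    and \<mu>: "sets \<mu>' = sets M" "M = add_measure \<mu>' (distr \<gamma> M fst)"
    and \<nu>: "sets \<nu>' = sets N" "N = add_measure \<nu>' (distr \<gamma> N snd)"
  shows "P = convolution_pair M N
          (convolution_pair M N
            (poisson_measure \<mu>' \<Otimes>\<^sub>M return (measures_space N) (null_measure N))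
            (distr (poisson_measure \<gamma>) (pair_measures_space M N) (marginals_map M N)))
          (return (measures_space M) (null_measure M) \<Otimes>\<^sub>M poisson_measure \<nu>')"
proof -
  define \<mu>t where "\<mu>t = distr \<gamma> M fst"
  define \<nu>t where "\<nu>t = distr \<gamma> N snd"
  have add_\<mu>: "emeasure M A = emeasure \<mu>' A + emeasure \<mu>t A" for A
  proof -
    have "emeasure (add_measure \<mu>' \<mu>t) A = emeasure \<mu>' A + emeasure \<mu>t A"
      by (rule emeasure_add_measure) (simp add: \<mu>t_def \<mu>(1))
    then show ?thesis unfolding \<mu>t_def by (simp flip: \<mu>(2))
  qed
  have add_\<nu>: "emeasure N B = emeasure \<nu>' B + emeasure \<nu>t B" for B
  proof -
    have "emeasure (add_measure \<nu>' \<nu>t) B = emeasure \<nu>' B + emeasure \<nu>t B"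
      by (rule emeasure_add_measure) (simp add: \<nu>t_def \<nu>(1))
    then show ?thesis unfolding \<nu>t_def by (simp flip: \<nu>(2))
  qed
  have le: "emeasure \<mu>' A \<le> emeasure M A" "emeasure \<nu>' B \<le> emeasure N B" for A B
    by (simp_all add: add_\<mu> add_\<nu>)
  have pl1: "poisson_like \<mu>' (poisson_measure \<mu>')"
    by (intro poisson_like_poisson_measure sigma_finite_if_le[OF M.sigma_finite_measure_axioms \<mu>(1)]
        diffuse_if_le[OF dM \<mu>(1)] le)
  have pl3: "poisson_like \<nu>' (poisson_measure \<nu>')"
    by (intro poisson_like_poisson_measure sigma_finite_if_le[OF N.sigma_finite_measure_axioms \<nu>(1)]
        diffuse_if_le[OF dN \<nu>(1)] le)
  have d\<gamma>: "diffuse \<gamma>"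
  proof (rule diffuse_if_marginal)
    show "diffuse (distr \<gamma> M fst)"
      by (rule diffuse_if_le[OF dM]) (simp_all add: marginal_fst_le)
    show "fst \<in> \<gamma> \<rightarrow>\<^sub>M M" by (simp add: measurable_cong_sets[OF sets_\<gamma> refl])
  qed
  have pl2: "poisson_like \<gamma> (poisson_measure \<gamma>)"
    by (intro poisson_like_poisson_measure sigma_finite_\<gamma> d\<gamma>)
  note ms = measures_space_cong[OF \<mu>(1)] measures_space_cong[OF \<nu>(1)]
  have P1: "prob_space (poisson_measure \<mu>')" "sets (poisson_measure \<mu>') = sets (measures_space M)"
    "space (poisson_measure \<mu>') = measures_on M"
    using poisson_likeD(1,2,3)[OF pl1] ms \<mu>(1) by (simp_all add: measures_on_def)
  have P3: "prob_space (poisson_measure \<nu>')" "sets (poisson_measure \<nu>') = sets (measures_space N)"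
    "space (poisson_measure \<nu>') = measures_on N"
    using poisson_likeD(1,2,3)[OF pl3] ms \<nu>(1) by (simp_all add: measures_on_def)
  have P2: "prob_space (poisson_measure \<gamma>)" by (rule poisson_likeD(1)[OF pl2])
  interpret P2: prob_space "poisson_measure \<gamma>" by fact
  define nM where "nM = return (measures_space M) (null_measure M)"
  define nN where "nN = return (measures_space N) (null_measure N)"
  have n: "prob_space nM" "prob_space nN" "sets nM = sets (measures_space M)" "sets nN = sets (measures_space N)"
    by (auto simp: nM_def nN_def intro!: prob_space_return)
  have nM: "measure nM {\<xi> \<in> space nM. emeasure \<xi> A = 0} = 1"
    "measure nM {\<xi> \<in> space nM. emeasure \<xi> A \<notin> {0, 1}} = 0" if "A \<in> sets M" for A
    using measure_return_null[OF that, of "{0}"] measure_return_null[OF that, of "- {0, 1}"]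
    by (simp_all add: nM_def)
  have nN: "measure nN {\<xi> \<in> space nN. emeasure \<xi> B = 0} = 1"
    "measure nN {\<xi> \<in> space nN. emeasure \<xi> B \<notin> {0, 1}} = 0" if "B \<in> sets N" for B
    using measure_return_null[OF that, of "{0}"] measure_return_null[OF that, of "- {0, 1}"]
    by (simp_all add: nN_def)
  define R1 where "R1 = poisson_measure \<mu>' \<Otimes>\<^sub>M nN"
  define R2 where "R2 = distr (poisson_measure \<gamma>) (pair_measures_space M N) (marginals_map M N)"
  define R3 where "R3 = nM \<Otimes>\<^sub>M poisson_measure \<nu>'"
  interpret PP1: pair_prob_space "poisson_measure \<mu>'" nN
    using P1(1) n(2) by (simp add: pair_prob_space_def pair_sigma_finite_def prob_space_imp_sigma_finite)
  interpret PP3: pair_prob_space nM "poisson_measure \<nu>'"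
    using P3(1) n(1) by (simp add: pair_prob_space_def pair_sigma_finite_def prob_space_imp_sigma_finite)
  have mm: "marginals_map M N \<in> poisson_measure \<gamma> \<rightarrow>\<^sub>M pair_measures_space M N"
    unfolding measurable_cong_sets[OF poisson_likeD(2)[OF pl2] refl]
    by (rule marginals_map_measurable_count_pair(1)[OF sets_\<gamma>])
  have R1: "prob_space R1" "sets R1 = sets (pair_measures_space M N)"
    unfolding R1_def using P1 n by (auto intro!: PP1.prob_space_axioms sets_pair_measure_cong)
  have R2: "prob_space R2" "sets R2 = sets (pair_measures_space M N)"
    unfolding R2_def using mm by (auto intro!: P2.prob_space_distr)
  have R3: "prob_space R3" "sets R3 = sets (pair_measures_space M N)"
    unfolding R3_def using P3 n by (auto intro!: PP3.prob_space_axioms sets_pair_measure_cong)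
  define R12 where "R12 = convolution_pair M N R1 R2"
  have R12: "prob_space R12" "sets R12 = sets (pair_measures_space M N)"
    unfolding R12_def using prob_space_convolution_pair[OF R1 R2] sets_convolution_pair[OF R1 R2] by auto
  define R where "R = convolution_pair M N R12 R3"
  have R: "prob_space R" "sets R = sets (pair_measures_space M N)"
    unfolding R_def using prob_space_convolution_pair[OF R12 R3] sets_convolution_pair[OF R12 R3] by auto
  have finA: "A \<in> sets M" "emeasure \<mu>' A < \<infinity>" "emeasure \<mu>t A < \<infinity>"
    "measure M A = measure \<mu>' A + measure \<mu>t A" if "A \<in> finM" for A
  proof -
    show "A \<in> sets M" using that by (simp add: finM_def)
    have "emeasure \<mu>' A + emeasure \<mu>t A < \<infinity>" using that add_\<mu>[of A] by (simp add: finM_def)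
    then show fin: "emeasure \<mu>' A < \<infinity>" "emeasure \<mu>t A < \<infinity>" by (auto simp: less_top)
    show "measure M A = measure \<mu>' A + measure \<mu>t A"
      using fin by (simp add: measure_def add_\<mu> enn2real_plus)
  qed
  have finB: "B \<in> sets N" "emeasure \<nu>' B < \<infinity>" "emeasure \<nu>t B < \<infinity>"
    "measure N B = measure \<nu>' B + measure \<nu>t B" if "B \<in> finN" for B
  proof -
    show "B \<in> sets N" using that by (simp add: finN_def)
    have "emeasure \<nu>' B + emeasure \<nu>t B < \<infinity>" using that add_\<nu>[of B] by (simp add: finN_def)
    then show fin: "emeasure \<nu>' B < \<infinity>" "emeasure \<nu>t B < \<infinity>" by (auto simp: less_top)
    show "measure N B = measure \<nu>' B + measure \<nu>t B"
      using fin by (simp add: measure_def add_\<nu> enn2real_plus)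
  qed
  have v1: "vacancy R1 A B = exp (- measure \<mu>' A)" if "A \<in> finM" "B \<in> finN" for A B
    unfolding R1_def using vacancy_product[OF P1(1,2) n(2,4) finA(1)[OF that(1)] finB(1)[OF that(2)]]
      nN(1)[OF finB(1)[OF that(2)]] poisson_likeD(4)[OF pl1] finA(1,2)[OF that(1)] \<mu>(1) by simp
  have v3: "vacancy R3 A B = exp (- measure \<nu>' B)" if "A \<in> finM" "B \<in> finN" for A B
    unfolding R3_def using vacancy_product[OF n(1,3) P3(1,2) finA(1)[OF that(1)] finB(1)[OF that(2)]]
      nM(1)[OF finA(1)[OF that(1)]] poisson_likeD(4)[OF pl3] finB(1,2)[OF that(2)] \<nu>(1) by simp
  have m1: "multiplicity_prob R1 A {} \<le> (measure \<mu>' A)\<^sup>2" "multiplicity_prob R3 A {} \<le> 0" if "A \<in> finM" for A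
    unfolding R1_def R3_def
    using multiplicity_prob_product_fst[OF P1(1,2) n(2,4) finA(1)[OF that] sets.empty_sets]
      multiplicity_prob_product_fst[OF n(1,3) P3(1,2) finA(1)[OF that] sets.empty_sets]
      nM(2)[OF finA(1)[OF that]] poisson_likeD(5)[OF pl1] finA(1,2)[OF that] \<mu>(1) by simp_all
  have m3: "multiplicity_prob R3 {} B \<le> (measure \<nu>' B)\<^sup>2" "multiplicity_prob R1 {} B \<le> 0" if "B \<in> finN" for B
    unfolding R1_def R3_def
    using multiplicity_prob_product_snd[OF n(1,3) P3(1,2) sets.empty_sets finB(1)[OF that]]
      multiplicity_prob_product_snd[OF P1(1,2) n(2,4) sets.empty_sets finB(1)[OF that]]
      nN(2)[OF finB(1)[OF that]] poisson_likeD(5)[OF pl3] finB(1,2)[OF that] \<nu>(1) by simp_all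
  have law2: "measure R2 {p \<in> space R2. count_pair A B p \<in> S} =
      measure (poisson_measure \<gamma>) {\<zeta> \<in> space (poisson_measure \<gamma>).
        emeasure \<zeta> (A \<times> space N) + emeasure \<zeta> (space M \<times> B) \<in> S}"
    if "A \<in> sets M" "B \<in> sets N" "S \<in> sets borel" for A B S
  proof -
    have "measure R2 {p \<in> space R2. count_pair A B p \<in> S} =
        measure (poisson_measure \<gamma>) {\<zeta> \<in> space (poisson_measure \<gamma>). count_pair A B (marginals_map M N \<zeta>) \<in> S}"
      unfolding R2_def using mm that by (rule measure_distr_count_pair)
    also have "{\<zeta> \<in> space (poisson_measure \<gamma>). count_pair A B (marginals_map M N \<zeta>) \<in> S} =
        {\<zeta> \<in> space (poisson_measure \<gamma>). emeasure \<zeta> (A \<times> space N) + emeasure \<zeta> (space M \<times> B) \<in> S}"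
      using marginals_map_measurable_count_pair(2)[OF sets_\<gamma> _ that(1,2)] poisson_likeD(3)[OF pl2] by auto
    finally show ?thesis .
  qed
  have cylA: "A \<times> space N \<in> sets \<gamma>" "emeasure \<gamma> (A \<times> space N) < \<infinity>"
    "measure \<gamma> (A \<times> space N) = measure \<mu>t A" if "A \<in> finM" for A
    using finA[OF that] marginal_fst[of A] by (auto simp: sets_\<gamma> \<mu>t_def measure_def)
  have cylB: "space M \<times> B \<in> sets \<gamma>" "emeasure \<gamma> (space M \<times> B) < \<infinity>"
    "measure \<gamma> (space M \<times> B) = measure \<nu>t B" if "B \<in> finN" for B
    using finB[OF that] marginal_snd[of B] by (auto simp: sets_\<gamma> \<nu>t_def measure_def)
  have v2: "vacancy R2 A B = exp (- (measure \<mu>t A + measure \<nu>t B - bimeasure A B))"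
    if AB: "A \<in> finM" "B \<in> finN" for A B
  proof -
    let ?U = "A \<times> space N \<union> space M \<times> B"
    have U: "?U \<in> sets \<gamma>" using cylA(1)[OF AB(1)] cylB(1)[OF AB(2)] by (rule sets.Un)
    have fU: "emeasure \<gamma> ?U < \<infinity>"
      using emeasure_subadditive[OF cylA(1)[OF AB(1)] cylB(1)[OF AB(2)]] cylA(2)[OF AB(1)] cylB(2)[OF AB(2)]
      by (auto intro: le_less_trans)
    have "vacancy R2 A B = measure (poisson_measure \<gamma>) {\<zeta> \<in> space (poisson_measure \<gamma>).
        emeasure \<zeta> (A \<times> space N) + emeasure \<zeta> (space M \<times> B) \<in> {0}}"
      unfolding vacancy_def using law2[OF finA(1)[OF AB(1)] finB(1)[OF AB(2)], of "{0}"] by simp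
    also have "{\<zeta> \<in> space (poisson_measure \<gamma>). emeasure \<zeta> (A \<times> space N) + emeasure \<zeta> (space M \<times> B) \<in> {0}} =
        {\<zeta> \<in> space (poisson_measure \<gamma>). emeasure \<zeta> ?U = 0}"
    proof (rule Collect_cong)
      fix \<zeta>
      have "emeasure \<zeta> ?U = 0 \<longleftrightarrow> emeasure \<zeta> (A \<times> space N) = 0 \<and> emeasure \<zeta> (space M \<times> B) = 0"
        if "\<zeta> \<in> space (poisson_measure \<gamma>)"
        using that cylA(1)[OF AB(1)] cylB(1)[OF AB(2)] poisson_likeD(3)[OF pl2]
        by (intro emeasure_Un_eq_0_iff) (auto simp: measures_on_def)
      then show "\<zeta> \<in> space (poisson_measure \<gamma>) \<and> emeasure \<zeta> (A \<times> space N) + emeasure \<zeta> (space M \<times> B) \<in> {0} \<longleftrightarrow>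
          \<zeta> \<in> space (poisson_measure \<gamma>) \<and> emeasure \<zeta> ?U = 0" by auto
    qed
    also have "measure (poisson_measure \<gamma>) \<dots> = exp (- measure \<gamma> ?U)"
      by (rule poisson_likeD(4)[OF pl2 U fU])
    also have "measure \<gamma> ?U = measure \<gamma> (A \<times> space N) + measure \<gamma> (space M \<times> B) -
        measure \<gamma> ((A \<times> space N) \<inter> (space M \<times> B))"
      using cylA[OF AB(1)] cylB[OF AB(2)] by (intro measure_Un3) (auto simp: fmeasurable_def)
    also have "(A \<times> space N) \<inter> (space M \<times> B) = A \<times> B"
      using finA(1)[OF AB(1)] finB(1)[OF AB(2)] by (auto dest: sets.sets_into_space)
    also have "measure \<gamma> (A \<times> B) = bimeasure A B"
      using \<gamma>[OF AB] bimeasure_nonneg[OF AB] by (simp add: measure_def)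
    finally show ?thesis using cylA(3)[OF AB(1)] cylB(3)[OF AB(2)] by simp
  qed
  have m2A: "multiplicity_prob R2 A {} \<le> (measure \<mu>t A)\<^sup>2" if "A \<in> finM" for A
    using law2[OF finA(1)[OF that] sets.empty_sets, of "- {0, 1}"]
      poisson_likeD(5)[OF pl2 cylA(1,2)[OF that]] cylA(3)[OF that]
    by (simp add: multiplicity_prob_def)
  have m2B: "multiplicity_prob R2 {} B \<le> (measure \<nu>t B)\<^sup>2" if "B \<in> finN" for B
    using law2[OF sets.empty_sets finB(1)[OF that], of "- {0, 1}"]
      poisson_likeD(5)[OF pl2 cylB(1,2)[OF that]] cylB(3)[OF that]
    by (simp add: multiplicity_prob_def)
  have e0: "bimeasure A {} = 0" "bimeasure {} B = 0" if "A \<in> finM" "B \<in> finN" for A B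
    using bimeasure_le[of A "{}"] bimeasure_nonneg[of A "{}"] bimeasure_le[of "{}" B] bimeasure_nonneg[of "{}" B] that
    by auto
  have poly: "x\<^sup>2 + y\<^sup>2 + (1 - exp (- x)) * (1 - exp (- y)) \<le> (x + y)\<^sup>2" if "0 \<le> x" "0 \<le> y" for x y :: real
  proof -
    have "(1 - exp (- x)) * (1 - exp (- y)) \<le> x * y"
      using that one_minus_exp_le by (intro mult_mono) auto
    moreover have "0 \<le> x * y" using that by simp
    ultimately show ?thesis by (simp add: power2_sum)
  qed
  have "P = R"
  proof (rule pair_law_eq_if_vacancy_eq[OF M.sigma_finite_measure_axioms dM N.sigma_finite_measure_axioms dN
        P.prob_space_axioms sets_P R])
    fix A B assume "A \<in> sets M" "emeasure M A < \<infinity>" "B \<in> sets N" "emeasure N B < \<infinity>"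
    then have AB: "A \<in> finM" "B \<in> finN" by (auto simp: finM_def finN_def)
    have "vacancy R A B = vacancy R1 A B * vacancy R2 A B * vacancy R3 A B"
      using vacancy_convolution_pair[OF R12 R3 finA(1)[OF AB(1)] finB(1)[OF AB(2)]]
        vacancy_convolution_pair[OF R1 R2 finA(1)[OF AB(1)] finB(1)[OF AB(2)]]
      by (simp add: R_def R12_def)
    also have "\<dots> = exp (- (measure M A + measure N B - bimeasure A B))"
      by (simp add: v1[OF AB] v2[OF AB] v3[OF AB] finA(4)[OF AB(1)] finB(4)[OF AB(2)] exp_add[symmetric])
    also have "\<dots> = vacancy P A B" by (rule vacancy_bimeasure[OF AB, symmetric])
    finally show "vacancy P A B = vacancy R A B" by simp
  next
    fix A Q assume Q: "Q \<in> {P, R}" and "A \<in> sets M" "emeasure M A < \<infinity>"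
    then have A: "A \<in> finM" by (simp add: finM_def)
    have "multiplicity_prob R12 A {} \<le> (measure M A)\<^sup>2"
      using multiplicity_prob_convolution_pair[OF R1 R2 finA(1)[OF A] sets.empty_sets]
        m1(1)[OF A] m2A[OF A] poly[of "measure \<mu>' A" "measure \<mu>t A"]
      by (simp add: R12_def v1[OF A empty_fin(2)] v2[OF A empty_fin(2)] e0(1)[OF A empty_fin(2)] finA(4)[OF A])
    then have "multiplicity_prob R A {} \<le> (measure M A)\<^sup>2"
      using multiplicity_prob_convolution_pair[OF R12 R3 finA(1)[OF A] sets.empty_sets] m1(2)[OF A]
      by (simp add: R_def v3[OF A empty_fin(2)])
    then show "multiplicity_prob Q A {} \<le> (measure M A)\<^sup>2" using Q mult_fst[OF A] by auto
  next
    fix B Q assume Q: "Q \<in> {P, R}" and "B \<in> sets N" "emeasure N B < \<infinity>"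
    then have B: "B \<in> finN" by (simp add: finN_def)
    have v12: "vacancy R12 {} B = exp (- measure \<nu>t B)"
      using vacancy_convolution_pair[OF R1 R2 sets.empty_sets finB(1)[OF B]]
      by (simp add: R12_def v1[OF empty_fin(1) B] v2[OF empty_fin(1) B] e0(2)[OF empty_fin(1) B])
    have "multiplicity_prob R12 {} B \<le> (measure \<nu>t B)\<^sup>2"
      using multiplicity_prob_convolution_pair[OF R1 R2 sets.empty_sets finB(1)[OF B]] m3(2)[OF B] m2B[OF B]
      by (simp add: R12_def v1[OF empty_fin(1) B])
    then have "multiplicity_prob R {} B \<le> (measure N B)\<^sup>2"
      using multiplicity_prob_convolution_pair[OF R12 R3 sets.empty_sets finB(1)[OF B]] m3(1)[OF B]
        poly[of "measure \<nu>t B" "measure \<nu>' B"]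
      by (simp add: R_def v12 v3[OF empty_fin(1) B] finB(4)[OF B] add.commute)
    then show "multiplicity_prob Q {} B \<le> (measure N B)\<^sup>2" using Q mult_snd[OF B] by auto
  qed
  then show ?thesis by (simp add: R_def R12_def R1_def R2_def R3_def nM_def nN_def)
qed

end

end

theorem theorem4p2:
  fixes M :: "'a measure" and N :: "'b measure"
    and T :: "'a \<Rightarrow> 'a" and S :: "'b \<Rightarrow> 'b"
    and P :: "('a measure \<times> 'b measure) measure"
  assumes "sigma_finite_lebesgue_space M" and "continuous_measure M"
    and "emeasure M (space M) = \<infinity>" and "automorphism M T"
    and "sigma_finite_lebesgue_space N" and "continuous_measure N"
    and "emeasure N (space N) = \<infinity>" and "automorphism N S"
    and "poissonian_joining M T N S P"
  shows "\<exists>\<mu>' \<mu>t \<nu>' \<nu>t \<gamma>.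
    invariant_measure M T \<mu>' \<and> invariant_measure M T \<mu>t \<and> M = add_measure \<mu>' \<mu>t \<and>
    invariant_measure N S \<nu>' \<and> invariant_measure N S \<nu>t \<and> N = add_measure \<nu>' \<nu>t \<and>
    joining \<mu>t T \<nu>t S \<gamma> \<and>
    P = convolution_pair M N
          (convolution_pair M N
            (poisson_measure \<mu>' \<Otimes>\<^sub>M return (measures_space N) (null_measure N))
            (distr (poisson_measure \<gamma>) (pair_measures_space M N) (marginals_map M N)))
          (return (measures_space M) (null_measure M) \<Otimes>\<^sub>M poisson_measure \<nu>')"
proof -
  have sfM: "sigma_finite_measure M" and sfN: "sigma_finite_measure N"
    using assms by (auto simp: sigma_finite_lebesgue_space_def)
  have dM: "diffuse M" and dN: "diffuse N" using assms by (auto intro: diffuse_lebesgue_space)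
  have T: "T \<in> M \<rightarrow>\<^sub>M M" "distr M M T = M" and S: "S \<in> N \<rightarrow>\<^sub>M N" "distr N N S = N"
    using assms(4,8) by (auto simp: automorphism_def invariant_measure_def)
  note plM = poisson_like_poisson_measure[OF sfM dM] and plN = poisson_like_poisson_measure[OF sfN dN]
  have P: "prob_space P" and div: "infinitely_divisible M N P"
    and invP: "sets P = sets (poisson_measure M \<Otimes>\<^sub>M poisson_measure N)"
      "distr P (poisson_measure M \<Otimes>\<^sub>M poisson_measure N) (map_prod (suspension_map M T) (suspension_map N S)) = P"
    and margP: "distr P (poisson_measure M) fst = poisson_measure M" "distr P (poisson_measure N) snd = poisson_measure N"
    using assms(9) by (auto simp: poissonian_joining_def joining_def invariant_measure_def)
  have sets_pp: "sets (poisson_measure M \<Otimes>\<^sub>M poisson_measure N) = sets (pair_measures_space M N)"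
    by (intro sets_pair_measure_cong poisson_likeD(2) plM plN)
  have sets_P: "sets P = sets (pair_measures_space M N)" using invP(1) sets_pp by simp
  have fst_law: "measure P {p \<in> space P. count_pair A {} p \<in> B} =
      measure (poisson_measure M) {\<xi> \<in> space (poisson_measure M). emeasure \<xi> A \<in> B}"
    if "A \<in> sets M" "B \<in> sets borel" for A B
    using measure_fst_marginal[OF sets_P poisson_likeD(2)[OF plM] that] by (simp add: margP)
  have snd_law: "measure P {p \<in> space P. count_pair {} A p \<in> B} =
      measure (poisson_measure N) {\<xi> \<in> space (poisson_measure N). emeasure \<xi> A \<in> B}"
    if "A \<in> sets N" "B \<in> sets borel" for A B
    using measure_snd_marginal[OF sets_P poisson_likeD(2)[OF plN] that] by (simp add: margP)
  interpret divisible_pair M N P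
  proof (intro divisible_pair.intro divisible_pair_axioms.intro)
    show "vacancy P A {} = exp (- measure M A)" if "A \<in> sets M" "emeasure M A < \<infinity>" for A
      using fst_law[OF that(1), of "{0}"] poisson_likeD(4)[OF plM that] by (simp add: vacancy_def)
    show "vacancy P {} A = exp (- measure N A)" if "A \<in> sets N" "emeasure N A < \<infinity>" for A
      using snd_law[OF that(1), of "{0}"] poisson_likeD(4)[OF plN that] by (simp add: vacancy_def)
  qed fact+
  obtain \<gamma> where sets_\<gamma>: "sets \<gamma> = sets (M \<Otimes>\<^sub>M N)"
    and \<gamma>: "\<And>A B. A \<in> finM \<Longrightarrow> B \<in> finN \<Longrightarrow> emeasure \<gamma> (A \<times> B) = ennreal (bimeasure A B)"
    using bimeasure_extends by blast
  define \<mu>t where "\<mu>t = distr \<gamma> M fst"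
  define \<nu>t where "\<nu>t = distr \<gamma> N snd"
  have sets_t: "sets \<mu>t = sets M" "sets \<nu>t = sets N" by (simp_all add: \<mu>t_def \<nu>t_def)
  have vac: "vacancy P (T -` A \<inter> space M) (S -` B \<inter> space N) = vacancy P A B"
    if AB: "A \<in> sets M" "B \<in> sets N" for A B
  proof -
    let ?F = "map_prod (suspension_map M T) (suspension_map N S)"
    have F: "?F \<in> P \<rightarrow>\<^sub>M pair_measures_space M N"
      unfolding measurable_cong_sets[OF sets_P refl] map_prod_def
      using suspension_map_measurable_emeasure(1)[OF T(1)] suspension_map_measurable_emeasure(1)[OF S(1)] by measurable
    have PF: "distr P (pair_measures_space M N) ?F = P"
      by (subst distr_cong[OF refl sets_pp[symmetric] refl]) (rule invP(2))
    have "vacancy P A B = measure P {p \<in> space P. count_pair A B (?F p) \<in> {0}}"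
      using measure_distr_count_pair[OF F AB, of "{0}"] unfolding PF by (simp add: vacancy_def)
    also have "{p \<in> space P. count_pair A B (?F p) \<in> {0}} =
        {p \<in> space P. count_pair (T -` A \<inter> space M) (S -` B \<inter> space N) p \<in> {0}}"
      using sets_eq_imp_space_eq[OF sets_P] suspension_map_measurable_emeasure(2)[OF T(1) _ AB(1)]
        suspension_map_measurable_emeasure(2)[OF S(1) _ AB(2)]
      by (auto simp: space_pair_measures_space count_pair_def)
    finally show ?thesis by (simp add: vacancy_def)
  qed
  have inv: "distr \<gamma> (M \<Otimes>\<^sub>M N) (map_prod T S) = \<gamma>"
    using \<gamma>_invariant[OF sets_\<gamma> \<gamma> T S vac] .
  have inv_t: "distr \<mu>t M T = \<mu>t" "distr \<nu>t N S = \<nu>t"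
    using marginals_invariant[OF sets_\<gamma> \<gamma> T(1) S(1) inv] by (simp_all add: \<mu>t_def \<nu>t_def)
  have leM: "emeasure \<mu>t A \<le> emeasure M A" if "A \<in> sets M" for A
    unfolding \<mu>t_def by (rule marginal_fst_le[OF sets_\<gamma> \<gamma> that])
  have leN: "emeasure \<nu>t A \<le> emeasure N A" if "A \<in> sets N" for A
    unfolding \<nu>t_def by (rule marginal_snd_le[OF sets_\<gamma> \<gamma> that])
  obtain \<mu>' where \<mu>': "sets \<mu>' = sets M" "M = add_measure \<mu>' \<mu>t"
    by (rule complementary_measure[OF sfM sets_t(1) leM])
  obtain \<nu>' where \<nu>': "sets \<nu>' = sets N" "N = add_measure \<nu>' \<nu>t"
    by (rule complementary_measure[OF sfN sets_t(2) leN])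
  have "invariant_measure M T \<mu>t" "invariant_measure N S \<nu>t"
    using inv_t sets_t by (simp_all add: invariant_measure_def)
  moreover have "invariant_measure M T \<mu>'" "invariant_measure N S \<nu>'"
    using invariant_complement[OF sfM T sets_t(1) inv_t(1) \<mu>'] invariant_complement[OF sfN S sets_t(2) inv_t(2) \<nu>']
      \<mu>'(1) \<nu>'(1) by (simp_all add: invariant_measure_def)
  moreover have "joining \<mu>t T \<nu>t S \<gamma>"
  proof -
    have s: "sets (\<mu>t \<Otimes>\<^sub>M \<nu>t) = sets (M \<Otimes>\<^sub>M N)" using sets_t by (rule sets_pair_measure_cong)
    have "distr \<gamma> (\<mu>t \<Otimes>\<^sub>M \<nu>t) (map_prod T S) = distr \<gamma> (M \<Otimes>\<^sub>M N) (map_prod T S)"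
      by (intro distr_cong s refl)
    moreover have "distr \<gamma> \<mu>t fst = distr \<gamma> M fst" by (intro distr_cong sets_t refl)
    moreover have "distr \<gamma> \<nu>t snd = distr \<gamma> N snd" by (intro distr_cong sets_t refl)
    ultimately show ?thesis
      unfolding joining_def invariant_measure_def using inv s sets_\<gamma> by (simp add: \<mu>t_def \<nu>t_def)
  qed
  moreover have "P = convolution_pair M N
          (convolution_pair M N
            (poisson_measure \<mu>' \<Otimes>\<^sub>M return (measures_space N) (null_measure N))
            (distr (poisson_measure \<gamma>) (pair_measures_space M N) (marginals_map M N)))
          (return (measures_space M) (null_measure M) \<Otimes>\<^sub>M poisson_measure \<nu>')"
  proof (rule law_decomposition[OF sets_\<gamma> \<gamma> dM dN])
    show "multiplicity_prob P A {} \<le> (measure M A)\<^sup>2" if "A \<in> finM" for A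
      using that fst_law[of A "- {0, 1}"] poisson_likeD(5)[OF plM, of A]
      by (simp add: multiplicity_prob_def finM_def)
    show "multiplicity_prob P {} B \<le> (measure N B)\<^sup>2" if "B \<in> finN" for B
      using that snd_law[of B "- {0, 1}"] poisson_likeD(5)[OF plN, of B]
      by (simp add: multiplicity_prob_def finN_def)
  qed (assumption | rule \<mu>'(1) \<mu>'(2)[unfolded \<mu>t_def] \<nu>'(1) \<nu>'(2)[unfolded \<nu>t_def])+
  ultimately show ?thesis using \<mu>'(2) \<nu>'(2) by blast
qed

end
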